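(* Consider the sequence $\{(X^{(t)},\Theta^{(t)},\Omega^{(t)})\}$ generated by the inexact proximal augmented Lagrangian method described in the context, and suppose that $\tau_t\downarrow\tau_\infty>0$ and $\sigma_t\uparrow\sigma_\infty\le\infty$. Assume the KKT system $0\in\mathcal{T}(X,\Theta,\Omega)$ has a (necessarily unique) solution $(\bar X,\bar\Theta,\bar\Omega)$. (i) Suppose the iterates satisfy stopping criterion (A) at every iteration. Then the sequence $\{(X^{(t)},\Theta^{(t)},\Omega^{(t)})\}$ is bounded. Moreover, $\{X^{(t)}\}$ converges to an optimal solution of the dual problem (D) and $\{\Theta^{(t)}\}$ converges to an optimal solution of the primal problem (P). (ii) Suppose the iterates satisfy both stopping criteria (A) and (B) at every iteration. Let $r>0$, and let $\kappa>0$ be a constant such that $$\|(X,\Theta,\Omega)-(\bar X,\bar\Theta,\bar\Omega)\|\le\kappa\,\mathrm{dist}(0,\mathcal{T}(X,\Theta,\Omega))$$ for all $(X,\Theta,\Omega)\in\mathcal{Y}^3$ with $\|(X,\Theta,\Omega)-(\bar X,\bar\Theta,\bar\Omega)\|\le r$. Assume that the initial point satisfies $\|(X^{(0)},\Theta^{(0)},\Omega^{(0)})-(\bar X,\bar\Theta,\bar\Omega)\|_{\mathcal{Q}_0}\le r-\sum_{i=0}^\infty\varepsilon_i$. Then for all $t\ge0$, $$\|(X^{(t+1)},\Theta^{(t+1)},\Omega^{(t+1)})-(\bar X,\bar\Theta,\bar\Omega)\|_{\mathcal{Q}_t}\le\zeta_t\,\|(X^{(t)},\Theta^{(t)},\Omega^{(t)})-(\bar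 X,\bar\Theta,\bar\Omega)\|_{\mathcal{Q}_t},$$ where $$\zeta_t:=\frac{1}{1-\delta_t}\left(\delta_t+\frac{(1+\delta_t)\kappa\gamma_t}{\sqrt{\sigma_t^2+\kappa^2\gamma_t^2}}\right)\longrightarrow\zeta_\infty:=\frac{\kappa\gamma_\infty}{\sqrt{\sigma_\infty^2+\kappa^2\gamma_\infty^2}}<1\quad\text{as }t\to\infty,$$ with $\gamma_t:=\max(\tau_t,1)$ and $\gamma_\infty:=\max(\tau_\infty,1)$ (and $\zeta_\infty=0$ if $\sigma_\infty=\infty$).
   Context: Setting. Let $p,K$ be positive integers, $\mathcal{Y}=(\mathbb{S}^p)^K$ the product of $K$ copies of the space of real symmetric $p\times p$ matrices, and $\mathcal{Y}_{++}=(\mathbb{S}^p_{++})^K$ (positive definite matrices), with the trace inner product and its norm $\|\cdot\|$ on $\mathcal{Y}$ and on $\mathcal{Y}^3$. Let $S=(S^1,\dots,S^K)$ be sample covariance matrices (symmetric positive semidefinite) and $\mu_1,\mu_2>0$. Let $h(A)=-\log\det A$ for $A\in\mathbb{S}^p_{++}$ and $h(A)=+\infty$ otherwise. Define $$L(\Theta)=\sum_{k=1}^K\big(h(\Theta^k)+\langle S^k,\Theta^k\rangle\big),\qquad \mathcal{P}(\Theta)=\mu_1\sum_{i\ne j}\sum_{k=1}^K|\Theta^k_{ij}|+\mu_2\sum_{i\ne j}\sum_{k<k'}|\Theta^k_{ij}-\Theta^{k'}_{ij}|.$$ Primal problem (P): $\min_{\Theta,\Omega\in\mathcal{Y}}\{L(\Theta)+\mathcal{P}(\Omega):\Theta=\Omega\}$.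 Dual problem (D): $\max_{X\in\mathcal{Y}}\,-\{L^*(-X)+\mathcal{P}^*(X)\}$, where $^*$ denotes the convex conjugate. The Lagrangian is $\mathcal{L}(X;\Theta,\Omega)=-L(\Theta)-\mathcal{P}(\Omega)-\langle\Theta,X\rangle+\langle\Omega,X\rangle$. For $\sigma>0$ the augmented Lagrangian is $$\mathcal{L}_\sigma(X;\Theta,\Omega)=\sup_{Z_1,Z_2\in\mathcal{Y}}\Big\{\mathcal{L}(X;Z_1,Z_2)-\tfrac{1}{2\sigma}\|Z_1-\Theta\|^2-\tfrac1{2\sigma}\|Z_2-\Omega\|^2\Big\}.$$ The operator $\mathcal{T}:\mathcal{Y}^3\rightrightarrows\mathcal{Y}^3$ is defined by: $(X',\Theta',\Omega')\in\mathcal{T}(X,\Theta,\Omega)$ if and only if $\Theta\in\mathcal{Y}_{++}$, $X'=-\Theta+\Omega$, $(\Theta')^k=-(\Theta^k)^{-1}+X^k+S^k$ for $k=1,\dots,K$, and $\Omega'\in\partial\mathcal{P}(\Omega)-X$. The KKT system is $0\in\mathcal{T}(X,\Theta,\Omega)$. $\mathrm{dist}(0,\emptyset)=+\infty$. Proximal mapping: $\mathrm{Prox}_f(x)=\arg\min_y\{f(y)+\frac12\|y-x\|^2\}$. Algorithm. Given $\sigma_0,\tau_0>0$ and $(X^{(0)},\Theta^{(0)},\Omega^{(0)})\in\mathcal{Y}_{++}^3$, for $t=0,1,2,\dots$: 1. Compute an approximate minimizer $X^{(t+1)}$ of $\Gamma_t(X):=\mathcal{L}_{\sigma_t}(X;\Theta^{(t)},\Omega^{(t)})+\frac{\tau_t}{2\sigma_t}\|X-X^{(t)}\|^2$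 satisfying the relevant stopping criteria below. 2. Set $\Omega^{(t+1)}=\mathrm{Prox}_{\sigma_t\mathcal{P}}(\Omega^{(t)}+\sigma_tX^{(t+1)})$ and $(\Theta^k)^{(t+1)}=\mathrm{Prox}_{\sigma_th}\big((\Theta^k)^{(t)}-\sigma_t((X^k)^{(t+1)}+S^k)\big)$, $k=1,\dots,K$. 3. Choose $\sigma_{t+1}$ and $\tau_{t+1}$, where the positive sequence $\{\sigma_t\}$ increases (weakly) to $\sigma_\infty\le\infty$ and $\{\tau_t\}$ decreases (weakly) to $\tau_\infty>0$. Let $\mathcal{Q}_t=\mathrm{Diag}(\tau_t\mathcal{I},\mathcal{I},\mathcal{I})$ acting on $\mathcal{Y}^3$, and $\|z\|_{\mathcal{Q}_t}=\sqrt{\langle z,\mathcal{Q}_tz\rangle}$. Let $\{\varepsilon_t\}$ and $\{\delta_t\}$ be given positive summable sequences with each $\delta_t<1$. The stopping criteria at iteration $t$ are (A) $\|\nabla\Gamma_t(X^{(t+1)})\|\le\dfrac{\min\{\sqrt{\tau_t},1\}}{\sigma_t}\,\varepsilon_t$; (B) $\|\nabla\Gamma_t(X^{(t+1)})\|\le\dfrac{\delta_t\min\{\sqrt{\tau_t},1\}}{\sigma_t}\,\|(X^{(t+1)},\Theta^{(t+1)},\Omega^{(t+1)})-(X^{(t)},\Theta^{(t)},\Omega^{(t)})\|_{\mathcal{Q}_t}$. *)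

theory Defs
  imports "HOL-Analysis.Analysis"
begin

text \<open>The inner product and norm that the library puts on \<open>real^'p^'p\<close> and on tuples
  \<open>real^'p^'p^'k\<close> are the trace inner product and the Frobenius norm, and those on
  nested pairs are the Euclidean product ones. Symmetric matrices form a subspace,
  and every optimisation below is over that subspace. The \<open>K\<close> classes are indexed by a
  finite linearly ordered type \<open>'k\<close>, so that sums over \<open>k < k'\<close> make sense.\<close>

type_synonym ('p, 'k) mats = "real^'p^'p^'k"

definition sym_mats :: "(real^'p^'p) set" where
  "sym_mats = {A. transpose A = A}"

definition psd_mats :: "(real^'p^'p) set" where
  "psd_mats = {A \<in> sym_mats. \<forall>x. 0 \<le> x \<bullet> (A *v x)}"

definition pd_mats :: "(real^'p^'p) set" where
  "pd_mats = {A \<in> sym_mats. \<forall>x. x \<noteq> 0 \<longrightarrow> 0 < x \<bullet> (A *v x)}"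

definition Y :: "('p::finite, 'k::finite) mats set" where
  "Y = {A. \<forall>k. A $ k \<in> sym_mats}"

definition Ypd :: "('p::finite, 'k::finite) mats set" where
  "Ypd = {A. \<forall>k. A $ k \<in> pd_mats}"


definition neg_logdet :: "real^'p^'p \<Rightarrow> ereal" where
  "neg_logdet A = (if A \<in> pd_mats then ereal (- ln (det A)) else \<infinity>)"

definition loss :: "('p::finite, 'k::finite) mats \<Rightarrow> ('p, 'k) mats \<Rightarrow> ereal" where
  "loss S \<Theta> = (\<Sum>k\<in>UNIV. neg_logdet (\<Theta> $ k) + ereal (S $ k \<bullet> \<Theta> $ k))"

definition penalty :: "real \<Rightarrow> real \<Rightarrow> ('p::finite, 'k::{finite,linorder}) mats \<Rightarrow> real" where
  "penalty \<mu>1 \<mu>2 \<Theta> =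
     \<mu>1 * (\<Sum>(i, j)\<in>{(i, j). i \<noteq> j}. \<Sum>k\<in>UNIV. \<bar>\<Theta> $ k $ i $ j\<bar>) +
     \<mu>2 * (\<Sum>(i, j)\<in>{(i, j). i \<noteq> j}. \<Sum>(k, k')\<in>{(k, k'). k < k'}.
            \<bar>\<Theta> $ k $ i $ j - \<Theta> $ k' $ i $ j\<bar>)"


text \<open>Convex analysis relative to an ambient subspace \<open>V\<close>.\<close>

definition conjugate :: "'a::real_inner set \<Rightarrow> ('a \<Rightarrow> ereal) \<Rightarrow> 'a \<Rightarrow> ereal" where
  "conjugate V f y = (SUP x\<in>V. ereal (y \<bullet> x) - f x)"

definition subdiff :: "'a::real_inner set \<Rightarrow> ('a \<Rightarrow> real) \<Rightarrow> 'a \<Rightarrow> 'a set" where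
  "subdiff V f x = {g \<in> V. \<forall>y\<in>V. f x + g \<bullet> (y - x) \<le> f y}"

definition prox :: "'a::real_inner set \<Rightarrow> ('a \<Rightarrow> ereal) \<Rightarrow> 'a \<Rightarrow> 'a" where
  "prox V f x = arg_min_on (\<lambda>y. f y + ereal (1 / 2 * (norm (y - x))\<^sup>2)) V"

text \<open>The gradient relative to \<open>V\<close> is the representer of the derivative that lies in \<open>V\<close>;
  without the requirement \<open>g \<in> V\<close> it would not be unique.\<close>

definition gradient_on :: "'a::real_inner set \<Rightarrow> ('a \<Rightarrow> real) \<Rightarrow> 'a \<Rightarrow> 'a" where
  "gradient_on V f x =
     (THE g. g \<in> V \<and> (f has_derivative (\<lambda>v. g \<bullet> v)) (at x within V))"

text \<open>Distance to a set with value \<open>\<infinity>\<close> on the empty set; the library's \<open>infdist\<close> is \<open>0\<close> there.\<close>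

definition set_dist :: "'a::metric_space \<Rightarrow> 'a set \<Rightarrow> ereal" where
  "set_dist x A = (INF a\<in>A. ereal (dist x a))"


definition primal_solution ::
    "('p::finite, 'k::{finite,linorder}) mats \<Rightarrow> real \<Rightarrow> real \<Rightarrow>
     ('p, 'k) mats \<times> ('p, 'k) mats \<Rightarrow> bool" where
  "primal_solution S \<mu>1 \<mu>2 z \<longleftrightarrow>
     is_arg_min (\<lambda>(\<Theta>, \<Omega>). loss S \<Theta> + ereal (penalty \<mu>1 \<mu>2 \<Omega>))
       (\<lambda>(\<Theta>, \<Omega>). \<Theta> \<in> Y \<and> \<Omega> \<in> Y \<and> \<Theta> = \<Omega>) z \<and>
     loss S (fst z) + ereal (penalty \<mu>1 \<mu>2 (snd z)) < \<infinity>"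

definition dual_objective ::
    "('p::finite, 'k::{finite,linorder}) mats \<Rightarrow> real \<Rightarrow> real \<Rightarrow> ('p, 'k) mats \<Rightarrow> ereal" where
  "dual_objective S \<mu>1 \<mu>2 X =
     - (conjugate Y (loss S) (- X) + conjugate Y (\<lambda>\<Omega>. ereal (penalty \<mu>1 \<mu>2 \<Omega>)) X)"

definition dual_solution ::
    "('p::finite, 'k::{finite,linorder}) mats \<Rightarrow> real \<Rightarrow> real \<Rightarrow> ('p, 'k) mats \<Rightarrow> bool" where
  "dual_solution S \<mu>1 \<mu>2 X \<longleftrightarrow>
     is_arg_max (dual_objective S \<mu>1 \<mu>2) (\<lambda>X. X \<in> Y) X \<and> - \<infinity> < dual_objective S \<mu>1 \<mu>2 X"


definition lagrangian ::
    "('p::finite, 'k::{finite,linorder}) mats \<Rightarrow> real \<Rightarrow> real \<Rightarrow>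
     ('p, 'k) mats \<Rightarrow> ('p, 'k) mats \<Rightarrow> ('p, 'k) mats \<Rightarrow> ereal" where
  "lagrangian S \<mu>1 \<mu>2 X \<Theta> \<Omega> =
     - loss S \<Theta> - ereal (penalty \<mu>1 \<mu>2 \<Omega>) - ereal (\<Theta> \<bullet> X) + ereal (\<Omega> \<bullet> X)"

definition aug_lagrangian ::
    "('p::finite, 'k::{finite,linorder}) mats \<Rightarrow> real \<Rightarrow> real \<Rightarrow> real \<Rightarrow>
     ('p, 'k) mats \<Rightarrow> ('p, 'k) mats \<Rightarrow> ('p, 'k) mats \<Rightarrow> ereal" where
  "aug_lagrangian S \<mu>1 \<mu>2 \<sigma> X \<Theta> \<Omega> =
     (SUP (Z1, Z2)\<in>Y \<times> Y. lagrangian S \<mu>1 \<mu>2 X Z1 Z2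
        - ereal (1 / (2 * \<sigma>) * (norm (Z1 - \<Theta>))\<^sup>2)
        - ereal (1 / (2 * \<sigma>) * (norm (Z2 - \<Omega>))\<^sup>2))"

text \<open>The augmented Lagrangian is finite on \<open>Y\<close> for \<open>\<sigma> > 0\<close>, so passing to real values
  loses nothing there.\<close>

definition subproblem ::
    "('p::finite, 'k::{finite,linorder}) mats \<Rightarrow> real \<Rightarrow> real \<Rightarrow> real \<Rightarrow> real \<Rightarrow>
     ('p, 'k) mats \<times> ('p, 'k) mats \<times> ('p, 'k) mats \<Rightarrow> ('p, 'k) mats \<Rightarrow> real" where
  "subproblem S \<mu>1 \<mu>2 \<sigma> \<tau> = (\<lambda>(Xt, \<Theta>t, \<Omega>t) X.
     real_of_ereal (aug_lagrangian S \<mu>1 \<mu>2 \<sigma> X \<Theta>t \<Omega>t)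
       + \<tau> / (2 * \<sigma>) * (norm (X - Xt))\<^sup>2)"

definition KKT_map ::
    "('p::finite, 'k::{finite,linorder}) mats \<Rightarrow> real \<Rightarrow> real \<Rightarrow>
     ('p, 'k) mats \<times> ('p, 'k) mats \<times> ('p, 'k) mats \<Rightarrow>
     (('p, 'k) mats \<times> ('p, 'k) mats \<times> ('p, 'k) mats) set" where
  "KKT_map S \<mu>1 \<mu>2 = (\<lambda>(X, \<Theta>, \<Omega>). {(X', \<Theta>', \<Omega>').
     \<Theta> \<in> Ypd \<and> X' = - \<Theta> + \<Omega> \<and>
     (\<forall>k. \<Theta>' $ k = - matrix_inv (\<Theta> $ k) + X $ k + S $ k) \<and>
     (\<exists>G\<in>subdiff Y (penalty \<mu>1 \<mu>2) \<Omega>. \<Omega>' = G - X)})"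


definition Q_op :: "real \<Rightarrow> 'a::real_vector \<times> 'b \<times> 'c \<Rightarrow> 'a \<times> 'b \<times> 'c" where
  "Q_op \<tau> = (\<lambda>(X, \<Theta>, \<Omega>). (\<tau> *\<^sub>R X, \<Theta>, \<Omega>))"

definition Q_norm ::
    "real \<Rightarrow> 'a::real_inner \<times> 'b::real_inner \<times> 'c::real_inner \<Rightarrow> real" where
  "Q_norm \<tau> z = sqrt (z \<bullet> Q_op \<tau> z)"


text \<open>The update rules. That \<open>X (Suc t)\<close> approximately minimises the subproblem is expressed
  solely by the stopping criteria.\<close>

definition prox_ALM_iterates ::
    "('p::finite, 'k::{finite,linorder}) mats \<Rightarrow> real \<Rightarrow> real \<Rightarrow> (nat \<Rightarrow> real) \<Rightarrow>
     (nat \<Rightarrow> ('p, 'k) mats) \<Rightarrow> (nat \<Rightarrow> ('p, 'k) mats) \<Rightarrow> (nat \<Rightarrow> ('p, 'k) mats) \<Rightarrow> bool" where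
  "prox_ALM_iterates S \<mu>1 \<mu>2 \<sigma> X \<Theta> \<Omega> \<longleftrightarrow>
     X 0 \<in> Ypd \<and> \<Theta> 0 \<in> Ypd \<and> \<Omega> 0 \<in> Ypd \<and>
     (\<forall>t. X (Suc t) \<in> Y \<and>
          \<Omega> (Suc t) = prox Y (\<lambda>W. ereal (\<sigma> t * penalty \<mu>1 \<mu>2 W)) (\<Omega> t + \<sigma> t *\<^sub>R X (Suc t)) \<and>
          (\<forall>k. \<Theta> (Suc t) $ k = prox sym_mats (\<lambda>A. ereal (\<sigma> t) * neg_logdet A)
                                 (\<Theta> t $ k - \<sigma> t *\<^sub>R (X (Suc t) $ k + S $ k))))"

definition crit_A ::
    "('p::finite, 'k::{finite,linorder}) mats \<Rightarrow> real \<Rightarrow> real \<Rightarrow> (nat \<Rightarrow> real) \<Rightarrow> (nat \<Rightarrow> real) \<Rightarrow>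
     (nat \<Rightarrow> real) \<Rightarrow> (nat \<Rightarrow> ('p, 'k) mats \<times> ('p, 'k) mats \<times> ('p, 'k) mats) \<Rightarrow> nat \<Rightarrow> bool" where
  "crit_A S \<mu>1 \<mu>2 \<sigma> \<tau> \<epsilon> z t \<longleftrightarrow>
     norm (gradient_on Y (subproblem S \<mu>1 \<mu>2 (\<sigma> t) (\<tau> t) (z t)) (fst (z (Suc t))))
       \<le> min (sqrt (\<tau> t)) 1 / \<sigma> t * \<epsilon> t"

definition crit_B ::
    "('p::finite, 'k::{finite,linorder}) mats \<Rightarrow> real \<Rightarrow> real \<Rightarrow> (nat \<Rightarrow> real) \<Rightarrow> (nat \<Rightarrow> real) \<Rightarrow>
     (nat \<Rightarrow> real) \<Rightarrow> (nat \<Rightarrow> ('p, 'k) mats \<times> ('p, 'k) mats \<times> ('p, 'k) mats) \<Rightarrow> nat \<Rightarrow> bool" where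
  "crit_B S \<mu>1 \<mu>2 \<sigma> \<tau> \<delta> z t \<longleftrightarrow>
     norm (gradient_on Y (subproblem S \<mu>1 \<mu>2 (\<sigma> t) (\<tau> t) (z t)) (fst (z (Suc t))))
       \<le> \<delta> t * min (sqrt (\<tau> t)) 1 / \<sigma> t * Q_norm (\<tau> t) (z (Suc t) - z t)"

end

theory Submission
  imports Defs
begin

text \<open>The gradient of the subproblem at \<open>X\<^sup>t\<^sup>+\<^sup>1\<close> is
  \<open>e = \<Omega>\<^sup>t\<^sup>+\<^sup>1 - \<Theta>\<^sup>t\<^sup>+\<^sup>1 + (\<tau> / \<sigma>) (X\<^sup>t\<^sup>+\<^sup>1 - X\<^sup>t)\<close>, so an iteration of the algorithm is an inexact proximal
  point step \<open>(e, 0, 0) + Q (z\<^sup>t - z\<^sup>t\<^sup>+\<^sup>1) / \<sigma> \<in> T z\<^sup>t\<^sup>+\<^sup>1\<close> for the monotone KKT operator \<open>T\<close>. Hence the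
  iterates are quasi-Fejer monotone in the \<open>Q\<close>-norm and the residuals tend to \<open>0\<close>. The matrix inverse is
  strongly monotone on bounded sets of positive definite matrices, which turns vanishing residuals
  into convergence to the KKT point.

  For the rate let \<open>w\<close> be the exact proximal point of \<open>z\<^sup>t\<close>. Monotonicity gives
  \<open>\<parallel>w - zbar\<parallel>\<^sup>2 + \<parallel>w - z\<^sup>t\<parallel>\<^sup>2 \<le> \<parallel>z\<^sup>t - zbar\<parallel>\<^sup>2\<close> in the \<open>Q\<close>-norm, the error bound gives
  \<open>\<parallel>w - zbar\<parallel> \<le> (\<kappa> \<gamma> / \<sigma>) \<parallel>w - z\<^sup>t\<parallel>\<close>, and criterion (B) makes \<open>z\<^sup>t\<^sup>+\<^sup>1\<close> differ from \<open>w\<close> by at most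
  \<open>\<delta> \<parallel>z\<^sup>t\<^sup>+\<^sup>1 - z\<^sup>t\<parallel>\<close>.\<close>

subsection \<open>Spectral theorem for symmetric matrices\<close>

text \<open>No theory of maximal monotone operators is invoked: resolvents are built by hand. For
  fixed \<open>X\<close> the \<open>\<Theta>\<close>-equation is solved on eigenvalues and the
  \<open>\<Omega>\<close>-equation by compactness; what is left is a strongly monotone Lipschitz
  equation in \<open>X\<close>, solved by a contraction. A single relation,
  \<open>prox_step\<close>, describes the prox updates, the maximiser inside the augmented
  Lagrangian and an inclusion in the KKT operator, so the gradient formula and the monotonicity
  estimates rest on the same data. Strong monotonicity controls \<open>\<Theta>\<close> only. The
  other components follow because a small residual ties \<open>\<Omega>\<close> to
  \<open>\<Theta>\<close> and \<open>X\<close> to the inverse of \<open>\<Theta>\<close>; no cluster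
  points are needed, and uniqueness of the KKT point is a by-product. The factor \<open>\<kappa> *
  \<gamma> / sqrt (\<sigma>^2 + \<kappa>^2 * \<gamma>^2)\<close> is what remains when the length of
  the exact step is eliminated from the two inequalities for \<open>w\<close>. Here
  \<open>\<gamma>\<close> is the operator norm of \<open>Q\<close>, entering as two factors
  \<open>sqrt \<gamma>\<close>: one converts the residual, the other the distance to the solution.
  The obstacle is that the error bound lives on a Euclidean ball while the iterates are controlled
  in the \<open>Q\<close>-norm.\<close>

lemma linear_term_zero_of_nonneg_quadratic:
  fixes b q :: real
  assumes "\<And>t. 0 \<le> 2 * t * b + t\<^sup>2 * q" "0 \<le> q"
  shows "b = 0"
proof (rule ccontr)
  assume "b \<noteq> 0"
  \<comment> \<open>The minimiser would be \<open>- b / q\<close>; the \<open>+ 1\<close> keeps the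
    denominator positive when \<open>q = 0\<close>, and the value is still negative.\<close>
  have "2 * (- b / (q + 1)) * b + (- b / (q + 1))\<^sup>2 * q = - (b\<^sup>2 * (q + 2)) / (q + 1)\<^sup>2"
    using assms(2) by (simp add: divide_simps power2_eq_square) (simp add: algebra_simps)
  moreover have "\<dots> < 0"
    using \<open>b \<noteq> 0\<close> assms(2) by (simp add: divide_neg_pos)
  ultimately show False
    using assms(1)[of "- b / (q + 1)"] by linarith
qed

text \<open>Rayleigh quotient: let \<open>v\<close> maximise \<open>x \<bullet> f x\<close> on the
  unit sphere of \<open>V\<close>, with value \<open>c\<close>. The form
  \<open>c * (y \<bullet> y) - y \<bullet> f y\<close> is nonnegative on \<open>V\<close> and zero
  at \<open>v\<close>, so its first variation there vanishes, which makes
  \<open>c *\<^sub>R v - f v\<close> orthogonal to \<open>V\<close>.\<close>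

lemma self_adjoint_eigenvector:
  fixes f :: "'a::euclidean_space \<Rightarrow> 'a"
  assumes "linear f" and adj: "\<And>x y. f x \<bullet> y = x \<bullet> f y"
    and V: "subspace V" "f ` V \<subseteq> V" "V \<noteq> {0}"
  obtains v c where "v \<in> V" "norm v = 1" "f v = c *\<^sub>R v"
proof -
  interpret linear f by fact
  have "0 \<in> V" using V(1) by (rule subspace_0)
  then obtain u where u: "u \<in> V" "u \<noteq> 0" using V(3) by auto
  have "compact (V \<inter> sphere 0 1)"
    using closed_subspace[OF V(1)] by (intro closed_Int_compact) auto
  moreover have "(1 / norm u) *\<^sub>R u \<in> V \<inter> sphere 0 1"
    using u V(1) by (auto intro: subspace_scale)
  moreover have "continuous_on (V \<inter> sphere 0 1) (\<lambda>x. x \<bullet> f x)"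
    by (intro continuous_intros linear_continuous_on linear_conv_bounded_linear[THEN iffD1]) fact
  ultimately obtain v where v: "v \<in> V" "norm v = 1"
    and max: "\<And>y. y \<in> V \<Longrightarrow> norm y = 1 \<Longrightarrow> y \<bullet> f y \<le> v \<bullet> f v"
    using continuous_attains_sup[of "V \<inter> sphere 0 1" "\<lambda>x. x \<bullet> f x"] by fastforce
  define c where "c = v \<bullet> f v"
  define q where "q y = c * (y \<bullet> y) - y \<bullet> f y" for y
  have q: "0 \<le> q y" if "y \<in> V" for y
  proof (cases "y = 0")
    case False
    have "(1 / norm y) *\<^sub>R y \<bullet> f ((1 / norm y) *\<^sub>R y) \<le> c"
      unfolding c_def using False that V(1) by (intro max subspace_scale) auto
    then have "(y \<bullet> f y) / (y \<bullet> y) \<le> c"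
      by (simp add: scale divide_simps dot_square_norm power2_eq_square)
    then show ?thesis
      using False by (simp add: q_def divide_simps split: if_splits)
  qed (simp add: q_def)
  have "v \<bullet> v = 1" using v(2) by (simp add: dot_square_norm)
  have "(c *\<^sub>R v - f v) \<bullet> y = 0" if "y \<in> V" for y
  proof (rule linear_term_zero_of_nonneg_quadratic)
    show "0 \<le> 2 * t * ((c *\<^sub>R v - f v) \<bullet> y) + t\<^sup>2 * q y" for t
    proof -
      have "q (v + t *\<^sub>R y) = 2 * t * ((c *\<^sub>R v - f v) \<bullet> y) + t\<^sup>2 * q y"
        using adj[of v y] \<open>v \<bullet> v = 1\<close>
        by (simp add: q_def add scale algebra_simps power2_eq_square inner_commute c_def[symmetric])
      then show ?thesis
        using q[of "v + t *\<^sub>R y"] v(1) that V(1) by (simp add: subspace_add subspace_scale)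
    qed
    show "0 \<le> q y" using that by (rule q)
  qed
  moreover have "c *\<^sub>R v - f v \<in> V"
    using v V by (auto intro!: subspace_diff subspace_scale)
  \<comment> \<open>The vector is orthogonal to all of \<open>V\<close> and itself in
    \<open>V\<close>, hence orthogonal to itself.\<close>
  ultimately have "f v = c *\<^sub>R v" by force
  with v that show thesis by blast
qed

text \<open>Split off one eigenvector and recurse on its orthogonal complement inside
  \<open>V\<close>, which is again invariant because \<open>f\<close> is self-adjoint. The general
  invariant subspace is there for the induction; the application takes the whole space.\<close>

lemma self_adjoint_eigenbasis:
  fixes f :: "'a::euclidean_space \<Rightarrow> 'a"
  assumes f: "linear f" and adj: "\<And>x y. f x \<bullet> y = x \<bullet> f y"
    and V: "subspace V" "f ` V \<subseteq> V"
  shows "\<exists>B \<subseteq> V. pairwise orthogonal B \<and> (\<forall>b\<in>B. norm b = 1 \<and> (\<exists>c. f b = c *\<^sub>R b)) \<and> V \<subseteq> span B"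
  using V
proof (induction "dim V" arbitrary: V rule: less_induct)
  case less
  show ?case
  proof (cases "V = {0}")
    case True
    then show ?thesis by (intro exI[of _ "{}"]) auto
  next
    case False
    obtain v c where v: "v \<in> V" "norm v = 1" "f v = c *\<^sub>R v"
      using self_adjoint_eigenvector[OF f adj less.prems False] by blast
    have vv: "v \<bullet> v = 1" using v(2) by (simp add: dot_square_norm)
    define W where "W = V \<inter> {y. orthogonal v y}"
    have W: "subspace W"
      unfolding W_def by (intro subspace_inter less.prems subspace_orthogonal_to_vector)
    have "v \<notin> W" using vv by (auto simp: W_def orthogonal_def)
    then have "span W \<subset> span V"
      using v W less.prems(1) by (auto simp: span_eq_iff[THEN iffD2] W_def)
    then have "dim W < dim V" by (rule dim_psubset)
    moreover have "f ` W \<subseteq> W"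

    proof -
      have "v \<bullet> f y = c * (v \<bullet> y)" for y using adj[of v y] v(3) by simp
      then show ?thesis using less.prems(2) by (auto simp: W_def orthogonal_def)
    qed
    ultimately obtain B where B: "B \<subseteq> W" "pairwise orthogonal B"
      "\<And>b. b \<in> B \<Longrightarrow> norm b = 1 \<and> (\<exists>c. f b = c *\<^sub>R b)" "W \<subseteq> span B"
      using less.hyps[of W] W by blast
    have "V \<subseteq> span (insert v B)"
    proof
      fix y assume "y \<in> V"
      have "y - (y \<bullet> v) *\<^sub>R v \<in> W"
        using \<open>y \<in> V\<close> v(1) less.prems(1) vv
        by (auto simp: W_def orthogonal_def inner_diff_right inner_commute intro: subspace_diff subspace_scale)
      then show "y \<in> span (insert v B)"
        using B(4) by (auto simp: span_insert)
    qed
    moreover have "pairwise orthogonal (insert v B)"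
      using B(1,2) by (auto simp: pairwise_insert W_def orthogonal_commute)
    ultimately show ?thesis
      using B v by (intro exI[of _ "insert v B"]) (auto simp: W_def)
  qed
qed

definition diag_mat :: "('n \<Rightarrow> 'a::zero) \<Rightarrow> 'a^'n^'n" where
  "diag_mat d = (\<chi> i j. if i = j then d i else 0)"

text \<open>An orthonormal spanning set is independent, so it has exactly \<open>CARD('n)\<close>
  elements and can be indexed by \<open>'n\<close>; the columns of \<open>P\<close> are this
  eigenbasis and \<open>A ** P = P ** diag_mat d\<close> is the eigenvalue equation read column by
  column.\<close>

lemma symmetric_matrix_spectral:
  fixes A :: "real^'n^'n"
  assumes "transpose A = A"
  obtains P d where "orthogonal_matrix P" "A = P ** diag_mat d ** transpose P"
proof -
  have adj: "(A *v x) \<bullet> y = x \<bullet> (A *v y)" for x y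
    by (metis assms dot_lmul_matrix vector_transpose_matrix)
  have "\<exists>B \<subseteq> UNIV. pairwise orthogonal B \<and>
      (\<forall>b\<in>B. norm b = 1 \<and> (\<exists>c. A *v b = c *\<^sub>R b)) \<and> UNIV \<subseteq> span B"
    using adj by (intro self_adjoint_eigenbasis) auto
  then obtain B where B: "pairwise orthogonal B" "\<And>b. b \<in> B \<Longrightarrow> norm b = 1"
    "\<And>b. b \<in> B \<Longrightarrow> \<exists>c. A *v b = c *\<^sub>R b" "span B = UNIV"
    by blast
  have "0 \<notin> B" using B(2)[of 0] by auto
  then have "independent B" using B(1) by (rule pairwise_orthogonal_independent[rotated])
  then have "finite B" "card B = dim (span B)"
    using independent_imp_finite dim_span_eq_card_independent[of B] by metis+
  then have "finite B" "card B = CARD('n)"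
    by (simp_all add: B(4))
  then obtain g where g: "bij_betw g (UNIV::'n set) B"
    by (metis finite_class.finite_UNIV finite_same_card_bij)
  have gB: "g i \<in> B" for i using bij_betwE[OF g] by simp
  have "\<exists>d. \<forall>i. A *v g i = d i *\<^sub>R g i" using B(3) gB by (intro choice) blast
  then obtain d where d: "\<And>i. A *v g i = d i *\<^sub>R g i" by blast
  define P :: "real^'n^'n" where "P = (\<chi> i j. g j $ i)"
  have P: "orthogonal_matrix P"
  proof -
    have "column j P = g j" for j by (simp add: P_def column_def)
    moreover have "orthogonal (g i) (g j)" if "i \<noteq> j" for i j
      using that gB B(1) bij_betw_imp_inj_on[OF g] by (simp add: pairwise_def inj_eq)
    ultimately show ?thesis
      using B(2) gB by (simp add: orthogonal_matrix_orthonormal_columns)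
  qed
  have "A ** P = P ** diag_mat d"
  proof -
    have "(A ** P) $ i $ j = (P ** diag_mat d) $ i $ j" for i j
    proof -
      have "(A ** P) $ i $ j = (A *v g j) $ i"
        by (simp add: matrix_matrix_mult_def matrix_vector_mult_def P_def)
      also have "\<dots> = (P ** diag_mat d) $ i $ j"
        by (simp add: d matrix_matrix_mult_def P_def diag_mat_def if_distrib cong: if_cong)
      finally show ?thesis .
    qed
    then show ?thesis by (simp add: vec_eq_iff)
  qed
  then have "P ** diag_mat d ** transpose P = A"
    using P by (metis matrix_mul_assoc matrix_mul_rid orthogonal_matrix_def)
  with P that show thesis by metis
qed

subsection \<open>Positive definite matrices\<close>

lemma diag_mat_mult: "diag_mat a ** diag_mat b = (diag_mat (\<lambda>i. a i * b i) :: 'a::semiring_1^'n^'n)"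
proof -
  have "(\<Sum>k\<in>UNIV. (if i = k then a i else 0) * (if k = j then b k else 0)) =
      (if i = j then a i * b i else 0)" for i j :: 'n
  proof -
    have "(\<Sum>k\<in>UNIV. (if i = k then a i else 0) * (if k = j then b k else 0)) =
        (\<Sum>k\<in>UNIV. if i = k then (if i = j then a i * b i else 0) else 0)"
      by (intro sum.cong) auto
    then show ?thesis by simp
  qed
  then show ?thesis by (simp add: diag_mat_def matrix_matrix_mult_def vec_eq_iff)
qed

lemma diag_mat_1: "diag_mat (\<lambda>_. 1) = mat 1"
  by (simp add: diag_mat_def mat_def)

lemma transpose_diag_mat [simp]: "transpose (diag_mat d) = diag_mat d"
  by (simp add: diag_mat_def transpose_def vec_eq_iff)

lemma diag_mat_mult_vec: "(diag_mat d *v x) $ i = d i * (x $ i)" for x :: "real^'n"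
proof -
  have "(\<Sum>j\<in>UNIV. (if i = j then d i else 0) * x $ j) = (\<Sum>j\<in>UNIV. if i = j then d i * x $ i else 0)"
    by (intro sum.cong) auto
  then show ?thesis by (simp add: diag_mat_def matrix_vector_mult_def)
qed

text \<open>\<open>matrix_inv\<close> is a choice among two-sided inverses; for square matrices a
  right inverse is also a left one, and such an inverse is unique.\<close>

lemma matrix_inv_eqI:
  fixes A :: "real^'n^'n"
  assumes "A ** B = mat 1"
  shows "matrix_inv A = B"
proof -
  have BA: "B ** A = mat 1" using assms matrix_left_right_inverse by blast
  have "A ** matrix_inv A = mat 1 \<and> matrix_inv A ** A = mat 1"
    unfolding matrix_inv_def by (rule someI[of _ B]) (simp add: assms BA)
  then show ?thesis by (metis BA matrix_mul_assoc matrix_mul_lid matrix_mul_rid)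
qed

section \<open>Matrix arithmetic and the Frobenius inner product\<close>

lemma matrix_mult_diff_left: "(A - B) ** C = A ** C - B ** C" for A B :: "real^'n^'m"
  by (simp add: vec_eq_iff matrix_matrix_mult_def left_diff_distrib sum_subtractf)

lemma matrix_mult_diff_right: "A ** (B - C) = A ** B - A ** C" for A :: "real^'n^'m"
  by (simp add: vec_eq_iff matrix_matrix_mult_def right_diff_distrib sum_subtractf)

lemma matrix_mult_scaleR_left: "(c *\<^sub>R A) ** B = c *\<^sub>R (A ** B)" for A :: "real^'n^'m"
  by (simp add: vec_eq_iff matrix_matrix_mult_def sum_distrib_left mult_ac)

lemma matrix_mult_scaleR_right: "A ** (c *\<^sub>R B) = c *\<^sub>R (A ** B)" for A :: "real^'n^'m"
  by (simp add: vec_eq_iff matrix_matrix_mult_def sum_distrib_left mult_ac)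

text \<open>Writing the inner product as a trace makes cyclicity of the trace available, which moves
  factors across the inner product in the two adjoint rules below.\<close>

lemma inner_matrix_trace: "A \<bullet> B = trace (transpose A ** B)" for A :: "real^'n^'m"
  unfolding inner_vec_def trace_def matrix_matrix_mult_def transpose_def
  by (simp, rule sum.swap)

lemma inner_matrix_mult_left: "(A ** B) \<bullet> C = B \<bullet> (transpose A ** C)"
  for A :: "real^'n^'m" and B :: "real^'l^'n"
  by (simp add: inner_matrix_trace matrix_transpose_mul matrix_mul_assoc)

lemma inner_matrix_mult_right: "(A ** B) \<bullet> C = A \<bullet> (C ** transpose B)"
  for A :: "real^'n^'m" and B :: "real^'l^'n"
  unfolding inner_matrix_trace matrix_transpose_mul
  by (subst matrix_mul_assoc[symmetric], subst trace_mul_sym) (simp add: matrix_mul_assoc)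

text \<open>Each entry of the product is a row times a column, so Cauchy-Schwarz bounds its square,
  and the double sum of the bounds factorises.\<close>

lemma norm_matrix_mult_le: "norm (A ** B) \<le> norm A * norm B"
  for A :: "real^'n^'m" and B :: "real^'l^'n"
proof -
  have entry: "((A ** B) $ i $ j)\<^sup>2 \<le> (norm (row i A))\<^sup>2 * (norm (column j B))\<^sup>2" for i j
  proof -
    have "(A ** B) $ i $ j = row i A \<bullet> column j B"
      by (simp add: matrix_matrix_mult_def inner_vec_def row_def column_def)
    then show ?thesis
      using Cauchy_Schwarz_ineq[of "row i A" "column j B"] by (simp add: dot_square_norm)
  qed
  have sq: "(norm C)\<^sup>2 = (\<Sum>i\<in>UNIV. \<Sum>j\<in>UNIV. (C $ i $ j)\<^sup>2)" for C :: "real^'q^'r"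
    unfolding power2_norm_eq_inner by (simp add: inner_vec_def power2_eq_square)
  have "(norm (A ** B))\<^sup>2 \<le> (\<Sum>i\<in>UNIV. \<Sum>j\<in>UNIV. (norm (row i A))\<^sup>2 * (norm (column j B))\<^sup>2)"
    unfolding sq by (intro sum_mono entry)
  also have "\<dots> = (\<Sum>i\<in>UNIV. (norm (row i A))\<^sup>2) * (\<Sum>j\<in>UNIV. (norm (column j B))\<^sup>2)"
    by (simp add: sum_product)
  also have "(\<Sum>i\<in>UNIV. (norm (row i A))\<^sup>2) = (norm A)\<^sup>2"
    unfolding sq power2_norm_eq_inner by (simp add: inner_vec_def row_def power2_eq_square)
  also have "(\<Sum>j\<in>UNIV. (norm (column j B))\<^sup>2) = (norm B)\<^sup>2"
    unfolding sq power2_norm_eq_inner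
    by (subst sum.swap) (simp add: inner_vec_def column_def power2_eq_square)
  finally show ?thesis
    by (simp add: power_mult_distrib[symmetric] power2_le_iff_abs_le abs_mult)
qed

section \<open>Congruence and factorisation of positive definite matrices\<close>

lemma pd_imp_sym: "A \<in> pd_mats \<Longrightarrow> A \<in> sym_mats"
  by (simp add: pd_mats_def)

lemma inner_congruence: "x \<bullet> ((M ** A ** transpose M) *v x) = (transpose M *v x) \<bullet> (A *v (transpose M *v x))"
  for A M :: "real^'n^'n"
proof -
  have "x v* M = transpose M *v x" using vector_transpose_matrix[of x "transpose M"] by simp
  then show ?thesis by (simp only: matrix_vector_mul_assoc[symmetric] dot_lmul_matrix[symmetric])
qed

lemma pd_mats_congruence:
  fixes A M :: "real^'n^'n"
  assumes "A \<in> pd_mats" "invertible M"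
  shows "M ** A ** transpose M \<in> pd_mats"
proof -
  obtain W where "M ** W = mat 1" using assms(2) by (auto simp: invertible_def)
  then have W: "transpose W ** transpose M = mat 1" by (simp add: matrix_transpose_mul[symmetric])
  have "transpose M *v x \<noteq> 0" if "x \<noteq> 0" for x
  proof
    assume "transpose M *v x = 0"
    then have "transpose W *v (transpose M *v x) = 0"
      by (simp only: matrix_vector_mult_0_right)
    then show False using that
      by (simp only: matrix_vector_mul_assoc W matrix_vector_mul_lid)
  qed
  then have "0 < x \<bullet> ((M ** A ** transpose M) *v x)" if "x \<noteq> 0" for x
    using assms(1) that unfolding inner_congruence by (simp add: pd_mats_def del: transpose_matrix_vector)
  moreover have "transpose (M ** A ** transpose M) = M ** A ** transpose M"
    using assms(1) by (simp add: pd_mats_def sym_mats_def matrix_transpose_mul matrix_mul_assoc)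
  ultimately show ?thesis by (simp add: pd_mats_def sym_mats_def)
qed

lemma orthogonal_matrix_invertible: "orthogonal_matrix P \<Longrightarrow> invertible P"
  by (auto simp: orthogonal_matrix_def invertible_def)

lemma pd_mats_spectralI:
  fixes d :: "'n::finite \<Rightarrow> real"
  assumes "orthogonal_matrix P" "\<And>i. 0 < d i"
  shows "P ** diag_mat d ** transpose P \<in> pd_mats"
proof (rule pd_mats_congruence)
  have "0 < x \<bullet> (diag_mat d *v x)" if "x \<noteq> 0" for x
  proof -
    obtain i where i: "x $ i \<noteq> 0" using \<open>x \<noteq> 0\<close> by (auto simp: vec_eq_iff)
    have "x \<bullet> (diag_mat d *v x) = (\<Sum>i\<in>UNIV. d i * (x $ i)\<^sup>2)"
      by (simp add: inner_vec_def diag_mat_mult_vec power2_eq_square mult_ac)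
    also have "\<dots> > 0"
      using i assms(2) by (intro sum_pos2[of _ i]) (auto simp: less_imp_le)
    finally show ?thesis .
  qed
  then show "diag_mat d \<in> pd_mats" by (simp add: pd_mats_def sym_mats_def)
qed (use assms in \<open>auto intro: orthogonal_matrix_invertible\<close>)

lemma pd_mats_spectral:
  fixes A :: "real^'n^'n"
  assumes "A \<in> pd_mats"
  obtains P d where "orthogonal_matrix P" "A = P ** diag_mat d ** transpose P" "\<And>i. 0 < d i"
proof -
  obtain P d where P: "orthogonal_matrix P" "A = P ** diag_mat d ** transpose P"
    using assms symmetric_matrix_spectral[of A] by (auto simp: pd_mats_def sym_mats_def)
  have "0 < d i" for i
  proof -
    \<comment> \<open>The \<open>i\<close>-th eigenvector; the quadratic form of \<open>A\<close> at
      it is the eigenvalue \<open>d i\<close>.\<close>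
    let ?x = "P *v axis i 1"
    have x: "transpose P *v ?x = axis i 1"
      using P(1) by (simp add: matrix_vector_mul_assoc orthogonal_matrix_def)
    then have "?x \<noteq> 0"
      by (metis axis_eq_0_iff matrix_vector_mult_0_right zero_neq_one)
    then have "0 < ?x \<bullet> (A *v ?x)" using assms by (simp add: pd_mats_def)
    also have "\<dots> = d i"
      unfolding P(2) inner_congruence x
      by (simp add: inner_axis' diag_mat_mult_vec)
    finally show ?thesis .
  qed
  with P that show thesis by blast
qed

text \<open>With eigenvalues \<open>d\<close>, take \<open>M = P ** diag_mat (sqrt d)\<close> and
  let \<open>W\<close> be its inverse. The factorisation allows statements about \<open>A\<close> to
  be transported to the identity by the congruence with \<open>W\<close>.\<close>

lemma pd_mats_factor:
  fixes A :: "real^'n^'n"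
  assumes "A \<in> pd_mats"
  obtains M W :: "real^'n^'n" where "A = M ** transpose M" "M ** W = mat 1" "W ** M = mat 1"
    "matrix_inv A = transpose W ** W"
proof -
  obtain P d where P: "orthogonal_matrix P" "A = P ** diag_mat d ** transpose P" "\<And>i. 0 < d i"
    using pd_mats_spectral[OF assms] by blast
  define M where "M = P ** diag_mat (\<lambda>i. sqrt (d i))"
  define W where "W = diag_mat (\<lambda>i. 1 / sqrt (d i)) ** transpose P"
  have d: "sqrt (d i) * sqrt (d i) = d i" "d i \<noteq> 0" for i using P(3)[of i] by auto
  have "A = P ** (diag_mat (\<lambda>i. sqrt (d i)) ** diag_mat (\<lambda>i. sqrt (d i))) ** transpose P"
    unfolding P(2) diag_mat_mult d ..
  then have A: "A = M ** transpose M"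
    by (simp add: M_def matrix_transpose_mul matrix_mul_assoc)
  have "M ** W = P ** (diag_mat (\<lambda>i. sqrt (d i)) ** diag_mat (\<lambda>i. 1 / sqrt (d i))) ** transpose P"
    by (simp add: M_def W_def matrix_mul_assoc)
  also have "\<dots> = mat 1"
    using P(1) d by (simp add: diag_mat_mult diag_mat_1 orthogonal_matrix_def)
  finally have MW: "M ** W = mat 1" .
  then have WM: "W ** M = mat 1" using matrix_left_right_inverse by blast
  have "transpose M ** transpose W = mat 1"
    by (simp add: WM flip: matrix_transpose_mul)
  moreover have "A ** (transpose W ** W) = M ** (transpose M ** transpose W) ** W"
    by (simp only: A matrix_mul_assoc)
  ultimately have "matrix_inv A = transpose W ** W"
    by (intro matrix_inv_eqI) (simp add: MW)
  then show thesis by (rule that[OF A MW WM])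
qed

lemma pd_mats_matrix_inv:
  fixes A :: "real^'n^'n"
  assumes "A \<in> pd_mats"
  shows "A ** matrix_inv A = mat 1" "matrix_inv A ** A = mat 1" "matrix_inv A \<in> sym_mats"
proof -
  obtain M W :: "real^'n^'n" where M: "A = M ** transpose M" "M ** W = mat 1" "W ** M = mat 1"
    and inv: "matrix_inv A = transpose W ** W"
    using pd_mats_factor[OF assms] .
  have "transpose M ** transpose W = mat 1"
    by (simp add: M(3) flip: matrix_transpose_mul)
  moreover have "A ** (transpose W ** W) = M ** (transpose M ** transpose W) ** W"
    by (simp only: M(1) matrix_mul_assoc)
  ultimately show *: "A ** matrix_inv A = mat 1" by (simp add: M(2) inv)
  then show "matrix_inv A ** A = mat 1" using matrix_left_right_inverse by blast
  show "matrix_inv A \<in> sym_mats" by (simp add: inv sym_mats_def matrix_transpose_mul)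
qed

section \<open>Log-determinant and inverse on the positive definite cone\<close>

lemma pd_mats_det_pos:
  fixes A :: "real^'n^'n"
  assumes "A \<in> pd_mats"
  shows "0 < det A"
proof -
  obtain M W :: "real^'n^'n" where M: "A = M ** transpose M" "M ** W = mat 1"
    using pd_mats_factor[OF assms] by metis
  have "det M * det W = 1" using M(2) by (metis det_I det_mul)
  then have "det M \<noteq> 0" by auto
  then have "0 < (det M)\<^sup>2" by simp
  then show ?thesis by (simp add: M(1) det_mul power2_eq_square)
qed

text \<open>The inequality \<open>ln x \<le> x - 1\<close> summed over the eigenvalues: the tangent
  inequality for \<open>ln (det A)\<close> at the identity.\<close>

lemma ln_det_le_trace:
  fixes A :: "real^'n^'n"
  assumes "A \<in> pd_mats"
  shows "ln (det A) \<le> trace A - real CARD('n)"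
proof -
  obtain P d where P: "orthogonal_matrix P" "A = P ** diag_mat d ** transpose P" "\<And>i. 0 < d i"
    using pd_mats_spectral[OF assms] by blast
  have "det P * det P = 1" using det_orthogonal_matrix[OF P(1)] by auto
  moreover have "det (diag_mat d) = prod d UNIV"
    by (subst det_diagonal) (auto simp: diag_mat_def)
  ultimately have "det A = prod d UNIV" by (simp add: P(2) det_mul mult_ac)
  then have "ln (det A) = (\<Sum>i\<in>UNIV. ln (d i))"
    using ln_prod[of UNIV d] P(3) by (simp add: less_imp_neq[symmetric])
  also have "\<dots> \<le> (\<Sum>i\<in>UNIV. d i - 1)"
    using P(3) by (intro sum_mono ln_le_minus_one)
  also have "\<dots> = trace (diag_mat d) - real CARD('n)"
    by (simp add: trace_def diag_mat_def sum_subtractf)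
  also have "trace (diag_mat d) = trace A"
    using P(1) unfolding P(2)
    by (subst trace_mul_sym) (simp add: matrix_mul_assoc orthogonal_matrix_def)
  finally show ?thesis .
qed

text \<open>Concavity of the log-determinant without calculus: the congruence by \<open>W\<close>
  sends \<open>A\<close> to the identity and \<open>B\<close> to
  \<open>W ** B ** transpose W\<close>, where the previous inequality applies, while determinants
  only change by the factor \<open>det A\<close>. It identifies the negated inverse as a subgradient
  of \<open>neg_logdet\<close>.\<close>

lemma ln_det_le_tangent:
  fixes A B :: "real^'n^'n"
  assumes "A \<in> pd_mats" "B \<in> pd_mats"
  shows "ln (det B) \<le> ln (det A) + matrix_inv A \<bullet> (B - A)"
proof -
  obtain M W :: "real^'n^'n" where M: "A = M ** transpose M" "M ** W = mat 1" "W ** M = mat 1"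
    and inv: "matrix_inv A = transpose W ** W"
    using pd_mats_factor[OF assms(1)] .
  have N: "W ** B ** transpose W \<in> pd_mats"
    using M by (intro pd_mats_congruence assms) (auto simp: invertible_def)
  have dW: "det M * det W = 1" using M(2) by (metis det_I det_mul)
  have "det A * det (W ** B ** transpose W) = (det M * det W) * (det M * det W) * det B"
    by (simp add: M(1) det_mul)
  then have "det A * det (W ** B ** transpose W) = det B" by (simp add: dW)
  then have "ln (det B) = ln (det A) + ln (det (W ** B ** transpose W))"
    using pd_mats_det_pos[OF N] pd_mats_det_pos[OF assms(1)] by (metis ln_mult_pos)
  also have "ln (det (W ** B ** transpose W)) \<le> trace (W ** B ** transpose W) - real CARD('n)"
    by (rule ln_det_le_trace[OF N])
  also have "trace (W ** B ** transpose W) = matrix_inv A \<bullet> B"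
    unfolding inv inner_matrix_trace
    by (subst trace_mul_sym) (simp add: matrix_transpose_mul matrix_mul_assoc)
  also have "real CARD('n) = matrix_inv A \<bullet> A"
    using pd_mats_matrix_inv[OF assms(1)] by (simp add: inner_matrix_trace trace_I sym_mats_def)
  finally show ?thesis by (simp add: inner_diff_right)
qed

text \<open>For \<open>D = B - A\<close> the difference of the inverses is
  \<open>matrix_inv A ** D ** matrix_inv B\<close>. Splitting both inverses turns its inner product
  with \<open>D\<close> into the squared norm of \<open>E\<close>, and
  \<open>D = M ** E ** transpose N\<close> is recovered at the price of the squared norms of
  \<open>M\<close> and \<open>N\<close>, which are the traces of \<open>A\<close> and
  \<open>B\<close>.\<close>

lemma matrix_inv_strongly_monotone:
  fixes A B :: "real^'n^'n"
  assumes "A \<in> pd_mats" "B \<in> pd_mats"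
  shows "(norm (B - A))\<^sup>2 \<le> trace A * trace B * ((matrix_inv A - matrix_inv B) \<bullet> (B - A))"
proof -
  obtain M W :: "real^'n^'n" where M: "A = M ** transpose M" "M ** W = mat 1" "W ** M = mat 1"
    and invA: "matrix_inv A = transpose W ** W"
    using pd_mats_factor[OF assms(1)] .
  obtain N V :: "real^'n^'n" where N: "B = N ** transpose N" "N ** V = mat 1" "V ** N = mat 1"
    and invB: "matrix_inv B = transpose V ** V"
    using pd_mats_factor[OF assms(2)] .
  define D where "D = B - A"
  define E where "E = W ** D ** transpose V"
  have norm_factor: "(norm L)\<^sup>2 = trace (L ** transpose L)" for L :: "real^'n^'n"
    unfolding power2_norm_eq_inner inner_matrix_trace by (rule trace_mul_sym)
  have "matrix_inv A ** D ** matrix_inv B = matrix_inv A - matrix_inv B"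
  proof -
    have "matrix_inv A ** D ** matrix_inv B =
        matrix_inv A ** (B ** matrix_inv B) - (matrix_inv A ** A) ** matrix_inv B"
      by (simp add: D_def matrix_mult_diff_right matrix_mult_diff_left matrix_mul_assoc)
    then show ?thesis by (simp add: pd_mats_matrix_inv assms)
  qed
  then have "(matrix_inv A - matrix_inv B) \<bullet> D = (transpose W ** (W ** D ** transpose V) ** V) \<bullet> D"
    by (simp add: invA invB matrix_mul_assoc)
  also have "\<dots> = E \<bullet> E"
    unfolding inner_matrix_mult_right[of _ V] inner_matrix_mult_left[of "transpose W"]
    by (simp add: E_def matrix_mul_assoc)
  finally have E: "(matrix_inv A - matrix_inv B) \<bullet> D = (norm E)\<^sup>2"
    by (simp add: power2_norm_eq_inner)
  have "M ** E ** transpose N = (M ** W) ** D ** transpose (N ** V)"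
    by (simp add: E_def matrix_mul_assoc matrix_transpose_mul)
  then have "D = M ** E ** transpose N" by (simp add: M N)
  then have "norm D \<le> norm (M ** E) * norm (transpose N)"
    by (simp add: norm_matrix_mult_le)
  also have "\<dots> \<le> norm M * norm E * norm (transpose N)"
    by (intro mult_right_mono norm_matrix_mult_le norm_ge_zero)
  finally have "(norm D)\<^sup>2 \<le> (norm M * norm E * norm (transpose N))\<^sup>2"
    by (intro power_mono norm_ge_zero)
  then have "(norm D)\<^sup>2 \<le> (norm M)\<^sup>2 * (norm E)\<^sup>2 * (norm (transpose N))\<^sup>2"
    by (simp only: power_mult_distrib)
  also have "(norm (transpose N))\<^sup>2 = (norm N)\<^sup>2"
    using trace_mul_sym[of "transpose N" N] by (simp add: norm_factor)
  finally show ?thesis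
    unfolding norm_factor[of M] norm_factor[of N] M(1)[symmetric] N(1)[symmetric] E[symmetric] D_def
    by (simp add: mult_ac)
qed

text \<open>In an eigenbasis of \<open>A\<close> the equation decouples into
  \<open>q - s / q = d\<close>, and \<open>q i\<close> is the positive root of
  \<open>q^2 - d * q - s = 0\<close>. This is the optimality condition of the prox of the scaled
  log-determinant term.\<close>

lemma pd_mats_resolvent:
  fixes A :: "real^'n^'n"
  assumes "A \<in> sym_mats" "0 < s"
  obtains B where "B \<in> pd_mats" "B - s *\<^sub>R matrix_inv B = A"
proof -
  obtain P d where P: "orthogonal_matrix P" "A = P ** diag_mat d ** transpose P"
    using assms symmetric_matrix_spectral[of A] by (auto simp: sym_mats_def)
  define q where "q i = (d i + sqrt ((d i)\<^sup>2 + 4 * s)) / 2" for i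
  have "\<bar>d i\<bar> < sqrt ((d i)\<^sup>2 + 4 * s)" for i
    using assms(2) by (intro real_less_rsqrt) auto
  then have "0 < d i + sqrt ((d i)\<^sup>2 + 4 * s)" for i
    using abs_less_iff[of "d i"] by (smt (verit))
  then have q: "0 < q i" for i
    unfolding q_def by simp
  have "q i * q i = d i * q i + s" for i
  proof -
    have "sqrt ((d i)\<^sup>2 + 4 * s) * sqrt ((d i)\<^sup>2 + 4 * s) = (d i)\<^sup>2 + 4 * s"
      using assms(2) by simp
    then show ?thesis unfolding q_def by (simp add: field_simps power2_eq_square)
  qed
  then have qd: "q i - s * (1 / q i) = d i" for i
    using q[of i] by (simp add: field_simps)
  define B where "B = P ** diag_mat q ** transpose P"
  have "B ** (P ** diag_mat (\<lambda>i. 1 / q i) ** transpose P) =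
      P ** diag_mat q ** (transpose P ** P) ** diag_mat (\<lambda>i. 1 / q i) ** transpose P"
    by (simp add: B_def matrix_mul_assoc)
  also have "\<dots> = P ** (diag_mat q ** diag_mat (\<lambda>i. 1 / q i)) ** transpose P"
    using P(1) by (simp add: orthogonal_matrix_def matrix_mul_assoc)
  also have "\<dots> = mat 1"
    using P(1) q by (simp add: diag_mat_mult diag_mat_1 orthogonal_matrix_def less_imp_neq[symmetric])
  finally have "matrix_inv B = P ** diag_mat (\<lambda>i. 1 / q i) ** transpose P"
    by (rule matrix_inv_eqI)
  then have "B - s *\<^sub>R matrix_inv B = P ** (diag_mat q - s *\<^sub>R diag_mat (\<lambda>i. 1 / q i)) ** transpose P"
    by (simp add: B_def matrix_mult_diff_right matrix_mult_diff_left matrix_mult_scaleR_right matrix_mult_scaleR_left)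
  also have "diag_mat q - s *\<^sub>R diag_mat (\<lambda>i. 1 / q i) = diag_mat d"
    using qd by (simp add: diag_mat_def vec_eq_iff)
  finally have "B - s *\<^sub>R matrix_inv B = A" by (simp add: P)
  moreover have "B \<in> pd_mats" unfolding B_def by (rule pd_mats_spectralI[OF P(1) q])
  ultimately show thesis using that by blast
qed

subsection \<open>Proximal maps and gradients relative to a subspace\<close>

text \<open>The last assumption says that \<open>x - w\<close> is a subgradient of \<open>f\<close>
  at \<open>w\<close> relative to \<open>V\<close>. The quadratic term then makes \<open>w\<close> a
  strict minimiser (finiteness of \<open>f w\<close> is what makes the comparison strict), and
  uniqueness is what pins down the choice inside \<open>arg_min_on\<close>.\<close>

lemma prox_eqI:
  fixes f :: "'a::real_inner \<Rightarrow> ereal"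
  assumes w: "w \<in> V" "f w \<noteq> \<infinity>" "f w \<noteq> -\<infinity>"
    and le: "\<And>y. y \<in> V \<Longrightarrow> f w + ereal ((x - w) \<bullet> (y - w)) \<le> f y"
  shows "prox V f x = w"
proof -
  let ?F = "\<lambda>y. f y + ereal (1 / 2 * (norm (y - x))\<^sup>2)"
  obtain a where a: "f w = ereal a" using w(2,3) by (cases "f w") auto
  have less: "?F w < ?F y" if "y \<in> V" "y \<noteq> w" for y
  proof (cases "f y")
    case (real b)
    have "a + (x - w) \<bullet> (y - w) \<le> b" using le[OF that(1)] by (simp add: a real)
    moreover have "(norm (y - x))\<^sup>2 = (norm (w - x))\<^sup>2 - 2 * ((x - w) \<bullet> (y - w)) + (norm (y - w))\<^sup>2"
      unfolding power2_norm_eq_inner by (simp add: inner_diff_left inner_diff_right inner_commute algebra_simps)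
    moreover have "0 < (norm (y - w))\<^sup>2" using that by simp
    ultimately have "a + 1 / 2 * (norm (w - x))\<^sup>2 < b + 1 / 2 * (norm (y - x))\<^sup>2"
      by linarith
    then show ?thesis by (simp add: a real)
  qed (use le[OF that(1)] a in auto)
  have "(SOME y. is_arg_min ?F (\<lambda>y. y \<in> V) y) = w"
  proof (rule some_equality)
    show "is_arg_min ?F (\<lambda>y. y \<in> V) w"
      using less w(1) by (auto simp: is_arg_min_def) (metis less_asym)
    show "y = w" if "is_arg_min ?F (\<lambda>y. y \<in> V) y" for y
      using that less w(1) unfolding is_arg_min_def by blast
  qed
  then show ?thesis by (simp add: prox_def arg_min_on_def arg_min_def)
qed

text \<open>A minimiser of \<open>P\<close> plus half the squared distance to \<open>x\<close>
  exists by compactness; its variational inequality follows by comparing with points slightly moved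
  from \<open>w\<close> towards \<open>y\<close>, since the quadratic term changes only to second
  order beyond its linear part.\<close>

lemma convex_prox_exists:
  fixes P :: "'a::euclidean_space \<Rightarrow> real"
  assumes conv: "convex_on UNIV P" and cont: "continuous_on UNIV P" and nonneg: "\<And>y. 0 \<le> P y"
    and V: "subspace V"
  obtains w where "w \<in> V" "\<And>y. y \<in> V \<Longrightarrow> P w + (x - w) \<bullet> (y - w) \<le> P y"
proof -
  define G where "G y = P y + 1 / 2 * (norm (y - x))\<^sup>2" for y
  \<comment> \<open>Outside this ball the quadratic term alone exceeds \<open>G 0\<close>, and
    \<open>0\<close> lies in the ball, so minimising over the ball is enough.\<close>
  define R where "R = sqrt (2 * G 0)"
  have "0 \<in> V" using V by (rule subspace_0)
  have "norm x \<le> R"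
    unfolding R_def G_def using nonneg[of 0] by (intro real_le_rsqrt) simp
  then have 0: "0 \<in> V \<inter> cball x R" using \<open>0 \<in> V\<close> by (simp add: dist_norm)
  have "compact (V \<inter> cball x R)"
    using closed_subspace[OF V] by (intro closed_Int_compact) auto
  moreover have "continuous_on (V \<inter> cball x R) G"
    unfolding G_def by (intro continuous_intros continuous_on_subset[OF cont]) auto
  moreover have "V \<inter> cball x R \<noteq> {}" using 0 by blast
  ultimately obtain w where w: "w \<in> V" and min: "\<And>y. y \<in> V \<inter> cball x R \<Longrightarrow> G w \<le> G y"
    using continuous_attains_inf[of "V \<inter> cball x R" G] by blast
  have Gmin: "G w \<le> G y" if "y \<in> V" for y
  proof (cases "norm (y - x) \<le> R")
    case True
    then show ?thesis using that by (intro min) (simp add: dist_norm norm_minus_commute)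
  next
    case False
    have "0 \<le> R" using \<open>norm x \<le> R\<close> norm_ge_zero[of x] by linarith
    then have "R\<^sup>2 \<le> (norm (y - x))\<^sup>2" using False by (intro power_mono) auto
    moreover have "R\<^sup>2 = 2 * G 0" unfolding R_def using nonneg[of 0] by (simp add: G_def)
    ultimately have "G 0 \<le> G y" using nonneg[of y] by (simp add: G_def)
    then show ?thesis using min[OF 0] by simp
  qed
  have "P w + (x - w) \<bullet> (y - w) \<le> P y" if "y \<in> V" for y
  proof (rule ccontr)
    define a where "a = P w + (x - w) \<bullet> (y - w) - P y"
    define b where "b = (norm (y - w))\<^sup>2"
    assume "\<not> ?thesis"
    then have "0 < a" by (simp add: a_def)
    \<comment> \<open>If the inequality failed by \<open>a\<close>, minimality would force
      \<open>a \<le> t * b / 2\<close>; this \<open>t\<close> gives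
      \<open>t * (b + 1) \<le> a\<close>, a contradiction, and \<open>b + 1\<close> avoids division
      by zero.\<close>
    define t where "t = min 1 (a / (b + 1))"
    have "0 \<le> b" by (simp add: b_def)
    have t: "0 < t" "t \<le> 1" using \<open>0 < a\<close> \<open>0 \<le> b\<close> by (auto simp: t_def)
    have "t * (b + 1) \<le> a / (b + 1) * (b + 1)"
      using \<open>0 \<le> b\<close> by (intro mult_right_mono) (auto simp: t_def)
    then have tb: "t * (b + 1) \<le> a" using \<open>0 \<le> b\<close> by simp
    let ?y = "(1 - t) *\<^sub>R w + t *\<^sub>R y"
    have "P ?y \<le> (1 - t) * P w + t * P y"
      using t by (intro convex_onD[OF conv]) auto
    moreover have "(norm (?y - x))\<^sup>2 = (norm (w - x))\<^sup>2 - 2 * t * ((x - w) \<bullet> (y - w)) + t\<^sup>2 * b"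
      unfolding b_def power2_norm_eq_inner
      by (simp add: inner_add_left inner_add_right inner_diff_left inner_diff_right inner_commute
          algebra_simps power2_eq_square)
    moreover have "G w \<le> G ?y"
      using V w that by (intro Gmin subspace_add subspace_scale)
    ultimately have "t * a \<le> t * (t * b / 2)"
      by (simp add: G_def a_def algebra_simps power2_eq_square)
    then have "a \<le> t * b / 2" using t(1) by (simp only: mult_le_cancel_left_pos)
    moreover have "t * b / 2 \<le> t * b" using t(1) \<open>0 \<le> b\<close> by simp
    moreover have "t * b < t * (b + 1)" using t(1) by (simp add: algebra_simps)
    ultimately show False using tb by linarith
  qed
  with w that show thesis by blast
qed

text \<open>The subgradient inequalities at \<open>x\<close> and at \<open>y\<close> trap the
  linearisation error between \<open>0\<close> and \<open>(g y - g x) \<bullet> (y - x)\<close>,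
  which is quadratic in the distance by the Lipschitz assumption. A Lipschitz selection of
  subgradients is therefore the gradient, so suprema need not be differentiated directly.\<close>

lemma gradient_on_eqI:
  fixes f :: "'a::real_inner \<Rightarrow> real"
  assumes V: "subspace V" and g: "\<And>x. x \<in> V \<Longrightarrow> g x \<in> V"
    and sub: "\<And>x y. x \<in> V \<Longrightarrow> y \<in> V \<Longrightarrow> f x + g x \<bullet> (y - x) \<le> f y"
    and lip: "\<And>x y. x \<in> V \<Longrightarrow> y \<in> V \<Longrightarrow> norm (g y - g x) \<le> C * norm (y - x)"
    and x: "x \<in> V"
  shows "gradient_on V f x = g x"
  unfolding gradient_on_def
proof (rule the_equality, intro conjI)
  show deriv: "(f has_derivative (\<lambda>v. g x \<bullet> v)) (at x within V)"
    unfolding has_derivative_within_alt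
  proof (intro conjI allI impI)
    show "bounded_linear (\<lambda>v. g x \<bullet> v)" by (rule bounded_linear_inner_right)
    fix e :: real assume "0 < e"
    show "\<exists>d>0. \<forall>y\<in>V. norm (y - x) < d \<longrightarrow> norm (f y - f x - g x \<bullet> (y - x)) \<le> e * norm (y - x)"
    proof (intro exI conjI ballI impI)
      show "0 < e / (\<bar>C\<bar> + 1)" using \<open>0 < e\<close> by simp
      fix y assume y: "y \<in> V" and "norm (y - x) < e / (\<bar>C\<bar> + 1)"
      then have d: "norm (y - x) * (\<bar>C\<bar> + 1) \<le> e" by (simp add: divide_simps split: if_splits)
      have "f y + g y \<bullet> (x - y) \<le> f x" by (rule sub[OF y x])
      then have "f y - f x - g x \<bullet> (y - x) \<le> (g y - g x) \<bullet> (y - x)"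
        by (simp add: inner_diff_left inner_diff_right)
      also have "\<dots> \<le> norm (g y - g x) * norm (y - x)" by (rule norm_cauchy_schwarz)
      also have "\<dots> \<le> (C * norm (y - x)) * norm (y - x)"
        by (intro mult_right_mono lip x y) simp
      also have "\<dots> \<le> (norm (y - x) * (\<bar>C\<bar> + 1)) * norm (y - x)"
      proof -
        have "C * norm (y - x) \<le> (\<bar>C\<bar> + 1) * norm (y - x)" by (intro mult_right_mono) auto
        then show ?thesis by (intro mult_right_mono) (auto simp: mult.commute)
      qed
      also have "\<dots> \<le> e * norm (y - x)" by (intro mult_right_mono d) simp
      finally show "norm (f y - f x - g x \<bullet> (y - x)) \<le> e * norm (y - x)"
        using sub[OF x y] by simp
    qed
  qed
  show "g x \<in> V" by (rule g[OF x])
  fix h assume h: "h \<in> V \<and> (f has_derivative (\<lambda>v. h \<bullet> v)) (at x within V)"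
  \<comment> \<open>The difference of two representers lies in \<open>V\<close>, so the line through
    \<open>x\<close> in this direction stays in \<open>V\<close>. Uniqueness of derivatives on the
    real line gives \<open>v \<bullet> v = 0\<close>.\<close>
  define v where "v = h - g x"
  have v: "v \<in> V" using h g[OF x] V by (simp add: v_def subspace_diff)
  have *: "((\<lambda>t. f (x + t *\<^sub>R v)) has_derivative (\<lambda>t. u \<bullet> (t *\<^sub>R v))) (at 0)"
    if "(f has_derivative (\<lambda>v. u \<bullet> v)) (at x within V)" for u
  proof -
    have "(\<lambda>t. x + t *\<^sub>R v) ` UNIV \<subseteq> V" using x v V by (auto intro: subspace_add subspace_scale)
    then have "(f has_derivative (\<lambda>v. u \<bullet> v)) (at (x + 0 *\<^sub>R v) within (\<lambda>t. x + t *\<^sub>R v) ` UNIV)"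
      using has_derivative_subset[OF that] by simp
    moreover have "((\<lambda>t. x + t *\<^sub>R v) has_derivative (\<lambda>t. t *\<^sub>R v)) (at 0 within UNIV)"
      by (auto intro!: derivative_eq_intros)
    ultimately show ?thesis by (rule has_derivative_in_compose[rotated])
  qed
  have "(\<lambda>t. h \<bullet> (t *\<^sub>R v)) = (\<lambda>t. g x \<bullet> (t *\<^sub>R v))"
    using *[of h] *[OF deriv] h by (intro has_derivative_unique) auto
  then have "h \<bullet> (1 *\<^sub>R v) = g x \<bullet> (1 *\<^sub>R v)" by (rule fun_cong)
  then have "v \<bullet> v = 0" by (simp add: v_def inner_diff_left)
  then show "h = g x" by (simp add: v_def)
qed

text \<open>Zeros of \<open>g\<close> are the fixed points of \<open>x - s *\<^sub>R g x\<close>, a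
  contraction of \<open>V\<close> for a suitable step \<open>s\<close>.\<close>

lemma strongly_monotone_zero:
  fixes g :: "'a::euclidean_space \<Rightarrow> 'a"
  assumes V: "subspace V" and g: "\<And>x. x \<in> V \<Longrightarrow> g x \<in> V" and "0 < m"
    and mono: "\<And>x y. x \<in> V \<Longrightarrow> y \<in> V \<Longrightarrow> m * (norm (x - y))\<^sup>2 \<le> (g x - g y) \<bullet> (x - y)"
    and lip: "\<And>x y. x \<in> V \<Longrightarrow> y \<in> V \<Longrightarrow> norm (g x - g y) \<le> C * norm (x - y)"
  obtains x where "x \<in> V" "g x = 0"
proof -
  \<comment> \<open>A Lipschitz constant that is positive and at least \<open>m\<close>, so that the
    square root in \<open>c\<close> is real. The step \<open>s = m / K^2\<close> minimises
    \<open>1 - 2 * s * m + s^2 * K^2\<close>, the bound on the squared contraction factor, with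
    minimum \<open>1 - (m / K)^2\<close>.\<close>
  define K where "K = \<bar>C\<bar> + m"
  define s where "s = m / K\<^sup>2"
  have K: "0 < K" "m \<le> K" using \<open>0 < m\<close> by (auto simp: K_def)
  have s: "0 < s" using K \<open>0 < m\<close> by (simp add: s_def)
  define c where "c = sqrt (1 - (m / K)\<^sup>2)"
  have mK: "0 < (m / K)\<^sup>2" "(m / K)\<^sup>2 \<le> 1"
    using K \<open>0 < m\<close> by (auto simp: power_le_one)
  then have c: "0 \<le> c" "c < 1" by (auto simp: c_def real_less_lsqrt)
  have "\<exists>!x\<in>V. x - s *\<^sub>R g x = x"
  proof (rule Banach_fix[OF _ _ c])
    show "complete V" using closed_subspace[OF V] by (simp add: complete_eq_closed)
    show "V \<noteq> {}" using subspace_0[OF V] by auto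
    show "(\<lambda>x. x - s *\<^sub>R g x) ` V \<subseteq> V" using g V by (auto intro!: subspace_diff subspace_scale)
    fix x y assume xy: "x \<in> V" "y \<in> V"
    define d where "d = x - y"
    define D where "D = g x - g y"
    have "norm D \<le> K * norm d"
    proof -
      have "C * norm d \<le> K * norm d" using \<open>0 < m\<close> by (intro mult_right_mono) (auto simp: K_def)
      then show ?thesis using lip[OF xy] by (simp add: D_def d_def)
    qed
    then have "(norm D)\<^sup>2 \<le> (K * norm d)\<^sup>2" by (intro power_mono) auto
    then have h1: "s\<^sup>2 * (norm D)\<^sup>2 \<le> s\<^sup>2 * (K * norm d)\<^sup>2" by (intro mult_left_mono) auto
    have h2: "2 * s * (m * (norm d)\<^sup>2) \<le> 2 * s * (D \<bullet> d)"
      using mono[OF xy] s by (intro mult_left_mono) (auto simp: D_def d_def)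
    have "(norm (d - s *\<^sub>R D))\<^sup>2 = (norm d)\<^sup>2 - 2 * s * (D \<bullet> d) + s\<^sup>2 * (norm D)\<^sup>2"
      unfolding power2_norm_eq_inner
      by (simp add: inner_diff_left inner_diff_right inner_commute algebra_simps power2_eq_square)
    also have "\<dots> \<le> (norm d)\<^sup>2 - 2 * s * (m * (norm d)\<^sup>2) + s\<^sup>2 * (K * norm d)\<^sup>2"
      by (intro add_mono diff_mono order_refl h1 h2)
    also have "\<dots> = (1 - 2 * (s * m) + s\<^sup>2 * K\<^sup>2) * (norm d)\<^sup>2"
      by (simp add: algebra_simps power_mult_distrib)
    also have "1 - 2 * (s * m) + s\<^sup>2 * K\<^sup>2 = c\<^sup>2"
    proof -
      have "s * m = (m / K)\<^sup>2" by (simp add: s_def power2_eq_square)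
      moreover have "s\<^sup>2 * K\<^sup>2 = (s * K)\<^sup>2" by (simp add: power_mult_distrib)
      moreover have "s * K = m / K" using K(1) by (simp add: s_def power2_eq_square)
      moreover have "c\<^sup>2 = 1 - (m / K)\<^sup>2" using mK by (simp add: c_def)
      ultimately show ?thesis by simp
    qed
    finally have "(norm (d - s *\<^sub>R D))\<^sup>2 \<le> (c * norm d)\<^sup>2"
      by (simp only: power_mult_distrib)
    then have "norm (d - s *\<^sub>R D) \<le> c * norm d"
      by (rule power2_le_imp_le) (use c(1) in auto)
    moreover have eq: "(x - s *\<^sub>R g x) - (y - s *\<^sub>R g y) = d - s *\<^sub>R D"
      by (simp add: d_def D_def algebra_simps)
    ultimately show "dist (x - s *\<^sub>R g x) (y - s *\<^sub>R g y) \<le> c * dist x y"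
      unfolding dist_norm eq d_def[symmetric] by simp
  qed
  then obtain x where "x \<in> V" "x - s *\<^sub>R g x = x" by blast
  then show thesis using that s by auto
qed

subsection \<open>Loss, penalty and KKT operator\<close>

lemma subspace_sym_mats: "subspace sym_mats"
  by (auto simp: subspace_def sym_mats_def transpose_def vec_eq_iff)

lemma subspace_Y: "subspace Y"
  using subspace_sym_mats by (auto simp: subspace_def Y_def)

lemma Ypd_imp_Y: "\<Theta> \<in> Ypd \<Longrightarrow> \<Theta> \<in> Y"
  by (auto simp: Ypd_def Y_def pd_mats_def)

definition inv_mats :: "('p::finite, 'k::finite) mats \<Rightarrow> ('p, 'k) mats" where
  "inv_mats \<Theta> = (\<chi> k. matrix_inv (\<Theta> $ k))"

lemma inv_mats_nth [simp]: "inv_mats \<Theta> $ k = matrix_inv (\<Theta> $ k)"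
  by (simp add: inv_mats_def)

text \<open>Agrees with \<open>loss\<close> on \<open>Ypd\<close> only; outside \<open>Ypd\<close>
  the extended-real loss is infinite and this number has no meaning.\<close>

definition real_loss :: "('p::finite, 'k::finite) mats \<Rightarrow> ('p, 'k) mats \<Rightarrow> real" where
  "real_loss S \<Theta> = (\<Sum>k\<in>UNIV. - ln (det (\<Theta> $ k))) + S \<bullet> \<Theta>"

lemma loss_Ypd: "\<Theta> \<in> Ypd \<Longrightarrow> loss S \<Theta> = ereal (real_loss S \<Theta>)"
  unfolding loss_def real_loss_def inner_vec_def[of S]
  by (simp add: neg_logdet_def Ypd_def sum.distrib[symmetric] del: sum_negf)

lemma loss_not_Ypd: "\<Theta> \<notin> Ypd \<Longrightarrow> loss S \<Theta> = \<infinity>"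
  unfolding loss_def by (subst sum_Pinfty) (auto simp: neg_logdet_def Ypd_def)

text \<open>The block inequalities for the log-determinant add up and the linear term is exact, so
  \<open>S - inv_mats \<Theta>\<close> acts as the gradient of the loss at
  \<open>\<Theta>\<close>.\<close>

lemma real_loss_tangent:
  assumes "\<Theta> \<in> Ypd" "Z \<in> Ypd"
  shows "real_loss S \<Theta> + (S - inv_mats \<Theta>) \<bullet> (Z - \<Theta>) \<le> real_loss S Z"
proof -
  have "(\<Sum>k\<in>UNIV. ln (det (Z $ k))) \<le> (\<Sum>k\<in>UNIV. ln (det (\<Theta> $ k)) + matrix_inv (\<Theta> $ k) \<bullet> (Z $ k - \<Theta> $ k))"
    using assms by (intro sum_mono ln_det_le_tangent) (auto simp: Ypd_def)
  also have "\<dots> = (\<Sum>k\<in>UNIV. ln (det (\<Theta> $ k))) + inv_mats \<Theta> \<bullet> (Z - \<Theta>)"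
    by (simp add: sum.distrib inner_vec_def[of "inv_mats \<Theta>"])
  finally show ?thesis
    by (simp add: real_loss_def sum_negf inner_diff_left inner_diff_right)
qed

lemma penalty_nonneg: "0 \<le> \<mu>1 \<Longrightarrow> 0 \<le> \<mu>2 \<Longrightarrow> 0 \<le> penalty \<mu>1 \<mu>2 \<Omega>"
  unfolding penalty_def by (intro add_nonneg_nonneg mult_nonneg_nonneg sum_nonneg) (auto intro!: sum_nonneg)

lemma penalty_add_le:
  assumes "0 \<le> \<mu>1" "0 \<le> \<mu>2"
  shows "penalty \<mu>1 \<mu>2 (A + B) \<le> penalty \<mu>1 \<mu>2 A + penalty \<mu>1 \<mu>2 B"
proof -
  have "penalty \<mu>1 \<mu>2 (A + B) \<le>
    \<mu>1 * (\<Sum>p\<in>{(i, j). i \<noteq> j}. \<Sum>k\<in>UNIV. \<bar>A $ k $ fst p $ snd p\<bar> + \<bar>B $ k $ fst p $ snd p\<bar>) +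
    \<mu>2 * (\<Sum>p\<in>{(i, j). i \<noteq> j}. \<Sum>q\<in>{(k, k'). k < k'}.
       \<bar>A $ fst q $ fst p $ snd p - A $ snd q $ fst p $ snd p\<bar> +
       \<bar>B $ fst q $ fst p $ snd p - B $ snd q $ fst p $ snd p\<bar>)"
    unfolding penalty_def case_prod_unfold
    using assms by (intro add_mono mult_left_mono sum_mono) auto
  also have "\<dots> = penalty \<mu>1 \<mu>2 A + penalty \<mu>1 \<mu>2 B"
    unfolding penalty_def case_prod_unfold by (simp add: sum.distrib distrib_left)
  finally show ?thesis .
qed

lemma penalty_scaleR: "0 \<le> c \<Longrightarrow> penalty \<mu>1 \<mu>2 (c *\<^sub>R A) = c * penalty \<mu>1 \<mu>2 A"
  unfolding penalty_def case_prod_unfold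
  by (simp add: abs_mult sum_distrib_left right_diff_distrib[symmetric] distrib_left mult_ac)

text \<open>Convexity from subadditivity and positive homogeneity.\<close>

lemma convex_penalty:
  assumes "0 \<le> \<mu>1" "0 \<le> \<mu>2"
  shows "convex_on UNIV (penalty \<mu>1 \<mu>2)"
proof (rule convex_onI)
  fix t :: real and x y :: "('p::finite, 'k::{finite,linorder}) mats"
  assume "0 < t" "t < 1"
  then show "penalty \<mu>1 \<mu>2 ((1 - t) *\<^sub>R x + t *\<^sub>R y) \<le> (1 - t) * penalty \<mu>1 \<mu>2 x + t * penalty \<mu>1 \<mu>2 y"
    using penalty_add_le[OF assms, of "(1 - t) *\<^sub>R x" "t *\<^sub>R y"] by (simp add: penalty_scaleR)
qed simp

lemma continuous_on_penalty: "continuous_on A (penalty \<mu>1 \<mu>2)"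
  unfolding penalty_def case_prod_unfold by (intro continuous_intros)

lemma KKT_map_iff:
  "(a, b, c) \<in> KKT_map S \<mu>1 \<mu>2 (X, \<Theta>, \<Omega>) \<longleftrightarrow>
     \<Theta> \<in> Ypd \<and> a = - \<Theta> + \<Omega> \<and> b = - inv_mats \<Theta> + X + S \<and> c + X \<in> subdiff Y (penalty \<mu>1 \<mu>2) \<Omega>"
  unfolding KKT_map_def by (force simp: vec_eq_iff[of b])

lemma subdiff_monotone:
  assumes "g \<in> subdiff V f x" "h \<in> subdiff V f y" "x \<in> V" "y \<in> V"
  shows "0 \<le> (g - h) \<bullet> (x - y)"
proof -
  have "f x + g \<bullet> (y - x) \<le> f y" "f y + h \<bullet> (x - y) \<le> f x"
    using assms by (auto simp: subdiff_def)
  then show ?thesis by (simp add: inner_diff_left inner_diff_right)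
qed

text \<open>Add the tangent inequalities of the log-determinant taken at either point towards the
  other.\<close>

lemma inv_mats_monotone:
  assumes "\<Theta>1 \<in> Ypd" "\<Theta>2 \<in> Ypd"
  shows "0 \<le> (matrix_inv (\<Theta>2 $ k) - matrix_inv (\<Theta>1 $ k)) \<bullet> (\<Theta>1 $ k - \<Theta>2 $ k)"
  using ln_det_le_tangent[of "\<Theta>1 $ k" "\<Theta>2 $ k"] ln_det_le_tangent[of "\<Theta>2 $ k" "\<Theta>1 $ k"] assms
  by (simp add: Ypd_def inner_diff_left inner_diff_right)

text \<open>The coupling between \<open>X\<close> and \<open>(\<Theta>, \<Omega>)\<close> is skew
  and cancels in the inner product, and the penalty contributes a nonnegative term. The contribution
  of the inverse is kept instead of being bounded below by zero, because convergence is read off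
  from it.\<close>

lemma KKT_map_monotone_gap:
  assumes "v1 \<in> KKT_map S \<mu>1 \<mu>2 (X1, \<Theta>1, \<Omega>1)" "v2 \<in> KKT_map S \<mu>1 \<mu>2 (X2, \<Theta>2, \<Omega>2)"
    and "\<Omega>1 \<in> Y" "\<Omega>2 \<in> Y"
  shows "(inv_mats \<Theta>2 - inv_mats \<Theta>1) \<bullet> (\<Theta>1 - \<Theta>2) \<le> (v1 - v2) \<bullet> ((X1, \<Theta>1, \<Omega>1) - (X2, \<Theta>2, \<Omega>2))"
proof -
  obtain a1 b1 c1 a2 b2 c2 where v: "v1 = (a1, b1, c1)" "v2 = (a2, b2, c2)" by (metis surj_pair)
  have "0 \<le> ((c1 + X1) - (c2 + X2)) \<bullet> (\<Omega>1 - \<Omega>2)"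
    using assms by (intro subdiff_monotone) (auto simp: v KKT_map_iff)
  moreover have "a1 = - \<Theta>1 + \<Omega>1" "a2 = - \<Theta>2 + \<Omega>2"
    "b1 = - inv_mats \<Theta>1 + X1 + S" "b2 = - inv_mats \<Theta>2 + X2 + S"
    using assms by (auto simp: v KKT_map_iff)
  ultimately show ?thesis
    by (simp add: v inner_diff_left inner_diff_right inner_add_left inner_add_right inner_commute)
qed

lemma KKT_map_monotone:
  assumes "v1 \<in> KKT_map S \<mu>1 \<mu>2 w1" "v2 \<in> KKT_map S \<mu>1 \<mu>2 w2"
    and "w1 \<in> Y \<times> Y \<times> Y" "w2 \<in> Y \<times> Y \<times> Y"
  shows "0 \<le> (v1 - v2) \<bullet> (w1 - w2)"
proof -
  obtain X1 \<Theta>1 \<Omega>1 X2 \<Theta>2 \<Omega>2 where w: "w1 = (X1, \<Theta>1, \<Omega>1)" "w2 = (X2, \<Theta>2, \<Omega>2)"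
    by (metis surj_pair)
  have pd: "\<Theta>1 \<in> Ypd" "\<Theta>2 \<in> Ypd"
    using assms(1,2) unfolding w by (cases v1, cases v2, auto simp: KKT_map_iff)+
  have "0 \<le> (inv_mats \<Theta>2 - inv_mats \<Theta>1) \<bullet> (\<Theta>1 - \<Theta>2)"
    unfolding inner_vec_def[of "inv_mats \<Theta>2 - inv_mats \<Theta>1"]
    by (intro sum_nonneg) (simp add: inv_mats_monotone pd)
  also have "\<dots> \<le> (v1 - v2) \<bullet> (w1 - w2)"
    using assms unfolding w by (intro KKT_map_monotone_gap) auto
  finally show ?thesis .
qed

subsection \<open>Augmented Lagrangian\<close>

text \<open>The prox updates of \<open>\<Theta>t\<close> and \<open>\<Omega>t\<close> for a given
  \<open>X\<close>, written through their optimality conditions. Phrasing these as membership in the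
  KKT operator makes monotonicity applicable; the first component is the \<open>X\<close>-residual,
  which is left free because \<open>X\<close> is given.\<close>

definition prox_step ::
    "('p::finite, 'k::{finite,linorder}) mats \<Rightarrow> real \<Rightarrow> real \<Rightarrow> real \<Rightarrow> ('p, 'k) mats \<Rightarrow> ('p, 'k) mats \<Rightarrow>
     ('p, 'k) mats \<Rightarrow> ('p, 'k) mats \<Rightarrow> ('p, 'k) mats \<Rightarrow> bool" where
  "prox_step S \<mu>1 \<mu>2 \<sigma> \<Theta>t \<Omega>t X \<Theta>' \<Omega>' \<longleftrightarrow> \<Omega>' \<in> Y \<and>
     (- \<Theta>' + \<Omega>', (1 / \<sigma>) *\<^sub>R (\<Theta>t - \<Theta>'), (1 / \<sigma>) *\<^sub>R (\<Omega>t - \<Omega>')) \<in> KKT_map S \<mu>1 \<mu>2 (X, \<Theta>', \<Omega>')"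

lemma prox_step_iff:
  "prox_step S \<mu>1 \<mu>2 \<sigma> \<Theta>t \<Omega>t X \<Theta>' \<Omega>' \<longleftrightarrow> \<Omega>' \<in> Y \<and> \<Theta>' \<in> Ypd \<and>
     (1 / \<sigma>) *\<^sub>R (\<Theta>t - \<Theta>') = - inv_mats \<Theta>' + X + S \<and>
     (1 / \<sigma>) *\<^sub>R (\<Omega>t - \<Omega>') + X \<in> subdiff Y (penalty \<mu>1 \<mu>2) \<Omega>'"
  by (auto simp: prox_step_def KKT_map_iff)

text \<open>The two components decouple once \<open>X\<close> is fixed: \<open>\<Theta>'\<close>
  comes block by block from the spectral resolvent, \<open>\<Omega>'\<close> from the prox of the
  penalty scaled by \<open>\<sigma>\<close>.\<close>

lemma prox_step_exists:
  fixes S :: "('p::finite, 'k::{finite,linorder}) mats"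
  assumes Y: "S \<in> Y" "\<Theta>t \<in> Y" "\<Omega>t \<in> Y" "X \<in> Y" and \<mu>: "0 \<le> \<mu>1" "0 \<le> \<mu>2" and \<sigma>: "0 < \<sigma>"
  shows "\<exists>\<Theta>' \<Omega>'. prox_step S \<mu>1 \<mu>2 \<sigma> \<Theta>t \<Omega>t X \<Theta>' \<Omega>'"
proof -
  have "\<exists>B. B \<in> pd_mats \<and> B - \<sigma> *\<^sub>R matrix_inv B = (\<Theta>t - \<sigma> *\<^sub>R (X + S)) $ k" for k
  proof -
    have "\<Theta>t - \<sigma> *\<^sub>R (X + S) \<in> Y"
      using Y subspace_Y by (intro subspace_diff subspace_scale subspace_add)
    then have "(\<Theta>t - \<sigma> *\<^sub>R (X + S)) $ k \<in> sym_mats" by (simp add: Y_def)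
    from pd_mats_resolvent[OF this \<sigma>] show ?thesis by blast
  qed
  then obtain B where B: "\<And>k. B k \<in> pd_mats"
    "\<And>k. B k - \<sigma> *\<^sub>R matrix_inv (B k) = (\<Theta>t - \<sigma> *\<^sub>R (X + S)) $ k"
    by metis
  define \<Theta>' :: "('p, 'k) mats" where "\<Theta>' = (\<chi> k. B k)"
  have "\<Theta>' - \<sigma> *\<^sub>R inv_mats \<Theta>' = \<Theta>t - \<sigma> *\<^sub>R (X + S)"
    using B(2) by (simp add: \<Theta>'_def vec_eq_iff[of "_ - _" "_ - _"])
  then have "\<Theta>t - \<Theta>' = \<sigma> *\<^sub>R (- inv_mats \<Theta>' + X + S)"
    by (simp add: algebra_simps)
  then have 1: "(1 / \<sigma>) *\<^sub>R (\<Theta>t - \<Theta>') = - inv_mats \<Theta>' + X + S"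
    using \<sigma> by simp
  have "\<Theta>' \<in> Ypd" using B(1) by (simp add: Ypd_def \<Theta>'_def)
  obtain w where w: "w \<in> Y" and le: "\<And>y. y \<in> Y \<Longrightarrow>
      \<sigma> * penalty \<mu>1 \<mu>2 w + ((\<Omega>t + \<sigma> *\<^sub>R X) - w) \<bullet> (y - w) \<le> \<sigma> * penalty \<mu>1 \<mu>2 y"
  proof (rule convex_prox_exists[OF _ _ _ subspace_Y])
    show "convex_on UNIV (\<lambda>W. \<sigma> * penalty \<mu>1 \<mu>2 W)"
      using \<sigma> \<mu> by (intro convex_on_cmul convex_penalty) auto
    show "continuous_on UNIV (\<lambda>W. \<sigma> * penalty \<mu>1 \<mu>2 W)"
      by (intro continuous_on_mult_left continuous_on_penalty)
    show "0 \<le> \<sigma> * penalty \<mu>1 \<mu>2 W" for W :: "('p, 'k) mats"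
      using \<sigma> \<mu> by (simp add: penalty_nonneg)
  qed (use that in blast)
  have "(1 / \<sigma>) *\<^sub>R (\<Omega>t - w) + X \<in> subdiff Y (penalty \<mu>1 \<mu>2) w"
    unfolding subdiff_def
  proof (intro CollectI conjI ballI)
    show "(1 / \<sigma>) *\<^sub>R (\<Omega>t - w) + X \<in> Y"
      using Y w subspace_Y by (intro subspace_diff subspace_scale subspace_add)
    fix y :: "('p, 'k) mats" assume "y \<in> Y"
    have "(1 / \<sigma>) *\<^sub>R (\<Omega>t - w) + X = (1 / \<sigma>) *\<^sub>R ((\<Omega>t + \<sigma> *\<^sub>R X) - w)"
      using \<sigma> by (simp add: scaleR_diff_right scaleR_add_right)
    then have "\<sigma> * (penalty \<mu>1 \<mu>2 w + ((1 / \<sigma>) *\<^sub>R (\<Omega>t - w) + X) \<bullet> (y - w)) \<le> \<sigma> * penalty \<mu>1 \<mu>2 y"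
      using le[OF \<open>y \<in> Y\<close>] \<sigma> by (simp add: distrib_left)
    then show "penalty \<mu>1 \<mu>2 w + ((1 / \<sigma>) *\<^sub>R (\<Omega>t - w) + X) \<bullet> (y - w) \<le> penalty \<mu>1 \<mu>2 y"
      using \<sigma> by simp
  qed
  with 1 \<open>\<Theta>' \<in> Ypd\<close> w show ?thesis unfolding prox_step_iff by blast
qed

text \<open>The optimality conditions multiplied by \<open>\<sigma>\<close> are the subgradient
  conditions that single out a prox. The updates of the algorithm, defined by choice, thus coincide
  with any pair satisfying \<open>prox_step\<close>.\<close>

lemma prox_step_prox:
  fixes S :: "('p::finite, 'k::{finite,linorder}) mats"
  assumes step: "prox_step S \<mu>1 \<mu>2 \<sigma> \<Theta>t \<Omega>t X \<Theta>' \<Omega>'" and \<sigma>: "0 < \<sigma>"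
  shows "prox Y (\<lambda>W. ereal (\<sigma> * penalty \<mu>1 \<mu>2 W)) (\<Omega>t + \<sigma> *\<^sub>R X) = \<Omega>'"
    and "prox sym_mats (\<lambda>A. ereal \<sigma> * neg_logdet A) (\<Theta>t $ k - \<sigma> *\<^sub>R (X $ k + S $ k)) = \<Theta>' $ k"
proof -
  show "prox Y (\<lambda>W. ereal (\<sigma> * penalty \<mu>1 \<mu>2 W)) (\<Omega>t + \<sigma> *\<^sub>R X) = \<Omega>'"
  proof (rule prox_eqI)
    fix y :: "('p, 'k) mats" assume "y \<in> Y"
    then have "penalty \<mu>1 \<mu>2 \<Omega>' + ((1 / \<sigma>) *\<^sub>R (\<Omega>t - \<Omega>') + X) \<bullet> (y - \<Omega>') \<le> penalty \<mu>1 \<mu>2 y"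
      using step by (auto simp: prox_step_iff subdiff_def)
    then have "\<sigma> * (penalty \<mu>1 \<mu>2 \<Omega>' + ((1 / \<sigma>) *\<^sub>R (\<Omega>t - \<Omega>') + X) \<bullet> (y - \<Omega>')) \<le> \<sigma> * penalty \<mu>1 \<mu>2 y"
      using \<sigma> by simp
    moreover have "\<Omega>t + \<sigma> *\<^sub>R X - \<Omega>' = \<sigma> *\<^sub>R ((1 / \<sigma>) *\<^sub>R (\<Omega>t - \<Omega>') + X)"
      using \<sigma> by (simp add: scaleR_add_right)
    ultimately show "ereal (\<sigma> * penalty \<mu>1 \<mu>2 \<Omega>') + ereal ((\<Omega>t + \<sigma> *\<^sub>R X - \<Omega>') \<bullet> (y - \<Omega>')) \<le>
        ereal (\<sigma> * penalty \<mu>1 \<mu>2 y)"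
      by (simp add: distrib_left)
  qed (use step in \<open>auto simp: prox_step_iff\<close>)
  have pd: "\<Theta>' $ k \<in> pd_mats" using step by (simp add: prox_step_iff Ypd_def)
  have "(\<Theta>t - \<Theta>') = \<sigma> *\<^sub>R ((1 / \<sigma>) *\<^sub>R (\<Theta>t - \<Theta>'))" using \<sigma> by simp
  also have "(1 / \<sigma>) *\<^sub>R (\<Theta>t - \<Theta>') = - inv_mats \<Theta>' + X + S"
    using step by (simp add: prox_step_iff)
  finally have "(\<Theta>t - \<Theta>') $ k = (\<sigma> *\<^sub>R (- inv_mats \<Theta>' + X + S)) $ k" by (rule arg_cong)
  then have x: "\<Theta>t $ k - \<sigma> *\<^sub>R (X $ k + S $ k) - \<Theta>' $ k = - \<sigma> *\<^sub>R matrix_inv (\<Theta>' $ k)"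
    by (simp add: algebra_simps)
  show "prox sym_mats (\<lambda>A. ereal \<sigma> * neg_logdet A) (\<Theta>t $ k - \<sigma> *\<^sub>R (X $ k + S $ k)) = \<Theta>' $ k"
  proof (rule prox_eqI)
    show "\<Theta>' $ k \<in> sym_mats" using pd by (rule pd_imp_sym)
    show "ereal \<sigma> * neg_logdet (\<Theta>' $ k) \<noteq> \<infinity>" "ereal \<sigma> * neg_logdet (\<Theta>' $ k) \<noteq> - \<infinity>"
      using pd by (auto simp: neg_logdet_def)
    fix y :: "real^'p^'p" assume "y \<in> sym_mats"
    show "ereal \<sigma> * neg_logdet (\<Theta>' $ k) +
        ereal ((\<Theta>t $ k - \<sigma> *\<^sub>R (X $ k + S $ k) - \<Theta>' $ k) \<bullet> (y - \<Theta>' $ k)) \<le> ereal \<sigma> * neg_logdet y"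
    proof (cases "y \<in> pd_mats")
      case True
      have "\<sigma> * ln (det y) \<le> \<sigma> * (ln (det (\<Theta>' $ k)) + matrix_inv (\<Theta>' $ k) \<bullet> (y - \<Theta>' $ k))"
        using \<sigma> ln_det_le_tangent[OF pd True] by simp
      then show ?thesis unfolding x by (simp add: neg_logdet_def pd True distrib_left)
    qed (use \<sigma> in \<open>simp add: neg_logdet_def\<close>)
  qed
qed

text \<open>Monotonicity of the KKT operator for two steps from the same \<open>\<Theta>t\<close>
  and \<open>\<Omega>t\<close>, whose contributions cancel. It makes the map from \<open>X\<close>
  to \<open>\<Omega>' - \<Theta>'\<close> monotone.\<close>

lemma prox_step_cocoercive:
  assumes steps: "prox_step S \<mu>1 \<mu>2 \<sigma> \<Theta>t \<Omega>t X1 \<Theta>1 \<Omega>1" "prox_step S \<mu>1 \<mu>2 \<sigma> \<Theta>t \<Omega>t X2 \<Theta>2 \<Omega>2"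
    and "X1 \<in> Y" "X2 \<in> Y" and \<sigma>: "0 < \<sigma>"
  shows "(norm (\<Theta>1 - \<Theta>2))\<^sup>2 + (norm (\<Omega>1 - \<Omega>2))\<^sup>2 \<le> \<sigma> * (((\<Omega>1 - \<Theta>1) - (\<Omega>2 - \<Theta>2)) \<bullet> (X1 - X2))"
proof -
  let ?v1 = "(- \<Theta>1 + \<Omega>1, (1 / \<sigma>) *\<^sub>R (\<Theta>t - \<Theta>1), (1 / \<sigma>) *\<^sub>R (\<Omega>t - \<Omega>1))"
  let ?v2 = "(- \<Theta>2 + \<Omega>2, (1 / \<sigma>) *\<^sub>R (\<Theta>t - \<Theta>2), (1 / \<sigma>) *\<^sub>R (\<Omega>t - \<Omega>2))"
  have "0 \<le> (?v1 - ?v2) \<bullet> ((X1, \<Theta>1, \<Omega>1) - (X2, \<Theta>2, \<Omega>2))"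
  proof (rule KKT_map_monotone[of _ S \<mu>1 \<mu>2])
    have "\<Theta>1 \<in> Y" "\<Theta>2 \<in> Y" "\<Omega>1 \<in> Y" "\<Omega>2 \<in> Y"
      using steps by (auto simp: prox_step_iff Ypd_imp_Y)
    then show "(X1, \<Theta>1, \<Omega>1) \<in> Y \<times> Y \<times> Y" "(X2, \<Theta>2, \<Omega>2) \<in> Y \<times> Y \<times> Y"
      using assms(3,4) by auto
  qed (use steps in \<open>auto simp: prox_step_def\<close>)
  moreover have "(1 / \<sigma>) *\<^sub>R (a - b) - (1 / \<sigma>) *\<^sub>R (a - c) = - (1 / \<sigma>) *\<^sub>R (b - c)" for a b c :: "('a, 'b) mats"
    by (simp add: scaleR_diff_right)
  ultimately have "0 \<le> ((\<Omega>1 - \<Theta>1) - (\<Omega>2 - \<Theta>2)) \<bullet> (X1 - X2)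
      - (1 / \<sigma>) * (norm (\<Theta>1 - \<Theta>2))\<^sup>2 - (1 / \<sigma>) * (norm (\<Omega>1 - \<Omega>2))\<^sup>2"
    by (simp add: power2_norm_eq_inner)
  then have "((norm (\<Theta>1 - \<Theta>2))\<^sup>2 + (norm (\<Omega>1 - \<Omega>2))\<^sup>2) / \<sigma> \<le> ((\<Omega>1 - \<Theta>1) - (\<Omega>2 - \<Theta>2)) \<bullet> (X1 - X2)"
    by (simp add: add_divide_distrib)
  then show ?thesis using \<sigma> by (simp only: pos_divide_le_eq mult.commute[of \<sigma>])
qed

text \<open>Cocoercivity with Cauchy-Schwarz; the \<open>2\<close> comes from bounding the squared
  norm of a difference by twice the sum of squares. Taking \<open>X1 = X2\<close> shows that
  \<open>\<Omega>' - \<Theta>'\<close> depends on \<open>X\<close> only.\<close>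

lemma prox_step_Lipschitz:
  assumes "prox_step S \<mu>1 \<mu>2 \<sigma> \<Theta>t \<Omega>t X1 \<Theta>1 \<Omega>1" "prox_step S \<mu>1 \<mu>2 \<sigma> \<Theta>t \<Omega>t X2 \<Theta>2 \<Omega>2"
    and "X1 \<in> Y" "X2 \<in> Y" and \<sigma>: "0 < \<sigma>"
  shows "norm ((\<Omega>1 - \<Theta>1) - (\<Omega>2 - \<Theta>2)) \<le> 2 * \<sigma> * norm (X1 - X2)"
proof -
  define D where "D = (\<Omega>1 - \<Theta>1) - (\<Omega>2 - \<Theta>2)"
  have "D = (\<Omega>1 - \<Omega>2) - (\<Theta>1 - \<Theta>2)" by (simp add: D_def)
  then have "norm D \<le> norm (\<Omega>1 - \<Omega>2) + norm (\<Theta>1 - \<Theta>2)" by (simp add: norm_triangle_ineq4)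
  then have "(norm D)\<^sup>2 \<le> (norm (\<Omega>1 - \<Omega>2) + norm (\<Theta>1 - \<Theta>2))\<^sup>2" by (intro power_mono) auto
  also have "\<dots> \<le> 2 * ((norm (\<Theta>1 - \<Theta>2))\<^sup>2 + (norm (\<Omega>1 - \<Omega>2))\<^sup>2)"
    using sum_squares_bound[of "norm (\<Omega>1 - \<Omega>2)" "norm (\<Theta>1 - \<Theta>2)"] by (simp add: power2_sum)
  also have "\<dots> \<le> 2 * (\<sigma> * (D \<bullet> (X1 - X2)))"
    using prox_step_cocoercive[OF assms] by (simp add: D_def)
  also have "\<dots> \<le> 2 * (\<sigma> * (norm D * norm (X1 - X2)))"
    using \<sigma> by (simp add: norm_cauchy_schwarz)
  finally have "norm D * norm D \<le> norm D * (2 * \<sigma> * norm (X1 - X2))"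
    by (simp add: power2_eq_square mult_ac)
  then show ?thesis
    using \<sigma> unfolding D_def[symmetric] by (cases "norm D = 0") auto
qed

text \<open>The expression under the supremum in \<open>aug_lagrangian\<close> as a real number. The
  two agree for \<open>Z1\<close> in \<open>Ypd\<close>; otherwise the extended-real expression is
  minus infinity.\<close>

definition aug_value ::
    "('p::finite, 'k::{finite,linorder}) mats \<Rightarrow> real \<Rightarrow> real \<Rightarrow> real \<Rightarrow> ('p, 'k) mats \<Rightarrow> ('p, 'k) mats \<Rightarrow>
     ('p, 'k) mats \<Rightarrow> ('p, 'k) mats \<Rightarrow> ('p, 'k) mats \<Rightarrow> real" where
  "aug_value S \<mu>1 \<mu>2 \<sigma> \<Theta>t \<Omega>t X Z1 Z2 = - real_loss S Z1 - penalty \<mu>1 \<mu>2 Z2 - Z1 \<bullet> X + Z2 \<bullet> X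
     - 1 / (2 * \<sigma>) * (norm (Z1 - \<Theta>t))\<^sup>2 - 1 / (2 * \<sigma>) * (norm (Z2 - \<Omega>t))\<^sup>2"

text \<open>Tangent inequality at \<open>b\<close> for the convex function
  \<open>1 / (2 * \<sigma>)\<close> times the squared distance to \<open>a\<close>.\<close>

lemma three_points_le:
  fixes a b c :: "'a::real_inner"
  assumes "0 < \<sigma>"
  shows "1 / (2 * \<sigma>) * (norm (b - a))\<^sup>2 \<le> 1 / (2 * \<sigma>) * (norm (c - a))\<^sup>2 + ((1 / \<sigma>) *\<^sub>R (a - b)) \<bullet> (c - b)"
proof -
  have "(norm (c - a))\<^sup>2 = (norm (c - b))\<^sup>2 + (norm (b - a))\<^sup>2 - 2 * ((a - b) \<bullet> (c - b))"
    unfolding power2_norm_eq_inner by (simp add: inner_diff_left inner_diff_right inner_commute)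
  then have "(norm (b - a))\<^sup>2 \<le> (norm (c - a))\<^sup>2 + 2 * ((a - b) \<bullet> (c - b))" by simp
  then have "1 / (2 * \<sigma>) * (norm (b - a))\<^sup>2 \<le> 1 / (2 * \<sigma>) * ((norm (c - a))\<^sup>2 + 2 * ((a - b) \<bullet> (c - b)))"
    using assms by (intro mult_left_mono) auto
  then show ?thesis using assms by (simp add: distrib_left)
qed

text \<open>Add the tangent inequalities of the loss, the penalty and the two quadratic terms at
  \<open>(\<Theta>', \<Omega>')\<close>: \<open>prox_step\<close> says precisely that their slopes
  cancel, so the concave objective is maximal there.\<close>

lemma aug_value_le:
  assumes step: "prox_step S \<mu>1 \<mu>2 \<sigma> \<Theta>t \<Omega>t X \<Theta>' \<Omega>'" and \<sigma>: "0 < \<sigma>"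
    and Z: "Z1 \<in> Ypd" "Z2 \<in> Y"
  shows "aug_value S \<mu>1 \<mu>2 \<sigma> \<Theta>t \<Omega>t X Z1 Z2 \<le> aug_value S \<mu>1 \<mu>2 \<sigma> \<Theta>t \<Omega>t X \<Theta>' \<Omega>'"
proof -
  have "S - inv_mats \<Theta>' = (1 / \<sigma>) *\<^sub>R (\<Theta>t - \<Theta>') - X"
    using step by (simp add: prox_step_iff)
  then have "real_loss S \<Theta>' + ((1 / \<sigma>) *\<^sub>R (\<Theta>t - \<Theta>') - X) \<bullet> (Z1 - \<Theta>') \<le> real_loss S Z1"
    using real_loss_tangent[of \<Theta>' Z1 S] step Z by (simp add: prox_step_iff)
  moreover have "penalty \<mu>1 \<mu>2 \<Omega>' + ((1 / \<sigma>) *\<^sub>R (\<Omega>t - \<Omega>') + X) \<bullet> (Z2 - \<Omega>') \<le> penalty \<mu>1 \<mu>2 Z2"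
    using step Z(2) by (auto simp: prox_step_iff subdiff_def)
  moreover note three_points_le[OF \<sigma>, of \<Theta>' \<Theta>t Z1] three_points_le[OF \<sigma>, of \<Omega>' \<Omega>t Z2]
  moreover have "X \<bullet> (Z1 - \<Theta>') = Z1 \<bullet> X - \<Theta>' \<bullet> X" "X \<bullet> (Z2 - \<Omega>') = Z2 \<bullet> X - \<Omega>' \<bullet> X"
    by (simp_all add: inner_diff_right inner_commute)
  ultimately show ?thesis
    unfolding aug_value_def inner_diff_left[of _ X] inner_add_left[of _ X] by linarith
qed

lemma aug_lagrangian_eq:
  fixes S :: "('p::finite, 'k::{finite,linorder}) mats"
  assumes step: "prox_step S \<mu>1 \<mu>2 \<sigma> \<Theta>t \<Omega>t X \<Theta>' \<Omega>'" and \<sigma>: "0 < \<sigma>"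
  shows "aug_lagrangian S \<mu>1 \<mu>2 \<sigma> X \<Theta>t \<Omega>t = ereal (aug_value S \<mu>1 \<mu>2 \<sigma> \<Theta>t \<Omega>t X \<Theta>' \<Omega>')"
proof -
  let ?F = "\<lambda>(Z1, Z2). lagrangian S \<mu>1 \<mu>2 X Z1 Z2
        - ereal (1 / (2 * \<sigma>) * (norm (Z1 - \<Theta>t))\<^sup>2) - ereal (1 / (2 * \<sigma>) * (norm (Z2 - \<Omega>t))\<^sup>2)"
  have pd: "?F (Z1, Z2) = ereal (aug_value S \<mu>1 \<mu>2 \<sigma> \<Theta>t \<Omega>t X Z1 Z2)" if "Z1 \<in> Ypd" for Z1 Z2
    using that by (simp add: lagrangian_def loss_Ypd aug_value_def)
  have not_pd: "?F (Z1, Z2) = - \<infinity>" if "Z1 \<notin> Ypd" for Z1 Z2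
    using that by (simp add: lagrangian_def loss_not_Ypd)
  have mem: "(\<Theta>', \<Omega>') \<in> Y \<times> Y" "\<Theta>' \<in> Ypd" using step by (auto simp: prox_step_iff Ypd_imp_Y)
  show ?thesis
    unfolding aug_lagrangian_def
  proof (rule SUP_eqI)
    fix Z :: "('p, 'k) mats \<times> ('p, 'k) mats" assume Z: "Z \<in> Y \<times> Y"
    obtain Z1 Z2 where Z_eq: "Z = (Z1, Z2)" by (cases Z)
    show "?F Z \<le> ereal (aug_value S \<mu>1 \<mu>2 \<sigma> \<Theta>t \<Omega>t X \<Theta>' \<Omega>')"
    proof (cases "Z1 \<in> Ypd")
      case True
      then show ?thesis using Z unfolding Z_eq pd[OF True] by (simp add: aug_value_le[OF step \<sigma>])
    next
      case False
      then show ?thesis unfolding Z_eq not_pd[OF False] by simp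
    qed
  next
    fix y assume "\<And>Z. Z \<in> Y \<times> Y \<Longrightarrow> ?F Z \<le> y"
    from this[OF mem(1)] show "ereal (aug_value S \<mu>1 \<mu>2 \<sigma> \<Theta>t \<Omega>t X \<Theta>' \<Omega>') \<le> y"
      unfolding pd[OF mem(2)] .
  qed
qed

text \<open>Envelope argument: for fixed \<open>Z1\<close> and \<open>Z2\<close> the value is affine
  in \<open>X\<close> with slope \<open>Z2 - Z1\<close>, so the slope at the maximiser for
  \<open>x\<close> is a subgradient of the supremum at \<open>x\<close>. This selection is
  Lipschitz, hence is the gradient.\<close>

lemma gradient_subproblem:
  fixes S :: "('p::finite, 'k::{finite,linorder}) mats"
  assumes Y: "S \<in> Y" "Xt \<in> Y" "\<Theta>t \<in> Y" "\<Omega>t \<in> Y" and \<mu>: "0 \<le> \<mu>1" "0 \<le> \<mu>2" and \<sigma>: "0 < \<sigma>" and \<tau>: "0 \<le> \<tau>"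
    and X: "X \<in> Y" and step: "prox_step S \<mu>1 \<mu>2 \<sigma> \<Theta>t \<Omega>t X \<Theta>' \<Omega>'"
  shows "gradient_on Y (subproblem S \<mu>1 \<mu>2 \<sigma> \<tau> (Xt, \<Theta>t, \<Omega>t)) X = (\<Omega>' - \<Theta>') + (\<tau> / \<sigma>) *\<^sub>R (X - Xt)"
proof -
  have "\<forall>X. \<exists>\<Theta>' \<Omega>'. X \<in> Y \<longrightarrow> prox_step S \<mu>1 \<mu>2 \<sigma> \<Theta>t \<Omega>t X \<Theta>' \<Omega>'"
    using prox_step_exists[OF Y(1,3,4) _ \<mu> \<sigma>] by blast
  then obtain T W where TW: "\<And>X. X \<in> Y \<Longrightarrow> prox_step S \<mu>1 \<mu>2 \<sigma> \<Theta>t \<Omega>t X (T X) (W X)"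
    by metis
  let ?f = "subproblem S \<mu>1 \<mu>2 \<sigma> \<tau> (Xt, \<Theta>t, \<Omega>t)"
  define g where "g X = (W X - T X) + (\<tau> / \<sigma>) *\<^sub>R (X - Xt)" for X
  \<comment> \<open>The Lipschitz bound at distance zero identifies the given step with the chosen
    one, as far as the difference \<open>\<Omega>' - \<Theta>'\<close> is concerned.\<close>
  have "norm ((\<Omega>' - \<Theta>') - (W X - T X)) \<le> 2 * \<sigma> * norm (X - X)"
    by (rule prox_step_Lipschitz[OF step TW[OF X] X X \<sigma>])
  then have "(\<Omega>' - \<Theta>') + (\<tau> / \<sigma>) *\<^sub>R (X - Xt) = g X" by (simp add: g_def)
  moreover have "gradient_on Y ?f X = g X"
  proof (rule gradient_on_eqI[OF subspace_Y, where C = "2 * \<sigma> + \<tau> / \<sigma>"])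
    show "g x \<in> Y" if "x \<in> Y" for x
      unfolding g_def using TW[OF that] that Y(2) subspace_Y
      by (intro subspace_diff subspace_scale subspace_add) (auto simp: prox_step_iff Ypd_imp_Y)
  next
    fix x y :: "('p, 'k) mats" assume x: "x \<in> Y" and y: "y \<in> Y"
    have f: "?f u = aug_value S \<mu>1 \<mu>2 \<sigma> \<Theta>t \<Omega>t u (T u) (W u) + \<tau> / (2 * \<sigma>) * (norm (u - Xt))\<^sup>2"
      if "u \<in> Y" for u
      using aug_lagrangian_eq[OF TW[OF that] \<sigma>] by (simp add: subproblem_def)
    have "aug_value S \<mu>1 \<mu>2 \<sigma> \<Theta>t \<Omega>t x (T x) (W x) + (W x - T x) \<bullet> (y - x)
        = aug_value S \<mu>1 \<mu>2 \<sigma> \<Theta>t \<Omega>t y (T x) (W x)"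
      by (simp add: aug_value_def inner_diff_left inner_diff_right)
    also have "\<dots> \<le> aug_value S \<mu>1 \<mu>2 \<sigma> \<Theta>t \<Omega>t y (T y) (W y)"
      using TW[OF x] by (intro aug_value_le TW y \<sigma>) (auto simp: prox_step_iff)
    finally have "aug_value S \<mu>1 \<mu>2 \<sigma> \<Theta>t \<Omega>t x (T x) (W x) + (W x - T x) \<bullet> (y - x)
        \<le> aug_value S \<mu>1 \<mu>2 \<sigma> \<Theta>t \<Omega>t y (T y) (W y)" .
    moreover have "\<tau> / (2 * \<sigma>) * (norm (x - Xt))\<^sup>2 + ((\<tau> / \<sigma>) *\<^sub>R (x - Xt)) \<bullet> (y - x)
        \<le> \<tau> / (2 * \<sigma>) * (norm (y - Xt))\<^sup>2"
    proof -
      have "(norm (y - Xt))\<^sup>2 = (norm (y - x))\<^sup>2 + (norm (x - Xt))\<^sup>2 + 2 * ((x - Xt) \<bullet> (y - x))"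
        unfolding power2_norm_eq_inner by (simp add: inner_diff_left inner_diff_right inner_commute)
      then have "(norm (x - Xt))\<^sup>2 + 2 * ((x - Xt) \<bullet> (y - x)) \<le> (norm (y - Xt))\<^sup>2" by simp
      then have "\<tau> / (2 * \<sigma>) * ((norm (x - Xt))\<^sup>2 + 2 * ((x - Xt) \<bullet> (y - x))) \<le> \<tau> / (2 * \<sigma>) * (norm (y - Xt))\<^sup>2"
        using \<sigma> \<tau> by (intro mult_left_mono) auto
      then show ?thesis by (simp add: distrib_left)
    qed
    ultimately show "?f x + g x \<bullet> (y - x) \<le> ?f y"
      unfolding f[OF x] f[OF y] g_def inner_add_left by linarith
    have "norm (g y - g x) = norm (((W y - T y) - (W x - T x)) + (\<tau> / \<sigma>) *\<^sub>R (y - x))"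
      by (simp add: g_def scaleR_diff_right algebra_simps)
    also have "\<dots> \<le> 2 * \<sigma> * norm (y - x) + norm ((\<tau> / \<sigma>) *\<^sub>R (y - x))"
      by (intro norm_triangle_mono order_refl prox_step_Lipschitz[OF TW[OF y] TW[OF x] y x \<sigma>])
    also have "\<dots> = (2 * \<sigma> + \<tau> / \<sigma>) * norm (y - x)"
      using \<sigma> \<tau> by (simp add: distrib_right)
    finally show "norm (g y - g x) \<le> (2 * \<sigma> + \<tau> / \<sigma>) * norm (y - x)" .
  qed (rule X)
  ultimately show ?thesis by simp
qed

subsection \<open>Stability and resolvents of the KKT operator\<close>

lemma trace_le_norm: "trace A \<le> real CARD('n) * norm A" for A :: "real^'n^'n"
proof -
  have "A $ i $ i \<le> norm A" for i
    using component_le_norm_cart[of "A $ i" i] Finite_Cartesian_Product.norm_nth_le[of A i] by linarith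
  then show ?thesis
    unfolding trace_def using sum_bounded_above[of UNIV "\<lambda>i. A $ i $ i" "norm A"] by simp
qed

lemma pd_mats_trace_nonneg:
  fixes A :: "real^'n^'n"
  assumes "A \<in> pd_mats"
  shows "0 \<le> trace A"
proof -
  obtain M W :: "real^'n^'n" where "A = M ** transpose M" using pd_mats_factor[OF assms] by metis
  then have "trace A = transpose M \<bullet> transpose M" by (simp add: inner_matrix_trace)
  then show ?thesis by simp
qed

text \<open>From \<open>matrix_inv A - matrix_inv B = matrix_inv A ** (B - A) ** matrix_inv
  B\<close>. It turns convergence of matrices into convergence of inverses as soon as the inverses
  are bounded.\<close>

lemma norm_matrix_inv_diff_le:
  fixes A B :: "real^'n^'n"
  assumes "A \<in> pd_mats" "B \<in> pd_mats"
  shows "norm (matrix_inv A - matrix_inv B) \<le> norm (matrix_inv A) * norm (A - B) * norm (matrix_inv B)"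
proof -
  have "matrix_inv A ** (B - A) ** matrix_inv B = matrix_inv A ** (B ** matrix_inv B) - (matrix_inv A ** A) ** matrix_inv B"
    by (simp add: matrix_mult_diff_right matrix_mult_diff_left matrix_mul_assoc)
  then have "matrix_inv A - matrix_inv B = matrix_inv A ** (B - A) ** matrix_inv B"
    by (simp add: pd_mats_matrix_inv assms)
  also have "norm \<dots> \<le> norm (matrix_inv A ** (B - A)) * norm (matrix_inv B)"
    by (rule norm_matrix_mult_le)
  also have "\<dots> \<le> norm (matrix_inv A) * norm (B - A) * norm (matrix_inv B)"
    by (intro mult_right_mono norm_matrix_mult_le norm_ge_zero)
  finally show ?thesis by (simp add: norm_minus_commute)
qed

text \<open>Compare \<open>w n\<close> with \<open>zbar\<close>, whose residual is \<open>0\<close>: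
  the monotonicity gap is at most \<open>norm (v n)\<close> times a bounded factor, so strong
  monotonicity of the inverse forces \<open>\<Theta> n\<close> to converge. The equations for the
  first two residuals then carry \<open>X n\<close> and \<open>\<Omega> n\<close> along.\<close>

lemma KKT_map_sequence_tendsto:
  fixes S :: "('p::finite, 'k::{finite,linorder}) mats"
  assumes zbar: "zbar \<in> Y \<times> Y \<times> Y" "0 \<in> KKT_map S \<mu>1 \<mu>2 zbar"
    and w: "\<And>n. w n \<in> Y \<times> Y \<times> Y" and v: "\<And>n. v n \<in> KKT_map S \<mu>1 \<mu>2 (w n)"
    and bdd: "\<And>n. norm (w n) \<le> B" and lim: "v \<longlonglongrightarrow> 0"
  shows "w \<longlonglongrightarrow> zbar"
proof -
  define X \<Theta> \<Omega> where "X n = fst (w n)" and "\<Theta> n = fst (snd (w n))" and "\<Omega> n = snd (snd (w n))" for n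
  define a b where "a n = fst (v n)" and "b n = fst (snd (v n))" for n
  have w_eq: "w n = (X n, \<Theta> n, \<Omega> n)" for n by (simp add: X_def \<Theta>_def \<Omega>_def)
  obtain Xb \<Theta>b \<Omega>b where zb: "zbar = (Xb, \<Theta>b, \<Omega>b)" by (cases zbar)
  have ab: "a \<longlonglongrightarrow> 0" "b \<longlonglongrightarrow> 0"
    unfolding a_def b_def using tendsto_fst[OF lim] tendsto_fst[OF tendsto_snd[OF lim]]
    by (simp_all add: zero_prod_def)
  have v_eq: "v n = (a n, b n, snd (snd (v n)))" for n by (simp add: a_def b_def)
  have KKT: "\<Theta> n \<in> Ypd" "a n = - \<Theta> n + \<Omega> n" "b n = - inv_mats (\<Theta> n) + X n + S" for n
    using v[of n] unfolding w_eq by (subst (asm) v_eq, simp add: KKT_map_iff)+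
  have KKTb: "\<Theta>b \<in> Ypd" "\<Omega>b = \<Theta>b" "Xb = inv_mats \<Theta>b - S"
    using zbar(2) unfolding zb zero_prod_def by (auto simp: KKT_map_iff algebra_simps eq_neg_iff_add_eq_0)
  have "0 \<le> B" using norm_ge_zero[of "w 0"] bdd[of 0] by linarith
  have \<Theta>B: "norm (\<Theta> n) \<le> B" and XB: "norm (X n) \<le> B" for n
    using bdd[of n] norm_fst_le[of "X n" "(\<Theta> n, \<Omega> n)"] norm_snd_le[of "(\<Theta> n, \<Omega> n)" "X n"]
      norm_fst_le[of "\<Theta> n" "\<Omega> n"] unfolding w_eq by linarith+
  have gap: "(inv_mats \<Theta>b - inv_mats (\<Theta> n)) \<bullet> (\<Theta> n - \<Theta>b) \<le> norm (v n) * (B + norm zbar)" for n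
  proof -
    have "(inv_mats \<Theta>b - inv_mats (\<Theta> n)) \<bullet> (\<Theta> n - \<Theta>b) \<le> (v n - 0) \<bullet> (w n - zbar)"
      using v[of n] zbar w[of n] unfolding w_eq zb by (intro KKT_map_monotone_gap) auto
    also have "\<dots> \<le> norm (v n) * norm (w n - zbar)" using norm_cauchy_schwarz by simp
    also have "\<dots> \<le> norm (v n) * (B + norm zbar)"
      using bdd[of n] norm_triangle_ineq4[of "w n" zbar] by (intro mult_left_mono) auto
    finally show ?thesis .
  qed
  have \<Theta>k: "(\<lambda>n. \<Theta> n $ k) \<longlonglongrightarrow> \<Theta>b $ k" for k
  proof -
    have pd: "\<Theta>b $ k \<in> pd_mats" "\<Theta> n $ k \<in> pd_mats" for n
      using KKTb(1) KKT(1)[of n] by (auto simp: Ypd_def)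
    \<comment> \<open>The two traces from strong monotonicity, that of \<open>\<Theta> n $ k\<close>
      replaced by its bound, times the bounded factor of the gap.\<close>
    define K where "K = trace (\<Theta>b $ k) * (real CARD('p) * B) * (B + norm zbar)"
    have le: "(norm (\<Theta> n $ k - \<Theta>b $ k))\<^sup>2 \<le> K * norm (v n)" for n
    proof -
      let ?g = "\<lambda>k. (matrix_inv (\<Theta>b $ k) - matrix_inv (\<Theta> n $ k)) \<bullet> (\<Theta> n $ k - \<Theta>b $ k)"
      have nonneg: "0 \<le> ?g k" for k by (intro inv_mats_monotone KKT KKTb)
      have "?g k \<le> (\<Sum>k\<in>UNIV. ?g k)"
        by (intro member_le_sum) (auto simp: nonneg)
      also have "\<dots> = (inv_mats \<Theta>b - inv_mats (\<Theta> n)) \<bullet> (\<Theta> n - \<Theta>b)"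
        by (simp add: inner_vec_def[of "inv_mats \<Theta>b - inv_mats (\<Theta> n)"])
      finally have "?g k \<le> norm (v n) * (B + norm zbar)" using gap[of n] by linarith
      moreover have "trace (\<Theta> n $ k) \<le> real CARD('p) * B"
      proof -
        have "norm (\<Theta> n $ k) \<le> B"
          using Finite_Cartesian_Product.norm_nth_le[of "\<Theta> n" k] \<Theta>B[of n] by linarith
        then have "real CARD('p) * norm (\<Theta> n $ k) \<le> real CARD('p) * B"
          by (intro mult_left_mono) auto
        then show ?thesis using trace_le_norm[of "\<Theta> n $ k"] by linarith
      qed
      ultimately have "trace (\<Theta>b $ k) * trace (\<Theta> n $ k) * ?g k
          \<le> trace (\<Theta>b $ k) * (real CARD('p) * B) * (norm (v n) * (B + norm zbar))"
        using \<open>0 \<le> B\<close> pd nonneg by (intro mult_mono mult_nonneg_nonneg pd_mats_trace_nonneg) auto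
      then show ?thesis
        using matrix_inv_strongly_monotone[OF pd(1) pd(2)[of n]] by (simp add: K_def mult_ac)
    qed
    have "(\<lambda>n. K * norm (v n)) \<longlonglongrightarrow> 0"
      using tendsto_mult_left[OF tendsto_norm_zero[OF lim], of K] by simp
    then have "(\<lambda>n. (norm (\<Theta> n $ k - \<Theta>b $ k))\<^sup>2) \<longlonglongrightarrow> 0"
      by (rule Lim_null_comparison[rotated]) (simp add: le)
    then have "(\<lambda>n. sqrt ((norm (\<Theta> n $ k - \<Theta>b $ k))\<^sup>2)) \<longlonglongrightarrow> sqrt 0" by (rule tendsto_real_sqrt)
    then have "(\<lambda>n. norm (\<Theta> n $ k - \<Theta>b $ k)) \<longlonglongrightarrow> 0" by simp
    then show ?thesis by (simp add: tendsto_norm_zero_iff LIM_zero_iff)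
  qed
  then have \<Theta>_lim: "\<Theta> \<longlonglongrightarrow> \<Theta>b" by (rule vec_tendstoI)
  \<comment> \<open>The residual equation expresses the inverse of \<open>\<Theta> n\<close> as
    \<open>X n + S - b n\<close>, a bounded quantity, so no separate lower bound on eigenvalues is
    needed to pass to the limit in the inverse.\<close>
  obtain Bb where Bb: "\<And>n. norm (b n) \<le> Bb"
    using convergent_imp_bounded[OF ab(2)] by (auto simp: bounded_iff)
  have "(\<lambda>n. inv_mats (\<Theta> n)) \<longlonglongrightarrow> inv_mats \<Theta>b"
  proof (rule vec_tendstoI)
    fix k
    have pd: "\<Theta>b $ k \<in> pd_mats" "\<Theta> n $ k \<in> pd_mats" for n
      using KKTb(1) KKT(1)[of n] by (auto simp: Ypd_def)
    define K where "K = (B + norm S + Bb) * norm (matrix_inv (\<Theta>b $ k))"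
    have le: "norm (matrix_inv (\<Theta> n $ k) - matrix_inv (\<Theta>b $ k)) \<le> K * norm (\<Theta> n $ k - \<Theta>b $ k)" for n
    proof -
      have "inv_mats (\<Theta> n) = X n + S - b n" using KKT(3)[of n] by simp
      then have "norm (inv_mats (\<Theta> n)) \<le> B + norm S + Bb"
        using XB[of n] Bb[of n] norm_triangle_ineq[of "X n" S] norm_triangle_ineq4[of "X n + S" "b n"] by simp
      then have "norm (matrix_inv (\<Theta> n $ k)) \<le> B + norm S + Bb"
        using Finite_Cartesian_Product.norm_nth_le[of "inv_mats (\<Theta> n)" k] by simp
      then have "norm (matrix_inv (\<Theta> n $ k)) * norm (\<Theta> n $ k - \<Theta>b $ k) * norm (matrix_inv (\<Theta>b $ k))
          \<le> (B + norm S + Bb) * norm (\<Theta> n $ k - \<Theta>b $ k) * norm (matrix_inv (\<Theta>b $ k))"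
        by (intro mult_right_mono) auto
      then show ?thesis
        using norm_matrix_inv_diff_le[OF pd(2)[of n] pd(1)] by (simp add: K_def mult_ac)
    qed
    have "(\<lambda>n. K * norm (\<Theta> n $ k - \<Theta>b $ k)) \<longlonglongrightarrow> 0"
      using tendsto_mult_left[OF tendsto_norm_zero[OF LIM_zero[OF \<Theta>k]], of K] by simp
    then have "(\<lambda>n. matrix_inv (\<Theta> n $ k) - matrix_inv (\<Theta>b $ k)) \<longlonglongrightarrow> 0"
      by (rule Lim_null_comparison[rotated]) (simp add: le)
    then show "(\<lambda>n. inv_mats (\<Theta> n) $ k) \<longlonglongrightarrow> inv_mats \<Theta>b $ k"
      by (simp add: LIM_zero_iff)
  qed
  then have "(\<lambda>n. b n + inv_mats (\<Theta> n) - S) \<longlonglongrightarrow> 0 + inv_mats \<Theta>b - S"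
    by (intro tendsto_intros ab)
  moreover have "b n + inv_mats (\<Theta> n) - S = X n" for n using KKT(3)[of n] by simp
  ultimately have X_lim: "X \<longlonglongrightarrow> Xb" by (simp add: KKTb)
  have "(\<lambda>n. a n + \<Theta> n) \<longlonglongrightarrow> 0 + \<Theta>b" by (intro tendsto_intros ab \<Theta>_lim)
  moreover have "a n + \<Theta> n = \<Omega> n" for n using KKT(2)[of n] by simp
  ultimately have "\<Omega> \<longlonglongrightarrow> \<Omega>b" by (simp add: KKTb)
  then have "(\<lambda>n. (X n, \<Theta> n, \<Omega> n)) \<longlonglongrightarrow> zbar"
    unfolding zb by (intro tendsto_Pair X_lim \<Theta>_lim)
  then show ?thesis by (simp add: w_eq[symmetric])
qed

text \<open>The constant sequence \<open>w\<close> has zero residuals and therefore converges to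
  \<open>zbar\<close>.\<close>

lemma KKT_map_zero_unique:
  assumes "zbar \<in> Y \<times> Y \<times> Y" "0 \<in> KKT_map S \<mu>1 \<mu>2 zbar" "w \<in> Y \<times> Y \<times> Y" "0 \<in> KKT_map S \<mu>1 \<mu>2 w"
  shows "w = zbar"
proof -
  have "(\<lambda>_::nat. w) \<longlonglongrightarrow> zbar"
    by (rule KKT_map_sequence_tendsto[OF assms(1,2), where v = "\<lambda>_. 0" and B = "norm w"])
      (simp_all add: assms(3,4))
  then show ?thesis by (simp add: LIMSEQ_const_iff)
qed

text \<open>Eliminating \<open>\<Theta>\<close> and \<open>\<Omega>\<close> by
  \<open>prox_step\<close> leaves the equation \<open>g X = 0\<close>, where \<open>g\<close> is the
  gradient of the subproblem. Cocoercivity makes its first part monotone, and the proximal term in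
  \<open>X\<close> adds the modulus \<open>\<tau> / \<sigma>\<close>.\<close>

lemma KKT_map_resolvent:
  fixes S :: "('p::finite, 'k::{finite,linorder}) mats"
  assumes S: "S \<in> Y" and \<mu>: "0 \<le> \<mu>1" "0 \<le> \<mu>2" and \<sigma>: "0 < \<sigma>" and \<tau>: "0 < \<tau>" and z: "z \<in> Y \<times> Y \<times> Y"
  obtains w where "w \<in> Y \<times> Y \<times> Y" "(1 / \<sigma>) *\<^sub>R Q_op \<tau> (z - w) \<in> KKT_map S \<mu>1 \<mu>2 w"
proof -
  obtain Xt \<Theta>t \<Omega>t where z_eq: "z = (Xt, \<Theta>t, \<Omega>t)" by (cases z)
  have Y: "Xt \<in> Y" "\<Theta>t \<in> Y" "\<Omega>t \<in> Y" using z by (auto simp: z_eq)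
  have "\<forall>X. \<exists>\<Theta>' \<Omega>'. X \<in> Y \<longrightarrow> prox_step S \<mu>1 \<mu>2 \<sigma> \<Theta>t \<Omega>t X \<Theta>' \<Omega>'"
    using prox_step_exists[OF S Y(2,3) _ \<mu> \<sigma>] by blast
  then obtain T W where TW: "\<And>X. X \<in> Y \<Longrightarrow> prox_step S \<mu>1 \<mu>2 \<sigma> \<Theta>t \<Omega>t X (T X) (W X)"
    by metis
  have TWY: "T X \<in> Y" "W X \<in> Y" if "X \<in> Y" for X
    using TW[OF that] by (auto simp: prox_step_iff Ypd_imp_Y)
  define g where "g X = (W X - T X) + (\<tau> / \<sigma>) *\<^sub>R (X - Xt)" for X
  have g_diff: "g x - g y = ((W x - T x) - (W y - T y)) + (\<tau> / \<sigma>) *\<^sub>R (x - y)" for x y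
    by (simp add: g_def scaleR_diff_right algebra_simps)
  obtain X where X: "X \<in> Y" "g X = 0"
  proof (rule strongly_monotone_zero[OF subspace_Y, of g "\<tau> / \<sigma>" "2 * \<sigma> + \<tau> / \<sigma>"])
    show "g x \<in> Y" if "x \<in> Y" for x
      unfolding g_def using TWY that Y(1) subspace_Y
      by (intro subspace_diff subspace_scale subspace_add)
    show "0 < \<tau> / \<sigma>" using \<sigma> \<tau> by simp
    fix x y :: "('p, 'k) mats" assume xy: "x \<in> Y" "y \<in> Y"
    have "0 \<le> \<sigma> * (((W x - T x) - (W y - T y)) \<bullet> (x - y))"
      using prox_step_cocoercive[OF TW[OF xy(1)] TW[OF xy(2)] xy \<sigma>]
      by (meson add_nonneg_nonneg order_trans zero_le_power2)
    then have "0 \<le> ((W x - T x) - (W y - T y)) \<bullet> (x - y)"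
      using \<sigma> by (simp add: zero_le_mult_iff)
    then show "\<tau> / \<sigma> * (norm (x - y))\<^sup>2 \<le> (g x - g y) \<bullet> (x - y)"
      unfolding g_diff inner_add_left by (simp add: power2_norm_eq_inner)
    have "norm (g x - g y) \<le> 2 * \<sigma> * norm (x - y) + norm ((\<tau> / \<sigma>) *\<^sub>R (x - y))"
      unfolding g_diff
      by (intro norm_triangle_mono order_refl prox_step_Lipschitz[OF TW[OF xy(1)] TW[OF xy(2)] xy \<sigma>])
    also have "\<dots> = (2 * \<sigma> + \<tau> / \<sigma>) * norm (x - y)"
      using \<sigma> \<tau> by (simp add: distrib_right)
    finally show "norm (g x - g y) \<le> (2 * \<sigma> + \<tau> / \<sigma>) * norm (x - y)" .
  qed (use that in blast)
  have "(1 / \<sigma>) *\<^sub>R Q_op \<tau> (z - (X, T X, W X)) = (- T X + W X, (1 / \<sigma>) *\<^sub>R (\<Theta>t - T X), (1 / \<sigma>) *\<^sub>R (\<Omega>t - W X))"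
  proof -
    have "- T X + W X = (\<tau> / \<sigma>) *\<^sub>R (Xt - X)"
      using X(2) unfolding g_def by (simp add: scaleR_diff_right eq_neg_iff_add_eq_0 algebra_simps)
    then show ?thesis by (simp add: z_eq Q_op_def)
  qed
  then have "(1 / \<sigma>) *\<^sub>R Q_op \<tau> (z - (X, T X, W X)) \<in> KKT_map S \<mu>1 \<mu>2 (X, T X, W X)"
    using TW[OF X(1)] by (simp add: prox_step_def)
  then show thesis using X(1) TWY[OF X(1)] by (intro that[of "(X, T X, W X)"]) auto
qed

subsection \<open>Inexact proximal point steps\<close>

text \<open>The square root of \<open>Q_op\<close>: the weighted norm becomes the Euclidean norm of
  the image, so Euclidean identities and Cauchy-Schwarz apply directly.\<close>

definition Q_root :: "real \<Rightarrow> 'a::real_vector \<times> 'b \<times> 'c \<Rightarrow> 'a \<times> 'b \<times> 'c" where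
  "Q_root \<tau> = (\<lambda>(X, \<Theta>, \<Omega>). (sqrt \<tau> *\<^sub>R X, \<Theta>, \<Omega>))"

lemma Q_root_diff: "Q_root \<tau> (x - y) = Q_root \<tau> x - Q_root \<tau> y"
  for x y :: "'a::real_vector \<times> 'b::ab_group_add \<times> 'c::ab_group_add"
  by (cases x, cases y) (simp add: Q_root_def scaleR_diff_right)

lemma Q_root_Q_root: "0 \<le> \<tau> \<Longrightarrow> Q_root \<tau> (Q_root \<tau> x) = Q_op \<tau> x"
  by (cases x) (simp add: Q_root_def Q_op_def)

lemma inner_Q_op: "0 \<le> \<tau> \<Longrightarrow> x \<bullet> Q_op \<tau> y = Q_root \<tau> x \<bullet> Q_root \<tau> y"
  for x y :: "'a::real_inner \<times> 'b::real_inner \<times> 'c::real_inner"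
  by (cases x, cases y) (simp add: Q_root_def Q_op_def flip: mult.assoc)

lemma Q_norm_eq: "0 \<le> \<tau> \<Longrightarrow> Q_norm \<tau> x = norm (Q_root \<tau> x)"
  by (simp add: Q_norm_def inner_Q_op norm_eq_sqrt_inner)

lemma norm_triple_squared: "(norm (x, y, z))\<^sup>2 = (norm x)\<^sup>2 + (norm y)\<^sup>2 + (norm z)\<^sup>2"
  by (simp add: norm_Pair)

text \<open>\<open>Q_root \<tau>\<close> is diagonal with eigenvalues \<open>sqrt \<tau>\<close> and
  \<open>1\<close>; this bound and the next use the smaller and the larger one.\<close>

lemma norm_Q_root_ge:
  fixes x :: "'a::real_inner \<times> 'b::real_inner \<times> 'c::real_inner"
  assumes "0 \<le> \<tau>"
  shows "min (sqrt \<tau>) 1 * norm x \<le> norm (Q_root \<tau> x)"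
proof (rule power2_le_imp_le)
  obtain a b c where x: "x = (a, b, c)" by (cases x)
  let ?m = "min (sqrt \<tau>) 1"
  have "0 \<le> ?m" using assms by simp
  then have "?m\<^sup>2 \<le> (sqrt \<tau>)\<^sup>2" "?m\<^sup>2 \<le> 1\<^sup>2" by (intro power_mono; simp)+
  then have "?m\<^sup>2 \<le> \<tau>" "?m\<^sup>2 \<le> 1" using assms by simp_all
  then have "?m\<^sup>2 * (norm a)\<^sup>2 + ?m\<^sup>2 * (norm b)\<^sup>2 + ?m\<^sup>2 * (norm c)\<^sup>2
      \<le> \<tau> * (norm a)\<^sup>2 + 1 * (norm b)\<^sup>2 + 1 * (norm c)\<^sup>2"
    by (intro add_mono mult_right_mono) auto
  then show "(?m * norm x)\<^sup>2 \<le> (norm (Q_root \<tau> x))\<^sup>2"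
    using assms by (simp add: x Q_root_def power_mult_distrib norm_triple_squared distrib_left)
qed simp

lemma norm_Q_root_le:
  fixes x :: "'a::real_inner \<times> 'b::real_inner \<times> 'c::real_inner"
  assumes "0 \<le> \<tau>"
  shows "norm (Q_root \<tau> x) \<le> sqrt (max \<tau> 1) * norm x"
proof (rule power2_le_imp_le)
  obtain a b c where x: "x = (a, b, c)" by (cases x)
  have "\<tau> * (norm a)\<^sup>2 + 1 * (norm b)\<^sup>2 + 1 * (norm c)\<^sup>2
      \<le> max \<tau> 1 * (norm a)\<^sup>2 + max \<tau> 1 * (norm b)\<^sup>2 + max \<tau> 1 * (norm c)\<^sup>2"
    by (intro add_mono mult_right_mono) auto
  then show "(norm (Q_root \<tau> x))\<^sup>2 \<le> (sqrt (max \<tau> 1) * norm x)\<^sup>2"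
    using assms by (simp add: x Q_root_def power_mult_distrib norm_triple_squared distrib_left)
qed simp

lemma Q_norm_mono: "0 \<le> \<tau> \<Longrightarrow> \<tau> \<le> \<tau>' \<Longrightarrow> Q_norm \<tau> x \<le> Q_norm \<tau>' x"
  by (cases x) (auto simp: Q_norm_def Q_op_def intro!: real_sqrt_le_mono add_mono mult_right_mono)

lemma Q_norm_nonneg: "0 \<le> \<tau> \<Longrightarrow> 0 \<le> Q_norm \<tau> x"
  by (simp add: Q_norm_eq)

lemma Q_norm_triangle:
  fixes x y z :: "'a::real_inner \<times> 'b::real_inner \<times> 'c::real_inner"
  assumes "0 \<le> \<tau>"
  shows "Q_norm \<tau> (x - z) \<le> Q_norm \<tau> (x - y) + Q_norm \<tau> (y - z)"
proof -
  have "Q_root \<tau> (x - z) = Q_root \<tau> (x - y) + Q_root \<tau> (y - z)" by (simp add: Q_root_diff)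
  then show ?thesis using assms by (simp add: Q_norm_eq norm_triangle_ineq)
qed

lemma Q_norm_minus_commute: "0 \<le> \<tau> \<Longrightarrow> Q_norm \<tau> (x - y) = Q_norm \<tau> (y - x)"
  for x y :: "'a::real_inner \<times> 'b::real_inner \<times> 'c::real_inner"
  by (simp add: Q_norm_eq Q_root_diff norm_minus_commute)

text \<open>The error sits in the \<open>X\<close>-component alone, so the factor
  \<open>sqrt \<tau>\<close> in its bound is just the weight needed to turn \<open>norm a\<close>
  into part of the \<open>Q\<close>-norm.\<close>

lemma inner_fst_le_Q_norm:
  fixes e :: "'a::real_inner" and x :: "'a \<times> 'b::real_inner \<times> 'c::real_inner"
  assumes "0 \<le> \<tau>" "0 \<le> E" "\<sigma> * norm e \<le> sqrt \<tau> * E" "0 \<le> \<sigma>"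
  shows "\<sigma> * ((e, 0, 0) \<bullet> x) \<le> E * Q_norm \<tau> x"
proof -
  obtain a b c where x: "x = (a, b, c)" by (cases x)
  have "\<sigma> * ((e, 0, 0) \<bullet> x) \<le> \<sigma> * (norm e * norm a)"
    using assms(4) by (simp add: x mult_left_mono norm_cauchy_schwarz)
  also have "\<dots> \<le> sqrt \<tau> * E * norm a"
    using mult_right_mono[OF assms(3), of "norm a"] by (simp add: mult.assoc)
  also have "\<dots> = E * norm (sqrt \<tau> *\<^sub>R a)" using assms(1) by simp
  also have "\<dots> \<le> E * Q_norm \<tau> x"
    using assms(1,2) norm_fst_le[of "sqrt \<tau> *\<^sub>R a" "(b, c)"]
    by (intro mult_left_mono) (simp_all add: Q_norm_eq x Q_root_def)
  finally show ?thesis .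
qed

text \<open>Monotonicity between the inclusion at \<open>z'\<close> and the zero at
  \<open>zbar\<close> gives \<open>0 \<le> E * norm b + (a - b) \<bullet> b\<close>. Expanding the
  inner product as squares yields the first claim, Cauchy-Schwarz and division by
  \<open>norm b\<close> the second.\<close>

lemma inexact_step_Fejer:
  fixes zbar z z' :: "('p::finite, 'k::{finite,linorder}) mats \<times> ('p, 'k) mats \<times> ('p, 'k) mats"
  assumes zbar: "zbar \<in> Y \<times> Y \<times> Y" "0 \<in> KKT_map S \<mu>1 \<mu>2 zbar"
    and z': "z' \<in> Y \<times> Y \<times> Y" "(e, 0, 0) + (1 / \<sigma>) *\<^sub>R Q_op \<tau> (z - z') \<in> KKT_map S \<mu>1 \<mu>2 z'"
    and \<sigma>: "0 < \<sigma>" and \<tau>: "0 \<le> \<tau>" and E: "0 \<le> E" "\<sigma> * norm e \<le> sqrt \<tau> * E"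
  shows "(Q_norm \<tau> (z' - zbar))\<^sup>2 + (Q_norm \<tau> (z' - z))\<^sup>2
      \<le> (Q_norm \<tau> (z - zbar))\<^sup>2 + 2 * E * Q_norm \<tau> (z' - zbar)"
    and "Q_norm \<tau> (z' - zbar) \<le> Q_norm \<tau> (z - zbar) + E"
proof -
  define a where "a = Q_root \<tau> (z - zbar)"
  define b where "b = Q_root \<tau> (z' - zbar)"
  have ab: "Q_root \<tau> (z - z') = a - b" by (simp add: a_def b_def Q_root_diff)
  have "0 \<le> ((e, 0, 0) + (1 / \<sigma>) *\<^sub>R Q_op \<tau> (z - z') - 0) \<bullet> (z' - zbar)"
    by (rule KKT_map_monotone[OF z'(2) zbar(2) z'(1) zbar(1)])
  then have "0 \<le> \<sigma> * ((e, 0, 0) \<bullet> (z' - zbar) + (1 / \<sigma>) * ((z' - zbar) \<bullet> Q_op \<tau> (z - z')))"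
    using \<sigma> by (intro mult_nonneg_nonneg) (simp_all add: inner_add_left inner_commute[of "Q_op _ _"])
  then have "0 \<le> \<sigma> * ((e, 0, 0) \<bullet> (z' - zbar)) + (a - b) \<bullet> b"
    using \<sigma> \<tau> by (simp add: distrib_left inner_Q_op ab b_def[symmetric] inner_commute)
  also have "\<sigma> * ((e, 0, 0) \<bullet> (z' - zbar)) \<le> E * norm b"
    using inner_fst_le_Q_norm[OF \<tau> E, of "z' - zbar"] \<sigma> \<tau> by (simp add: Q_norm_eq b_def)
  finally have *: "0 \<le> E * norm b + (a - b) \<bullet> b" by simp
  have "(norm a)\<^sup>2 = (norm b)\<^sup>2 + (norm (b - a))\<^sup>2 + 2 * ((a - b) \<bullet> b)"
    unfolding power2_norm_eq_inner by (simp add: inner_diff_left inner_diff_right inner_commute)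
  with * have "(norm b)\<^sup>2 + (norm (b - a))\<^sup>2 \<le> (norm a)\<^sup>2 + 2 * E * norm b" by simp
  moreover have "Q_root \<tau> (z' - z) = b - a" by (simp add: a_def b_def Q_root_diff)
  ultimately show "(Q_norm \<tau> (z' - zbar))\<^sup>2 + (Q_norm \<tau> (z' - z))\<^sup>2
      \<le> (Q_norm \<tau> (z - zbar))\<^sup>2 + 2 * E * Q_norm \<tau> (z' - zbar)"
    using \<tau> by (simp add: Q_norm_eq a_def b_def)
  have "a \<bullet> b \<le> norm a * norm b" by (rule norm_cauchy_schwarz)
  with * have "norm b * norm b \<le> norm b * (norm a + E)"
    by (simp add: inner_diff_left algebra_simps flip: power2_norm_eq_inner power2_eq_square)
  then have "norm b \<le> norm a + E" using E(1) by (cases "norm b = 0") auto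
  then show "Q_norm \<tau> (z' - zbar) \<le> Q_norm \<tau> (z - zbar) + E"
    using \<tau> by (simp add: Q_norm_eq a_def b_def)
qed

text \<open>Both inclusions start from the same \<open>z\<close>, so subtracting them leaves only
  the error and the term in \<open>z' - w\<close>; monotonicity bounds the squared
  \<open>Q\<close>-norm of that difference by \<open>E\<close> times its
  \<open>Q\<close>-norm.\<close>

lemma inexact_step_close:
  fixes z z' w :: "('p::finite, 'k::{finite,linorder}) mats \<times> ('p, 'k) mats \<times> ('p, 'k) mats"
  assumes w: "w \<in> Y \<times> Y \<times> Y" "(1 / \<sigma>) *\<^sub>R Q_op \<tau> (z - w) \<in> KKT_map S \<mu>1 \<mu>2 w"
    and z': "z' \<in> Y \<times> Y \<times> Y" "(e, 0, 0) + (1 / \<sigma>) *\<^sub>R Q_op \<tau> (z - z') \<in> KKT_map S \<mu>1 \<mu>2 z'"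
    and \<sigma>: "0 < \<sigma>" and \<tau>: "0 \<le> \<tau>" and E: "0 \<le> E" "\<sigma> * norm e \<le> sqrt \<tau> * E"
  shows "Q_norm \<tau> (z' - w) \<le> E"
proof -
  define b where "b = Q_root \<tau> (z' - w)"
  have Q_lin: "Q_op \<tau> (z - z') - Q_op \<tau> (z - w) = - Q_op \<tau> (z' - w)"
    by (cases z, cases z', cases w) (simp add: Q_op_def scaleR_diff_right)
  have "0 \<le> (((e, 0, 0) + (1 / \<sigma>) *\<^sub>R Q_op \<tau> (z - z')) - (1 / \<sigma>) *\<^sub>R Q_op \<tau> (z - w)) \<bullet> (z' - w)"
    by (rule KKT_map_monotone[OF z'(2) w(2) z'(1) w(1)])
  also have "((e, 0, 0) + (1 / \<sigma>) *\<^sub>R Q_op \<tau> (z - z')) - (1 / \<sigma>) *\<^sub>R Q_op \<tau> (z - w)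
      = (e, 0, 0) + (1 / \<sigma>) *\<^sub>R (Q_op \<tau> (z - z') - Q_op \<tau> (z - w))"
    by (simp add: scaleR_diff_right)
  finally have "0 \<le> (e, 0, 0) \<bullet> (z' - w) - (1 / \<sigma>) * (Q_op \<tau> (z' - w) \<bullet> (z' - w))"
    unfolding Q_lin by (simp add: inner_diff_left)
  then have "0 \<le> \<sigma> * ((e, 0, 0) \<bullet> (z' - w) - (1 / \<sigma>) * ((z' - w) \<bullet> Q_op \<tau> (z' - w)))"
    using \<sigma> by (simp add: inner_commute)
  then have "norm b * norm b \<le> \<sigma> * ((e, 0, 0) \<bullet> (z' - w))"
    using \<sigma> \<tau> by (simp add: right_diff_distrib inner_Q_op b_def[symmetric] power2_norm_eq_inner flip: power2_eq_square)
  also have "\<dots> \<le> norm b * E"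
    using inner_fst_le_Q_norm[OF \<tau> E, of "z' - w"] \<sigma> \<tau> by (simp add: Q_norm_eq b_def mult.commute)
  finally have "norm b \<le> E" using E(1) by (cases "norm b = 0") auto
  then show ?thesis using \<tau> by (simp add: Q_norm_eq b_def)
qed

text \<open>Brings both stopping criteria to the form expected by the step lemmas, with
  \<open>E = \<epsilon> * c\<close>: criterion (A) has \<open>\<epsilon> = 1\<close>, criterion (B)
  has \<open>c\<close> the length of the step.\<close>

lemma error_bound_scale:
  fixes \<sigma> \<tau> \<epsilon> c :: real
  assumes "norm e \<le> \<epsilon> * min (sqrt \<tau>) 1 / \<sigma> * c" "0 < \<sigma>" "0 \<le> \<epsilon> * c"
  shows "\<sigma> * norm e \<le> sqrt \<tau> * (\<epsilon> * c)"
proof -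
  have "\<sigma> * norm e \<le> \<sigma> * (\<epsilon> * min (sqrt \<tau>) 1 / \<sigma> * c)"
    using assms by (intro mult_left_mono) auto
  also have "\<dots> = min (sqrt \<tau>) 1 * (\<epsilon> * c)" using assms(2) by simp
  also have "\<dots> \<le> sqrt \<tau> * (\<epsilon> * c)" using assms(3) by (intro mult_right_mono) auto
  finally show ?thesis .
qed

lemma inexact_proximal_point_converges:
  fixes z :: "nat \<Rightarrow> ('p::finite, 'k::{finite,linorder}) mats \<times> ('p, 'k) mats \<times> ('p, 'k) mats"
  assumes zbar: "zbar \<in> Y \<times> Y \<times> Y" "0 \<in> KKT_map S \<mu>1 \<mu>2 zbar"
    and z: "\<And>t. z t \<in> Y \<times> Y \<times> Y"
      "\<And>t. (e t, 0, 0) + (1 / \<sigma> t) *\<^sub>R Q_op (\<tau> t) (z t - z (Suc t)) \<in> KKT_map S \<mu>1 \<mu>2 (z (Suc t))"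
    and \<sigma>: "0 < \<sigma>_min" "\<And>t. \<sigma>_min \<le> \<sigma> t" and \<tau>: "decseq \<tau>" "0 < \<tau>_min" "\<And>t. \<tau>_min \<le> \<tau> t"
    and \<epsilon>: "\<And>t. 0 \<le> \<epsilon> t" "summable \<epsilon>" and e: "\<And>t. norm (e t) \<le> min (sqrt (\<tau> t)) 1 / \<sigma> t * \<epsilon> t"
  shows "Q_norm (\<tau> t) (z t - zbar) \<le> Q_norm (\<tau> 0) (z 0 - zbar) + (\<Sum>i. \<epsilon> i)"
    and "z \<longlonglongrightarrow> zbar"
proof -
  have pos: "0 < \<sigma> t" "0 \<le> \<tau> t" for t using \<sigma>(1) \<sigma>(2)[of t] \<tau>(2) \<tau>(3)[of t] by auto
  define a where "a t = Q_norm (\<tau> t) (z t - zbar)" for t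
  define b where "b t = Q_norm (\<tau> t) (z (Suc t) - zbar)" for t
  define d where "d t = Q_norm (\<tau> t) (z (Suc t) - z t)" for t
  have E: "\<sigma> t * norm (e t) \<le> sqrt (\<tau> t) * \<epsilon> t" for t
    using error_bound_scale[of "e t" 1 "\<tau> t" "\<sigma> t" "\<epsilon> t"] e[of t] pos[of t] \<epsilon>(1)[of t] by simp
  note Fejer = inexact_step_Fejer[OF zbar z(1) z(2) pos(1) pos(2) \<epsilon>(1) E]
  have step: "(b t)\<^sup>2 + (d t)\<^sup>2 \<le> (a t)\<^sup>2 + 2 * \<epsilon> t * b t" "b t \<le> a t + \<epsilon> t" for t
    using Fejer[of t] by (auto simp: a_def b_def d_def)
  \<comment> \<open>The metric changes with \<open>t\<close>, but a decreasing \<open>\<tau>\<close>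
    only shrinks the norm, so the one-step estimates still chain.\<close>
  have next_le: "a (Suc t) \<le> b t" for t
    unfolding a_def b_def using \<tau>(1) pos(2) by (intro Q_norm_mono) (auto simp: decseq_Suc_iff)
  define C where "C = a 0 + (\<Sum>i. \<epsilon> i)"
  have a_sum: "a t \<le> a 0 + (\<Sum>i<t. \<epsilon> i)" for t
  proof (induction t)
    case (Suc t)
    then show ?case using next_le[of t] step(2)[of t] by simp
  qed simp
  have partial: "(\<Sum>i<t. \<epsilon> i) \<le> (\<Sum>i. \<epsilon> i)" for t
    using \<epsilon> by (intro sum_le_suminf) auto
  show a_le: "Q_norm (\<tau> t) (z t - zbar) \<le> Q_norm (\<tau> 0) (z 0 - zbar) + (\<Sum>i. \<epsilon> i)" for t
    using a_sum[of t] partial[of t] by (simp add: a_def)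
  then have aC: "a t \<le> C" for t by (simp add: a_def C_def)
  have bC: "b t \<le> C" for t
    using a_sum[of t] partial[of "Suc t"] step(2)[of t] by (simp add: C_def)
  have nonneg: "0 \<le> a t" "0 \<le> b t" "0 \<le> d t" for t
    unfolding a_def b_def d_def using pos(2) by (simp_all add: Q_norm_nonneg)
  \<comment> \<open>Telescoping the squared estimate, with the cross term bounded through
    \<open>b t \<le> C\<close>; it makes the squared step lengths summable.\<close>
  have sum_d: "(\<Sum>t<n. (d t)\<^sup>2) \<le> (a 0)\<^sup>2 - (a n)\<^sup>2 + 2 * C * (\<Sum>t<n. \<epsilon> t)" for n
  proof (induction n)
    case (Suc n)
    have "(a (Suc n))\<^sup>2 \<le> (b n)\<^sup>2" using next_le nonneg by (intro power_mono)
    moreover have "2 * \<epsilon> n * b n \<le> 2 * \<epsilon> n * C" using bC \<epsilon>(1) by (intro mult_left_mono) auto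
    ultimately have "(d n)\<^sup>2 \<le> (a n)\<^sup>2 - (a (Suc n))\<^sup>2 + 2 * \<epsilon> n * C" using step(1)[of n] by linarith
    then show ?case using Suc by (simp add: algebra_simps)
  qed simp
  have "0 \<le> C" using nonneg(1) aC order_trans by blast
  have "summable (\<lambda>t. (d t)\<^sup>2)"
  proof (rule summableI_nonneg_bounded)
    fix n
    have "2 * C * (\<Sum>t<n. \<epsilon> t) \<le> 2 * C * (\<Sum>i. \<epsilon> i)"
      using \<open>0 \<le> C\<close> partial by (intro mult_left_mono) auto
    then show "(\<Sum>t<n. (d t)\<^sup>2) \<le> (a 0)\<^sup>2 + 2 * C * (\<Sum>i. \<epsilon> i)"
      using sum_d[of n] zero_le_power2[of "a n"] by linarith
  qed simp
  then have "(\<lambda>t. sqrt ((d t)\<^sup>2)) \<longlonglongrightarrow> sqrt 0"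
    by (intro tendsto_real_sqrt summable_LIMSEQ_zero)
  then have d_lim: "d \<longlonglongrightarrow> 0" using nonneg(3) by simp
  define u where "u t = (e t, 0, 0) + (1 / \<sigma> t) *\<^sub>R Q_op (\<tau> t) (z t - z (Suc t))" for t
  \<comment> \<open>The residual is the gradient error plus the scaled step. Applying
    \<open>Q_root\<close> twice costs one operator norm beyond \<open>d t\<close>, and the lower
    bound on \<open>\<sigma>\<close> together with the decrease of \<open>\<tau>\<close> makes all
    constants uniform in \<open>t\<close>.\<close>
  have u_le: "norm (u t) \<le> 1 / \<sigma>_min * \<epsilon> t + 1 / \<sigma>_min * (sqrt (max (\<tau> 0) 1) * d t)" for t
  proof -
    have inv: "1 / \<sigma> t \<le> 1 / \<sigma>_min" using \<sigma>(1) \<sigma>(2)[of t] by (simp add: frac_le)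
    have "min (sqrt (\<tau> t)) 1 / \<sigma> t \<le> 1 / \<sigma> t" using pos(1)[of t] by (intro divide_right_mono) auto
    also note inv
    finally have "min (sqrt (\<tau> t)) 1 / \<sigma> t * \<epsilon> t \<le> 1 / \<sigma>_min * \<epsilon> t"
      using \<epsilon>(1) by (intro mult_right_mono)
    then have 1: "norm (e t) \<le> 1 / \<sigma>_min * \<epsilon> t" using e[of t] by linarith
    have "norm (Q_op (\<tau> t) (z t - z (Suc t))) \<le> sqrt (max (\<tau> t) 1) * norm (Q_root (\<tau> t) (z t - z (Suc t)))"
      using norm_Q_root_le[OF pos(2), of t "Q_root (\<tau> t) (z t - z (Suc t))"] pos(2) by (simp add: Q_root_Q_root)
    also have "norm (Q_root (\<tau> t) (z t - z (Suc t))) = d t"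
      unfolding d_def Q_norm_minus_commute[OF pos(2), of t "z (Suc t)"] using pos(2) by (simp add: Q_norm_eq)
    also have "sqrt (max (\<tau> t) 1) * d t \<le> sqrt (max (\<tau> 0) 1) * d t"
      using \<tau>(1) nonneg(3) by (intro mult_right_mono real_sqrt_le_mono max.mono) (auto simp: decseq_def)
    finally have "1 / \<sigma> t * norm (Q_op (\<tau> t) (z t - z (Suc t))) \<le> 1 / \<sigma>_min * (sqrt (max (\<tau> 0) 1) * d t)"
      using inv \<sigma>(1) by (intro mult_mono) auto
    moreover have "norm (u t) \<le> norm (e t) + 1 / \<sigma> t * norm (Q_op (\<tau> t) (z t - z (Suc t)))"
      unfolding u_def
      by (rule order_trans[OF norm_triangle_ineq]) (use pos(1)[of t] in \<open>simp add: norm_Pair\<close>)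
    ultimately show ?thesis using 1 by linarith
  qed
  have "(\<lambda>t. 1 / \<sigma>_min * \<epsilon> t + 1 / \<sigma>_min * (sqrt (max (\<tau> 0) 1) * d t)) \<longlonglongrightarrow> 1 / \<sigma>_min * 0 + 1 / \<sigma>_min * (sqrt (max (\<tau> 0) 1) * 0)"
    by (intro tendsto_add tendsto_mult_left d_lim summable_LIMSEQ_zero[OF \<epsilon>(2)])
  then have "(\<lambda>t. 1 / \<sigma>_min * \<epsilon> t + 1 / \<sigma>_min * (sqrt (max (\<tau> 0) 1) * d t)) \<longlonglongrightarrow> 0" by simp
  then have u_lim: "u \<longlonglongrightarrow> 0"
    by (rule Lim_null_comparison[rotated]) (use u_le in simp)
  define m where "m = min (sqrt \<tau>_min) 1"
  have "0 < m" using \<tau>(2) by (simp add: m_def)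
  have "norm (z t) \<le> norm zbar + C / m" for t
  proof -
    have "m * norm (z t - zbar) \<le> min (sqrt (\<tau> t)) 1 * norm (z t - zbar)"
      unfolding m_def using \<tau>(3)[of t] by (intro mult_right_mono min.mono real_sqrt_le_mono) auto
    also have "\<dots> \<le> a t" unfolding a_def using norm_Q_root_ge[OF pos(2)] pos(2) by (simp add: Q_norm_eq)
    also have "\<dots> \<le> C" by (rule aC)
    finally have "norm (z t - zbar) \<le> C / m" using \<open>0 < m\<close> by (simp add: pos_le_divide_eq mult.commute)
    then show ?thesis using norm_triangle_sub[of "z t" zbar] by linarith
  qed
  \<comment> \<open>The shift is forced: \<open>u t\<close> is a residual at the new iterate
    \<open>z (Suc t)\<close>.\<close>
  then have "(\<lambda>t. z (Suc t)) \<longlonglongrightarrow> zbar"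
    by (rule KKT_map_sequence_tendsto[OF zbar z(1) z(2)[folded u_def] _ u_lim])
  then show "z \<longlonglongrightarrow> zbar" by (rule LIMSEQ_imp_Suc)
qed

subsection \<open>Linear rate\<close>

text \<open>For \<open>\<tau> < 1\<close> the ball of radius \<open>r\<close> in the \<open>Q\<close>-norm sticks out of the Euclidean ball on which
  the error bound is assumed. Exact proximal point steps of size \<open>s\<close> from an outer point decrease the
  residual and move by at most \<open>s\<close> times it; applying the bound at the first iterate inside the ball
  and letting \<open>s\<close> tend to \<open>0\<close> shows that the residual outside is still at least \<open>r / \<kappa>\<close>.\<close>

lemma error_bound_beyond_ball:
  fixes zbar :: "('p::finite, 'k::{finite,linorder}) mats \<times> ('p, 'k) mats \<times> ('p, 'k) mats"
  assumes S: "S \<in> Y" and \<mu>: "0 \<le> \<mu>1" "0 \<le> \<mu>2"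
    and zbar: "zbar \<in> Y \<times> Y \<times> Y" "0 \<in> KKT_map S \<mu>1 \<mu>2 zbar"
    and r: "0 < r"
    and bound: "\<And>w v. w \<in> Y \<times> Y \<times> Y \<Longrightarrow> v \<in> KKT_map S \<mu>1 \<mu>2 w \<Longrightarrow> norm (w - zbar) \<le> r \<Longrightarrow>
        norm (w - zbar) \<le> \<kappa> * norm v"
    and \<kappa>: "0 \<le> \<kappa>" and w: "w \<in> Y \<times> Y \<times> Y" "v \<in> KKT_map S \<mu>1 \<mu>2 w" "r < norm (w - zbar)"
  shows "r \<le> \<kappa> * norm v"
proof -
  have key: "r \<le> (\<kappa> + s) * norm v" if s: "0 < s" for s
  proof -
    let ?Y = "Y \<times> Y \<times> Y :: (('p, 'k) mats \<times> ('p, 'k) mats \<times> ('p, 'k) mats) set"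
    have "\<forall>y. \<exists>y'. y \<in> ?Y \<longrightarrow> y' \<in> ?Y \<and> (1 / s) *\<^sub>R Q_op 1 (y - y') \<in> KKT_map S \<mu>1 \<mu>2 y'"
      using KKT_map_resolvent[OF S \<mu> s zero_less_one] by metis
    then obtain J where J: "\<And>y. y \<in> ?Y \<Longrightarrow> J y \<in> ?Y"
      "\<And>y. y \<in> ?Y \<Longrightarrow> (1 / s) *\<^sub>R Q_op 1 (y - J y) \<in> KKT_map S \<mu>1 \<mu>2 (J y)"
      by metis
    have Q1: "Q_op 1 x = x" for x :: "('p, 'k) mats \<times> ('p, 'k) mats \<times> ('p, 'k) mats"
      by (cases x) (simp add: Q_op_def)
    define y where "y n = (J ^^ n) w" for n
    have y_Suc: "y (Suc n) = J (y n)" for n by (simp add: y_def)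
    have yY: "y n \<in> ?Y" for n by (induction n) (use w(1) J(1) y_Suc in \<open>auto simp: y_def\<close>)
    define u where "u n = (1 / s) *\<^sub>R (y n - y (Suc n))" for n
    have u: "u n \<in> KKT_map S \<mu>1 \<mu>2 (y (Suc n))" for n
      using J(2)[OF yY[of n]] by (simp add: Q1 u_def y_Suc)
    \<comment> \<open>The step is \<open>s\<close> times the new residual \<open>u n\<close>, so
      monotonicity between \<open>y n\<close> and \<open>y (Suc n)\<close> reads
      \<open>u n \<bullet> u n \<le> v' \<bullet> u n\<close>.\<close>
    have decrease: "norm (u n) \<le> norm v'" if "v' \<in> KKT_map S \<mu>1 \<mu>2 (y n)" for n v'
    proof -
      have "0 \<le> (v' - u n) \<bullet> (y n - y (Suc n))"
        by (rule KKT_map_monotone[OF that u yY yY])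
      also have "y n - y (Suc n) = s *\<^sub>R u n" using s by (simp add: u_def)
      finally have "u n \<bullet> u n \<le> v' \<bullet> u n" using s by (simp add: inner_diff_left zero_le_mult_iff)
      also have "\<dots> \<le> norm v' * norm (u n)" by (rule norm_cauchy_schwarz)
      finally have "norm (u n) * norm (u n) \<le> norm v' * norm (u n)"
        by (simp add: dot_square_norm power2_eq_square)
      then show ?thesis by (cases "norm (u n) = 0") auto
    qed
    have u_le: "norm (u n) \<le> norm v" for n
    proof (induction n)
      case 0
      then show ?case using decrease[of v 0] w(2) by (simp add: y_def)
    next
      case (Suc n)
      then show ?case using decrease[OF u, of n] by simp
    qed
    have "y \<longlonglongrightarrow> zbar"
    proof (rule inexact_proximal_point_converges(2)[OF zbar, where e = "\<lambda>_. 0" and \<sigma> = "\<lambda>_. s" and \<tau> = "\<lambda>_. 1"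
          and \<epsilon> = "\<lambda>_. 0" and \<sigma>_min = s and \<tau>_min = 1])
      show "y t \<in> ?Y" for t by (rule yY)
      show "(0, 0, 0) + (1 / s) *\<^sub>R Q_op 1 (y t - y (Suc t)) \<in> KKT_map S \<mu>1 \<mu>2 (y (Suc t))" for t
        using u[of t] by (simp add: Q1 u_def flip: zero_prod_def)
    qed (use s in \<open>auto simp: decseq_def\<close>)
    then obtain N where "dist (y N) zbar < r"
      using r by (meson lim_sequentially order_refl)
    then have N: "norm (y N - zbar) \<le> r" by (simp add: dist_norm)
    define n where "n = (LEAST n. norm (y n - zbar) \<le> r)"
    have n: "norm (y n - zbar) \<le> r" unfolding n_def using N by (rule LeastI)
    have "n \<noteq> 0" using n w(3) by (auto simp: y_def intro: ccontr)
    then obtain m where m: "n = Suc m" by (cases n) auto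
    have "\<not> norm (y m - zbar) \<le> r" using not_less_Least[of m "\<lambda>n. norm (y n - zbar) \<le> r"] m
      by (simp add: n_def)
    \<comment> \<open>The last iterate before entering the ball is outside, while its successor
      satisfies the error bound; the two are \<open>s * norm (u m)\<close> apart.\<close>
    then have "r < norm (y m - zbar)" by simp
    also have "\<dots> \<le> norm (y (Suc m) - zbar) + norm (y m - y (Suc m))"
      using norm_triangle_ineq[of "y (Suc m) - zbar" "y m - y (Suc m)"] by simp
    also have "norm (y m - y (Suc m)) = s * norm (u m)" using s by (simp add: u_def)
    also have "norm (y (Suc m) - zbar) \<le> \<kappa> * norm (u m)"
      using n m by (intro bound[OF yY u]) simp
    finally have "r \<le> (\<kappa> + s) * norm (u m)" by (simp add: distrib_right)
    also have "\<dots> \<le> (\<kappa> + s) * norm v" using \<kappa> s u_le by (intro mult_left_mono) auto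
    finally show ?thesis .
  qed
  show ?thesis
  proof (rule field_le_epsilon)
    fix d :: real assume "0 < d"
    \<comment> \<open>The step size \<open>d / (norm v + 1)\<close> keeps the excess
      \<open>s * norm v\<close> below \<open>d\<close> and is defined even when
      \<open>v = 0\<close>.\<close>
    have "0 < norm v + 1" by (rule add_nonneg_pos) auto
    then have "r \<le> (\<kappa> + d / (norm v + 1)) * norm v"
      using \<open>0 < d\<close> by (intro key divide_pos_pos)
    also have "\<dots> = \<kappa> * norm v + d * (norm v / (norm v + 1))" by (simp add: distrib_right)
    also have "d * (norm v / (norm v + 1)) \<le> d * 1"
      using \<open>0 < d\<close> \<open>0 < norm v + 1\<close> by (intro mult_left_mono) (auto simp: divide_le_eq)
    finally show "r \<le> \<kappa> * norm v + d" by simp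
  qed
qed

text \<open>With \<open>A\<close>, \<open>B\<close>, \<open>D\<close> the \<open>Q\<close>-distances
  from \<open>z\<close> to \<open>zbar\<close>, from \<open>w\<close> to \<open>zbar\<close> and
  from \<open>w\<close> to \<open>z\<close>, it suffices to combine
  \<open>\<sigma> * B \<le> \<kappa> * \<gamma> * D\<close> with \<open>B^2 + D^2 \<le> A^2\<close>
  and solve for \<open>B\<close>.\<close>

lemma exact_step_rate:
  fixes zbar :: "('p::finite, 'k::{finite,linorder}) mats \<times> ('p, 'k) mats \<times> ('p, 'k) mats"
  assumes S: "S \<in> Y" and \<mu>: "0 \<le> \<mu>1" "0 \<le> \<mu>2"
    and zbar: "zbar \<in> Y \<times> Y \<times> Y" "0 \<in> KKT_map S \<mu>1 \<mu>2 zbar"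
    and r: "0 < r"
    and bound: "\<And>w v. w \<in> Y \<times> Y \<times> Y \<Longrightarrow> v \<in> KKT_map S \<mu>1 \<mu>2 w \<Longrightarrow> norm (w - zbar) \<le> r \<Longrightarrow>
        norm (w - zbar) \<le> \<kappa> * norm v"
    and \<kappa>: "0 \<le> \<kappa>" and \<sigma>: "0 < \<sigma>" and \<tau>: "0 \<le> \<tau>"
    and w: "w \<in> Y \<times> Y \<times> Y" "(1 / \<sigma>) *\<^sub>R Q_op \<tau> (z - w) \<in> KKT_map S \<mu>1 \<mu>2 w"
    and start: "Q_norm \<tau> (z - zbar) \<le> r"
  shows "Q_norm \<tau> (w - zbar) \<le> \<kappa> * max \<tau> 1 / sqrt (\<sigma>\<^sup>2 + \<kappa>\<^sup>2 * (max \<tau> 1)\<^sup>2) * Q_norm \<tau> (z - zbar)"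
proof -
  define A B D where "A = Q_norm \<tau> (z - zbar)" and "B = Q_norm \<tau> (w - zbar)" and "D = Q_norm \<tau> (w - z)"
  define \<gamma> where "\<gamma> = max \<tau> 1"
  define u where "u = (1 / \<sigma>) *\<^sub>R Q_op \<tau> (z - w)"
  have w': "(0, 0, 0) + (1 / \<sigma>) *\<^sub>R Q_op \<tau> (z - w) \<in> KKT_map S \<mu>1 \<mu>2 w"
    using w(2) by (simp flip: zero_prod_def)
  have nonneg: "0 \<le> A" "0 \<le> B" "0 \<le> D" using \<tau> by (simp_all add: A_def B_def D_def Q_norm_nonneg)
  have BD: "B\<^sup>2 + D\<^sup>2 \<le> A\<^sup>2" and "B \<le> A"
    using inexact_step_Fejer[OF zbar w(1) w' \<sigma> \<tau>, of 0] \<tau> by (auto simp: A_def B_def D_def)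
  have \<gamma>: "1 \<le> \<gamma>" "sqrt \<gamma> * sqrt \<gamma> = \<gamma>" by (auto simp: \<gamma>_def)
  then have "1 \<le> sqrt \<gamma>" by simp
  have "norm (Q_op \<tau> (z - w)) \<le> sqrt \<gamma> * norm (Q_root \<tau> (z - w))"
    using norm_Q_root_le[OF \<tau>, of "Q_root \<tau> (z - w)"] \<tau> by (simp add: Q_root_Q_root \<gamma>_def)
  also have "norm (Q_root \<tau> (z - w)) = D"
    unfolding D_def Q_norm_minus_commute[OF \<tau>, of w] using \<tau> by (simp add: Q_norm_eq)
  finally have "\<sigma> * norm u \<le> sqrt \<gamma> * D" using \<sigma> by (simp add: u_def)
  then have "\<kappa> * (\<sigma> * norm u) \<le> \<kappa> * (sqrt \<gamma> * D)" using \<kappa> by (rule mult_left_mono)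
  then have u_le: "\<sigma> * (\<kappa> * norm u) \<le> \<kappa> * sqrt \<gamma> * D" by (simp add: mult_ac)
  have "\<sigma> * B \<le> \<kappa> * \<gamma> * D"
  proof (cases "norm (w - zbar) \<le> r")
    case True
    have "B \<le> sqrt \<gamma> * norm (w - zbar)"
      using norm_Q_root_le[OF \<tau>, of "w - zbar"] \<tau> by (simp add: B_def Q_norm_eq \<gamma>_def)
    also have "\<dots> \<le> sqrt \<gamma> * (\<kappa> * norm u)"
      using \<open>1 \<le> sqrt \<gamma>\<close> bound[OF w(1) w(2) True] by (intro mult_left_mono) (auto simp: u_def)
    finally have "\<sigma> * B \<le> \<sigma> * (sqrt \<gamma> * (\<kappa> * norm u))" using \<sigma> by (intro mult_left_mono) auto
    also have "\<dots> = sqrt \<gamma> * (\<sigma> * (\<kappa> * norm u))" by (simp add: mult_ac)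
    also have "\<dots> \<le> sqrt \<gamma> * (\<kappa> * sqrt \<gamma> * D)"
      using \<open>1 \<le> sqrt \<gamma>\<close> u_le by (intro mult_left_mono) auto
    also have "\<dots> = \<kappa> * (sqrt \<gamma> * sqrt \<gamma>) * D" by (simp only: mult_ac)
    finally show ?thesis unfolding \<gamma>(2) .
  next
    \<comment> \<open>Here \<open>w\<close> lies outside the Euclidean ball although
      \<open>B \<le> A \<le> r\<close>. The residual is then at least \<open>r / \<kappa>\<close>,
      so \<open>B\<close> is again bounded by \<open>\<kappa> * norm u\<close>, this time without
      the conversion factor \<open>sqrt \<gamma>\<close>.\<close>
    case False
    then have "r \<le> \<kappa> * norm u"
      unfolding u_def by (intro error_bound_beyond_ball[OF S \<mu> zbar r bound \<kappa> w]) auto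
    then have "B \<le> \<kappa> * norm u" using \<open>B \<le> A\<close> start by (simp add: A_def)
    then have "\<sigma> * B \<le> \<sigma> * (\<kappa> * norm u)" using \<sigma> by (intro mult_left_mono) auto
    also have "\<dots> \<le> \<kappa> * sqrt \<gamma> * D" by (rule u_le)
    also have "\<dots> \<le> \<kappa> * \<gamma> * D"
    proof -
      have "sqrt \<gamma> * 1 \<le> sqrt \<gamma> * sqrt \<gamma>" using \<open>1 \<le> sqrt \<gamma>\<close> by (intro mult_left_mono) auto
      then have "sqrt \<gamma> \<le> \<gamma>" using \<gamma>(2) by simp
      then show ?thesis using \<kappa> nonneg by (intro mult_right_mono mult_left_mono)
    qed
    finally show ?thesis .
  qed
  then have "(\<sigma> * B)\<^sup>2 \<le> (\<kappa> * \<gamma> * D)\<^sup>2" using \<sigma> nonneg by (intro power_mono) auto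
  also have "\<dots> \<le> (\<kappa> * \<gamma>)\<^sup>2 * (A\<^sup>2 - B\<^sup>2)"
    unfolding power_mult_distrib[of "\<kappa> * \<gamma>"] using BD by (intro mult_left_mono) auto
  finally have "(\<sigma>\<^sup>2 + \<kappa>\<^sup>2 * \<gamma>\<^sup>2) * B\<^sup>2 \<le> (\<kappa> * \<gamma> * A)\<^sup>2"
    by (simp add: power_mult_distrib algebra_simps)
  then have "sqrt ((\<sigma>\<^sup>2 + \<kappa>\<^sup>2 * \<gamma>\<^sup>2) * B\<^sup>2) \<le> sqrt ((\<kappa> * \<gamma> * A)\<^sup>2)" by (rule real_sqrt_le_mono)
  then have "sqrt (\<sigma>\<^sup>2 + \<kappa>\<^sup>2 * \<gamma>\<^sup>2) * B \<le> \<kappa> * \<gamma> * A"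
    using nonneg \<kappa> \<gamma>(1) by (simp add: real_sqrt_mult)
  moreover have "0 < sqrt (\<sigma>\<^sup>2 + \<kappa>\<^sup>2 * \<gamma>\<^sup>2)" using \<sigma> by (simp add: add_pos_nonneg)
  ultimately have "B \<le> \<kappa> * \<gamma> * A / sqrt (\<sigma>\<^sup>2 + \<kappa>\<^sup>2 * \<gamma>\<^sup>2)"
    by (simp add: pos_le_divide_eq mult.commute)
  then show ?thesis by (simp add: A_def B_def \<gamma>_def)
qed

text \<open>Inserting \<open>d \<le> B + A\<close> and absorbing \<open>\<delta> * B\<close> on the
  left gives the factor \<open>(\<delta> + \<rho>) / (1 - \<delta>)\<close>, which is then relaxed
  to the stated one.\<close>

lemma inexact_step_rate:
  fixes A B d \<delta> \<rho> :: real
  assumes "B \<le> \<delta> * d + \<rho> * A" "d \<le> B + A" "0 < \<delta>" "\<delta> < 1" "0 \<le> \<rho>" "0 \<le> A"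
  shows "B \<le> 1 / (1 - \<delta>) * (\<delta> + (1 + \<delta>) * \<rho>) * A"
proof -
  have "\<delta> * d \<le> \<delta> * (B + A)" using assms by (intro mult_left_mono) auto
  then have "(1 - \<delta>) * B \<le> (\<delta> + \<rho>) * A" using assms(1) by (simp add: algebra_simps)
  also have "\<dots> \<le> (\<delta> + (1 + \<delta>) * \<rho>) * A" using assms by (intro mult_right_mono) (auto simp: distrib_right)
  finally have "B \<le> (\<delta> + (1 + \<delta>) * \<rho>) * A / (1 - \<delta>)"
    using assms(4) by (simp add: pos_le_divide_eq mult.commute)
  then show ?thesis by simp
qed

section \<open>Optimality of KKT points and the limit of the rate\<close>

text \<open>At a KKT point \<open>- Xb\<close> is a subgradient of the loss and \<open>Xb\<close>
  one of the penalty, both at \<open>\<Theta>b\<close>; on the feasible set the two linear terms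
  cancel.\<close>

lemma KKT_primal_solution:
  fixes S Xb \<Theta>b \<Omega>b :: "('p::finite, 'k::{finite,linorder}) mats"
  assumes "(Xb, \<Theta>b, \<Omega>b) \<in> Y \<times> Y \<times> Y" "0 \<in> KKT_map S \<mu>1 \<mu>2 (Xb, \<Theta>b, \<Omega>b)"
  shows "primal_solution S \<mu>1 \<mu>2 (\<Theta>b, \<Theta>b)"
proof -
  have KKT: "\<Theta>b \<in> Ypd" "\<Omega>b = \<Theta>b" "S - inv_mats \<Theta>b = - Xb" "Xb \<in> subdiff Y (penalty \<mu>1 \<mu>2) \<Theta>b"
    using assms(2) unfolding zero_prod_def by (auto simp: KKT_map_iff algebra_simps eq_neg_iff_add_eq_0)
  have le: "loss S \<Theta>b + ereal (penalty \<mu>1 \<mu>2 \<Theta>b) \<le> loss S Z + ereal (penalty \<mu>1 \<mu>2 Z)" if "Z \<in> Y" for Z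
  proof (cases "Z \<in> Ypd")
    case True
    have "real_loss S \<Theta>b + (- Xb) \<bullet> (Z - \<Theta>b) \<le> real_loss S Z"
      using real_loss_tangent[OF KKT(1) True, of S] by (simp add: KKT(3))
    moreover have "penalty \<mu>1 \<mu>2 \<Theta>b + Xb \<bullet> (Z - \<Theta>b) \<le> penalty \<mu>1 \<mu>2 Z"
      using KKT(4) that by (simp add: subdiff_def)
    ultimately show ?thesis by (simp add: loss_Ypd True KKT(1))
  qed (simp add: loss_not_Ypd)
  then show ?thesis
    using KKT(1) by (auto simp: primal_solution_def is_arg_min_def loss_Ypd Ypd_imp_Y not_less)
qed

text \<open>The same two subgradient relations make \<open>\<Theta>b\<close> attain both conjugates,
  so the dual value at \<open>Xb\<close> equals the primal value at \<open>\<Theta>b\<close>, and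
  weak duality does the rest.\<close>

lemma KKT_dual_solution:
  fixes S Xb \<Theta>b \<Omega>b :: "('p::finite, 'k::{finite,linorder}) mats"
  assumes "(Xb, \<Theta>b, \<Omega>b) \<in> Y \<times> Y \<times> Y" "0 \<in> KKT_map S \<mu>1 \<mu>2 (Xb, \<Theta>b, \<Omega>b)"
  shows "dual_solution S \<mu>1 \<mu>2 Xb"
proof -
  have KKT: "\<Theta>b \<in> Ypd" "\<Omega>b = \<Theta>b" "S - inv_mats \<Theta>b = - Xb" "Xb \<in> subdiff Y (penalty \<mu>1 \<mu>2) \<Theta>b"
    using assms(2) unfolding zero_prod_def by (auto simp: KKT_map_iff algebra_simps eq_neg_iff_add_eq_0)
  have Y: "Xb \<in> Y" "\<Theta>b \<in> Y" using assms(1) by auto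
  let ?P = "\<lambda>\<Omega>. ereal (penalty \<mu>1 \<mu>2 \<Omega>)"
  have "conjugate Y (loss S) (- Xb) = ereal (- Xb \<bullet> \<Theta>b - real_loss S \<Theta>b)"
    unfolding conjugate_def
  proof (rule SUP_eqI)
    fix Z :: "('p, 'k) mats" assume "Z \<in> Y"
    show "ereal (- Xb \<bullet> Z) - loss S Z \<le> ereal (- Xb \<bullet> \<Theta>b - real_loss S \<Theta>b)"
    proof (cases "Z \<in> Ypd")
      case True
      have "real_loss S \<Theta>b + (- Xb) \<bullet> (Z - \<Theta>b) \<le> real_loss S Z"
        using real_loss_tangent[OF KKT(1) True, of S] by (simp add: KKT(3))
      then show ?thesis by (simp add: loss_Ypd True inner_diff_right)
    qed (simp add: loss_not_Ypd)
  next
    fix y assume "\<And>Z :: ('p, 'k) mats. Z \<in> Y \<Longrightarrow> ereal (- Xb \<bullet> Z) - loss S Z \<le> y"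
    from this[OF Y(2)] show "ereal (- Xb \<bullet> \<Theta>b - real_loss S \<Theta>b) \<le> y"
      by (simp add: loss_Ypd KKT(1))
  qed
  moreover have "conjugate Y ?P Xb = ereal (Xb \<bullet> \<Theta>b - penalty \<mu>1 \<mu>2 \<Theta>b)"
    unfolding conjugate_def
  proof (rule SUP_eqI)
    fix Z :: "('p, 'k) mats" assume "Z \<in> Y"
    then show "ereal (Xb \<bullet> Z) - ?P Z \<le> ereal (Xb \<bullet> \<Theta>b - penalty \<mu>1 \<mu>2 \<Theta>b)"
      using KKT(4) by (auto simp: subdiff_def inner_diff_right algebra_simps)
  next
    fix y assume "\<And>Z :: ('p, 'k) mats. Z \<in> Y \<Longrightarrow> ereal (Xb \<bullet> Z) - ?P Z \<le> y"
    from this[OF Y(2)] show "ereal (Xb \<bullet> \<Theta>b - penalty \<mu>1 \<mu>2 \<Theta>b) \<le> y" by simp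
  qed
  ultimately have val: "dual_objective S \<mu>1 \<mu>2 Xb = ereal (real_loss S \<Theta>b + penalty \<mu>1 \<mu>2 \<Theta>b)"
    by (simp add: dual_objective_def)
  \<comment> \<open>Weak duality: testing both suprema with \<open>\<Theta>b\<close> cancels the
    terms in \<open>X\<close>.\<close>
  have "dual_objective S \<mu>1 \<mu>2 X \<le> ereal (real_loss S \<Theta>b + penalty \<mu>1 \<mu>2 \<Theta>b)" for X
  proof -
    have "ereal (- X \<bullet> \<Theta>b) - loss S \<Theta>b \<le> conjugate Y (loss S) (- X)"
      unfolding conjugate_def using Y(2) by (rule SUP_upper)
    moreover have "ereal (X \<bullet> \<Theta>b) - ?P \<Theta>b \<le> conjugate Y ?P X"
      unfolding conjugate_def using Y(2) by (rule SUP_upper)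
    ultimately have "(ereal (- X \<bullet> \<Theta>b) - loss S \<Theta>b) + (ereal (X \<bullet> \<Theta>b) - ?P \<Theta>b)
        \<le> conjugate Y (loss S) (- X) + conjugate Y ?P X"
      by (rule add_mono)
    then have "ereal (- (real_loss S \<Theta>b + penalty \<mu>1 \<mu>2 \<Theta>b)) \<le> conjugate Y (loss S) (- X) + conjugate Y ?P X"
      by (simp add: loss_Ypd KKT(1))
    then show ?thesis unfolding dual_objective_def by (subst ereal_uminus_le_reorder) simp
  qed
  then show ?thesis
    using Y(1) by (auto simp: dual_solution_def is_arg_max_def val not_less)
qed

lemma rate_limit:
  fixes \<sigma> \<tau> \<delta> :: "nat \<Rightarrow> real" and \<sigma>_inf :: ereal
  assumes \<sigma>: "\<And>t. \<sigma> t > 0" "incseq \<sigma>" "(\<lambda>t. ereal (\<sigma> t)) \<longlonglongrightarrow> \<sigma>_inf"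
    and \<tau>: "\<tau> \<longlonglongrightarrow> \<tau>_inf" and \<delta>: "\<delta> \<longlonglongrightarrow> 0" and \<kappa>: "0 < \<kappa>"
  defines "\<rho>_inf \<equiv> if \<sigma>_inf = \<infinity> then 0
      else \<kappa> * max \<tau>_inf 1 / sqrt ((real_of_ereal \<sigma>_inf)\<^sup>2 + \<kappa>\<^sup>2 * (max \<tau>_inf 1)\<^sup>2)"
  shows "(\<lambda>t. 1 / (1 - \<delta> t) * (\<delta> t + (1 + \<delta> t) * \<kappa> * max (\<tau> t) 1 /
      sqrt ((\<sigma> t)\<^sup>2 + \<kappa>\<^sup>2 * (max (\<tau> t) 1)\<^sup>2))) \<longlonglongrightarrow> \<rho>_inf"
    and "\<rho>_inf < 1"
proof -
  define \<gamma> where "\<gamma> t = max (\<tau> t) 1" for t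
  define \<gamma>_inf where "\<gamma>_inf = max \<tau>_inf 1"
  have \<gamma>: "\<gamma> \<longlonglongrightarrow> \<gamma>_inf" unfolding \<gamma>_def \<gamma>_inf_def by (intro tendsto_intros \<tau>)
  have "1 \<le> \<gamma>_inf" by (simp add: \<gamma>_inf_def)
  have "\<sigma>_inf \<noteq> - \<infinity>"
    using LIMSEQ_le_const[OF \<sigma>(3), of 0] \<sigma>(1) by (force simp: less_imp_le)
  \<comment> \<open>Monotonicity gives \<open>\<sigma> 0 \<le> s\<close>, so a finite limit is
    positive; this yields both a nonzero denominator and the strict inequality of the limit with
    \<open>1\<close>.\<close>
  have fin: "\<exists>s. \<sigma>_inf = ereal s \<and> 0 < s \<and> \<sigma> \<longlonglongrightarrow> s" if not_inf: "\<sigma>_inf \<noteq> \<infinity>"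
  proof -
    obtain s where s: "\<sigma>_inf = ereal s" using not_inf \<open>\<sigma>_inf \<noteq> - \<infinity>\<close> by (cases \<sigma>_inf) auto
    then have "\<sigma> \<longlonglongrightarrow> s" using \<sigma>(3) by simp
    then have "\<sigma> 0 \<le> s" using incseq_le[OF \<sigma>(2)] by blast
    then show ?thesis using s \<open>\<sigma> \<longlonglongrightarrow> s\<close> \<sigma>(1)[of 0] by auto
  qed
  have "(\<lambda>t. \<kappa> * \<gamma> t / sqrt ((\<sigma> t)\<^sup>2 + \<kappa>\<^sup>2 * (\<gamma> t)\<^sup>2)) \<longlonglongrightarrow> \<rho>_inf"
  proof (cases "\<sigma>_inf = \<infinity>")
    case True
    then have "filterlim \<sigma> at_top sequentially" using \<sigma>(3) by (simp add: tendsto_PInfty_eq_at_top)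
    then have lim: "(\<lambda>t. \<kappa> * \<gamma> t / \<sigma> t) \<longlonglongrightarrow> 0"
      by (intro real_tendsto_divide_at_top[of _ "\<kappa> * \<gamma>_inf"] tendsto_mult_left \<gamma>)
    have "norm (\<kappa> * \<gamma> t / sqrt ((\<sigma> t)\<^sup>2 + \<kappa>\<^sup>2 * (\<gamma> t)\<^sup>2)) \<le> \<kappa> * \<gamma> t / \<sigma> t" for t
    proof -
      have "1 \<le> \<gamma> t" by (simp add: \<gamma>_def)
      have "\<sigma> t \<le> sqrt ((\<sigma> t)\<^sup>2 + \<kappa>\<^sup>2 * (\<gamma> t)\<^sup>2)" using \<sigma>(1)[of t] by (intro real_le_rsqrt) simp
      then show ?thesis using \<sigma>(1)[of t] \<kappa> \<open>1 \<le> \<gamma> t\<close> by (simp add: frac_le)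
    qed
    then have "(\<lambda>t. \<kappa> * \<gamma> t / sqrt ((\<sigma> t)\<^sup>2 + \<kappa>\<^sup>2 * (\<gamma> t)\<^sup>2)) \<longlonglongrightarrow> 0"
      by (intro Lim_null_comparison[OF _ lim] always_eventually) auto
    then show ?thesis using True by (simp add: \<rho>_inf_def)
  next
    case False
    then obtain s where s: "\<sigma>_inf = ereal s" "0 < s" "\<sigma> \<longlonglongrightarrow> s" using fin by blast
    then have "sqrt (s\<^sup>2 + \<kappa>\<^sup>2 * \<gamma>_inf\<^sup>2) \<noteq> 0" by (simp add: sum_power2_eq_zero_iff add_nonneg_eq_0_iff)
    then have "(\<lambda>t. \<kappa> * \<gamma> t / sqrt ((\<sigma> t)\<^sup>2 + \<kappa>\<^sup>2 * (\<gamma> t)\<^sup>2)) \<longlonglongrightarrow> \<kappa> * \<gamma>_inf / sqrt (s\<^sup>2 + \<kappa>\<^sup>2 * \<gamma>_inf\<^sup>2)"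
      by (intro tendsto_intros \<gamma> s(3))
    then show ?thesis using s(1) by (simp add: \<rho>_inf_def \<gamma>_inf_def)
  qed
  then have "(\<lambda>t. 1 / (1 - \<delta> t) * (\<delta> t + (1 + \<delta> t) * (\<kappa> * \<gamma> t / sqrt ((\<sigma> t)\<^sup>2 + \<kappa>\<^sup>2 * (\<gamma> t)\<^sup>2))))
      \<longlonglongrightarrow> 1 / (1 - 0) * (0 + (1 + 0) * \<rho>_inf)"
    by (intro tendsto_intros \<delta>) simp_all
  then show "(\<lambda>t. 1 / (1 - \<delta> t) * (\<delta> t + (1 + \<delta> t) * \<kappa> * max (\<tau> t) 1 /
      sqrt ((\<sigma> t)\<^sup>2 + \<kappa>\<^sup>2 * (max (\<tau> t) 1)\<^sup>2))) \<longlonglongrightarrow> \<rho>_inf"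
    by (simp add: \<gamma>_def mult.assoc)
  show "\<rho>_inf < 1"
  proof (cases "\<sigma>_inf = \<infinity>")
    case False
    then obtain s where s: "\<sigma>_inf = ereal s" "0 < s" using fin by blast
    have "\<kappa> * \<gamma>_inf < sqrt (s\<^sup>2 + \<kappa>\<^sup>2 * \<gamma>_inf\<^sup>2)"
      using s(2) by (intro real_less_rsqrt) (simp add: power_mult_distrib)
    moreover have "0 < \<kappa> * \<gamma>_inf" using \<kappa> \<open>1 \<le> \<gamma>_inf\<close> by simp
    ultimately have "\<kappa> * \<gamma>_inf / sqrt (s\<^sup>2 + \<kappa>\<^sup>2 * \<gamma>_inf\<^sup>2) < 1"
      by (subst divide_less_eq_1_pos) linarith+
    then show ?thesis using s(1) by (simp add: \<rho>_inf_def flip: \<gamma>_inf_def)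
  qed (simp add: \<rho>_inf_def)
qed

section \<open>The algorithm as an inexact proximal point method\<close>

text \<open>The \<open>\<Theta>\<close> and \<open>\<Omega>\<close> updates are exact once
  \<open>X (Suc t)\<close> is given, so only the first component carries an error. Membership in
  \<open>Y\<close> is proved by induction because a step is described by \<open>prox_step\<close>
  only when it starts in \<open>Y\<close>.\<close>

lemma prox_ALM_iterates_inclusion:
  fixes S :: "('p::finite, 'k::{finite,linorder}) mats"
  assumes S: "S \<in> Y" and \<mu>: "0 \<le> \<mu>1" "0 \<le> \<mu>2" and \<sigma>: "\<And>t. 0 < \<sigma> t" and \<tau>: "\<And>t. 0 \<le> \<tau> t"
    and z: "\<And>t. z t = (X t, \<Theta> t, \<Omega> t)"
    and iterates: "prox_ALM_iterates S \<mu>1 \<mu>2 \<sigma> X \<Theta> \<Omega>"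
  shows "z t \<in> Y \<times> Y \<times> Y"
    and "(gradient_on Y (subproblem S \<mu>1 \<mu>2 (\<sigma> t) (\<tau> t) (z t)) (fst (z (Suc t))), 0, 0)
      + (1 / \<sigma> t) *\<^sub>R Q_op (\<tau> t) (z t - z (Suc t)) \<in> KKT_map S \<mu>1 \<mu>2 (z (Suc t))"
proof -
  have X: "X (Suc t) \<in> Y" for t using iterates by (simp add: prox_ALM_iterates_def)
  have step: "prox_step S \<mu>1 \<mu>2 (\<sigma> t) (\<Theta> t) (\<Omega> t) (X (Suc t)) (\<Theta> (Suc t)) (\<Omega> (Suc t))"
    if Y: "\<Theta> t \<in> Y" "\<Omega> t \<in> Y" for t
  proof -
    obtain \<Theta>' \<Omega>' where s: "prox_step S \<mu>1 \<mu>2 (\<sigma> t) (\<Theta> t) (\<Omega> t) (X (Suc t)) \<Theta>' \<Omega>'"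
      using prox_step_exists[OF S Y X \<mu> \<sigma>] by blast
    have "\<Omega> (Suc t) = \<Omega>'"
      using prox_step_prox(1)[OF s \<sigma>] iterates by (simp add: prox_ALM_iterates_def)
    moreover have "\<Theta> (Suc t) $ k = \<Theta>' $ k" for k
      using prox_step_prox(2)[OF s \<sigma>] iterates by (simp add: prox_ALM_iterates_def)
    then have "\<Theta> (Suc t) = \<Theta>'" by (subst vec_eq_iff) blast
    ultimately show ?thesis using s by simp
  qed
  have mem: "\<Theta> t \<in> Y \<and> \<Omega> t \<in> Y" for t
  proof (induction t)
    case 0
    then show ?case using iterates by (simp add: prox_ALM_iterates_def Ypd_imp_Y)
  next
    case (Suc t)
    then show ?case using step[of t] by (simp add: prox_step_iff Ypd_imp_Y)
  qed
  have XY: "X t \<in> Y" for t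
    using iterates X by (cases t) (auto simp: prox_ALM_iterates_def Ypd_imp_Y)
  show "z t \<in> Y \<times> Y \<times> Y" using mem XY by (simp add: z)
  define g where "g = gradient_on Y (subproblem S \<mu>1 \<mu>2 (\<sigma> t) (\<tau> t) (z t)) (fst (z (Suc t)))"
  have s: "prox_step S \<mu>1 \<mu>2 (\<sigma> t) (\<Theta> t) (\<Omega> t) (X (Suc t)) (\<Theta> (Suc t)) (\<Omega> (Suc t))"
    using step mem by blast
  have "g = (\<Omega> (Suc t) - \<Theta> (Suc t)) + (\<tau> t / \<sigma> t) *\<^sub>R (X (Suc t) - X t)"
    using gradient_subproblem[OF S XY _ _ \<mu> \<sigma> \<tau> X s] mem by (simp add: g_def z)
  \<comment> \<open>The proximal part of the gradient cancels the \<open>X\<close>-component of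
    \<open>Q_op\<close>, leaving exactly the residual \<open>\<Omega> - \<Theta>\<close> that the
    KKT operator prescribes.\<close>
  then have "(g, 0, 0) + (1 / \<sigma> t) *\<^sub>R Q_op (\<tau> t) (z t - z (Suc t))
      = (- \<Theta> (Suc t) + \<Omega> (Suc t), (1 / \<sigma> t) *\<^sub>R (\<Theta> t - \<Theta> (Suc t)), (1 / \<sigma> t) *\<^sub>R (\<Omega> t - \<Omega> (Suc t)))"
    by (simp add: z Q_op_def scaleR_diff_right)
  then have "(g, 0, 0) + (1 / \<sigma> t) *\<^sub>R Q_op (\<tau> t) (z t - z (Suc t)) \<in> KKT_map S \<mu>1 \<mu>2 (z (Suc t))"
    using s by (simp add: prox_step_def z)
  then show "(gradient_on Y (subproblem S \<mu>1 \<mu>2 (\<sigma> t) (\<tau> t) (z t)) (fst (z (Suc t))), 0, 0)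
      + (1 / \<sigma> t) *\<^sub>R Q_op (\<tau> t) (z t - z (Suc t)) \<in> KKT_map S \<mu>1 \<mu>2 (z (Suc t))"
    by (simp add: g_def)
qed

theorem theorem7:
  fixes S :: "('p::finite, 'k::{finite,linorder}) mats"
    and \<mu>1 \<mu>2 \<tau>_inf :: real
    and \<sigma>_inf :: ereal
    and \<sigma> \<tau> \<epsilon> \<delta> :: "nat \<Rightarrow> real"
    and X \<Theta> \<Omega> :: "nat \<Rightarrow> ('p, 'k) mats"
    and z :: "nat \<Rightarrow> ('p, 'k) mats \<times> ('p, 'k) mats \<times> ('p, 'k) mats"
    and zbar :: "('p, 'k) mats \<times> ('p, 'k) mats \<times> ('p, 'k) mats"
  assumes S: "\<And>k. S $ k \<in> psd_mats"
    and \<mu>: "\<mu>1 > 0" "\<mu>2 > 0"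
    and \<sigma>: "\<And>t. \<sigma> t > 0" "incseq \<sigma>" "(\<lambda>t. ereal (\<sigma> t)) \<longlonglongrightarrow> \<sigma>_inf"
    and \<tau>: "decseq \<tau>" "\<tau> \<longlonglongrightarrow> \<tau>_inf" "\<tau>_inf > 0"
    and \<epsilon>: "\<And>t. \<epsilon> t > 0" "summable \<epsilon>"
    and \<delta>: "\<And>t. \<delta> t > 0" "summable \<delta>" "\<And>t. \<delta> t < 1"
    and z: "\<And>t. z t = (X t, \<Theta> t, \<Omega> t)"
    and iterates: "prox_ALM_iterates S \<mu>1 \<mu>2 \<sigma> X \<Theta> \<Omega>"
    and KKT: "zbar \<in> Y \<times> Y \<times> Y" "0 \<in> KKT_map S \<mu>1 \<mu>2 zbar"
  shows "(\<forall>w \<in> Y \<times> Y \<times> Y. 0 \<in> KKT_map S \<mu>1 \<mu>2 w \<longrightarrow> w = zbar)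
    \<and> ((\<forall>t. crit_A S \<mu>1 \<mu>2 \<sigma> \<tau> \<epsilon> z t) \<longrightarrow>
         bounded (range z)
         \<and> (\<exists>X_inf. dual_solution S \<mu>1 \<mu>2 X_inf \<and> X \<longlonglongrightarrow> X_inf)
         \<and> (\<exists>\<Theta>_inf. primal_solution S \<mu>1 \<mu>2 (\<Theta>_inf, \<Theta>_inf) \<and> \<Theta> \<longlonglongrightarrow> \<Theta>_inf))
    \<and> ((\<forall>t. crit_A S \<mu>1 \<mu>2 \<sigma> \<tau> \<epsilon> z t \<and> crit_B S \<mu>1 \<mu>2 \<sigma> \<tau> \<delta> z t) \<longrightarrow>
         (\<forall>r \<kappa>. r > 0 \<longrightarrow> \<kappa> > 0 \<longrightarrow>
            (\<forall>w \<in> Y \<times> Y \<times> Y. norm (w - zbar) \<le> r \<longrightarrow>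
               ereal (norm (w - zbar)) \<le> ereal \<kappa> * set_dist 0 (KKT_map S \<mu>1 \<mu>2 w)) \<longrightarrow>
            Q_norm (\<tau> 0) (z 0 - zbar) \<le> r - (\<Sum>i. \<epsilon> i) \<longrightarrow>
            (let \<gamma> = (\<lambda>t. max (\<tau> t) 1);
                 \<gamma>_inf = max \<tau>_inf 1;
                 \<zeta> = (\<lambda>t. 1 / (1 - \<delta> t) *
                        (\<delta> t + (1 + \<delta> t) * \<kappa> * \<gamma> t / sqrt ((\<sigma> t)\<^sup>2 + \<kappa>\<^sup>2 * (\<gamma> t)\<^sup>2)));
                 \<zeta>_inf = (if \<sigma>_inf = \<infinity> then 0
                       else \<kappa> * \<gamma>_inf / sqrt ((real_of_ereal \<sigma>_inf)\<^sup>2 + \<kappa>\<^sup>2 * \<gamma>_inf\<^sup>2))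
             in (\<forall>t. Q_norm (\<tau> t) (z (Suc t) - zbar) \<le> \<zeta> t * Q_norm (\<tau> t) (z t - zbar))
                \<and> \<zeta> \<longlonglongrightarrow> \<zeta>_inf \<and> \<zeta>_inf < 1)))"
proof -
  have SY: "S \<in> Y" using S by (auto simp: Y_def psd_mats_def)
  have \<mu>0: "0 \<le> \<mu>1" "0 \<le> \<mu>2" using \<mu> by auto
  have \<tau>_ge: "\<tau>_inf \<le> \<tau> t" for t using \<tau>(1,2) by (rule decseq_ge)
  have \<tau>_pos: "0 < \<tau> t" for t using \<tau>_ge[of t] \<tau>(3) by linarith
  have \<sigma>_ge: "\<sigma> 0 \<le> \<sigma> t" for t using \<sigma>(2) by (simp add: incseq_def)
  obtain Xb \<Theta>b \<Omega>b where zb: "zbar = (Xb, \<Theta>b, \<Omega>b)" by (cases zbar)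
  define e where "e t = gradient_on Y (subproblem S \<mu>1 \<mu>2 (\<sigma> t) (\<tau> t) (z t)) (fst (z (Suc t)))" for t
  have zY: "z t \<in> Y \<times> Y \<times> Y" for t
    using prox_ALM_iterates_inclusion(1)[OF SY \<mu>0 \<sigma>(1) less_imp_le[OF \<tau>_pos] z iterates] .
  have incl: "(e t, 0, 0) + (1 / \<sigma> t) *\<^sub>R Q_op (\<tau> t) (z t - z (Suc t)) \<in> KKT_map S \<mu>1 \<mu>2 (z (Suc t))" for t
    unfolding e_def
    using prox_ALM_iterates_inclusion(2)[OF SY \<mu>0 \<sigma>(1) less_imp_le[OF \<tau>_pos] z iterates] .
  \<comment> \<open>Uniform lower bounds come from monotonicity: \<open>\<sigma> 0\<close> for the
    increasing \<open>\<sigma>\<close> and the limit \<open>\<tau>_inf\<close> for the decreasing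
    \<open>\<tau>\<close>. Criterion (A) remains as a premise, to be supplied in each part.\<close>
  note conv = inexact_proximal_point_converges[OF KKT zY incl \<sigma>(1)[of 0] \<sigma>_ge \<tau>(1) \<tau>(3) \<tau>_ge
      less_imp_le[OF \<epsilon>(1)] \<epsilon>(2)]
  show ?thesis
  proof (intro conjI impI allI)
    show "\<forall>w \<in> Y \<times> Y \<times> Y. 0 \<in> KKT_map S \<mu>1 \<mu>2 w \<longrightarrow> w = zbar"
      using KKT_map_zero_unique[OF KKT] by blast
  next
    assume A: "\<forall>t. crit_A S \<mu>1 \<mu>2 \<sigma> \<tau> \<epsilon> z t"
    then have lim: "z \<longlonglongrightarrow> zbar" by (intro conv(2)) (simp add: crit_A_def e_def)
    then show "bounded (range z)" by (rule convergent_imp_bounded)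
    have "X \<longlonglongrightarrow> Xb" "\<Theta> \<longlonglongrightarrow> \<Theta>b"
      using tendsto_fst[OF lim] tendsto_fst[OF tendsto_snd[OF lim]] by (simp_all add: z zb)
    then show "\<exists>X_inf. dual_solution S \<mu>1 \<mu>2 X_inf \<and> X \<longlonglongrightarrow> X_inf"
      "\<exists>\<Theta>_inf. primal_solution S \<mu>1 \<mu>2 (\<Theta>_inf, \<Theta>_inf) \<and> \<Theta> \<longlonglongrightarrow> \<Theta>_inf"
      using KKT_dual_solution KKT_primal_solution KKT unfolding zb by blast+
  next
    fix r \<kappa> :: real
    assume crit: "\<forall>t. crit_A S \<mu>1 \<mu>2 \<sigma> \<tau> \<epsilon> z t \<and> crit_B S \<mu>1 \<mu>2 \<sigma> \<tau> \<delta> z t"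
      and r: "0 < r" and \<kappa>: "0 < \<kappa>"
      and dist_bound: "\<forall>w \<in> Y \<times> Y \<times> Y. norm (w - zbar) \<le> r \<longrightarrow>
        ereal (norm (w - zbar)) \<le> ereal \<kappa> * set_dist 0 (KKT_map S \<mu>1 \<mu>2 w)"
      and start: "Q_norm (\<tau> 0) (z 0 - zbar) \<le> r - (\<Sum>i. \<epsilon> i)"
    \<comment> \<open>Restating the distance bound for each element of the operator value removes
      infinite distances: where the value is empty there is no \<open>v\<close> to consider.\<close>
    have bound: "norm (w - zbar) \<le> \<kappa> * norm v"
      if "w \<in> Y \<times> Y \<times> Y" "v \<in> KKT_map S \<mu>1 \<mu>2 w" "norm (w - zbar) \<le> r" for w v
    proof -
      have "set_dist 0 (KKT_map S \<mu>1 \<mu>2 w) \<le> ereal (dist 0 v)"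
        unfolding set_dist_def using that(2) by (rule INF_lower)
      then have "ereal \<kappa> * set_dist 0 (KKT_map S \<mu>1 \<mu>2 w) \<le> ereal \<kappa> * ereal (norm v)"
        using \<kappa> by (intro ereal_mult_left_mono) auto
      with dist_bound that have "ereal (norm (w - zbar)) \<le> ereal \<kappa> * ereal (norm v)"
        using order_trans by blast
      then show ?thesis by simp
    qed
    have contraction: "Q_norm (\<tau> t) (z (Suc t) - zbar) \<le> 1 / (1 - \<delta> t) *
        (\<delta> t + (1 + \<delta> t) * (\<kappa> * max (\<tau> t) 1 / sqrt ((\<sigma> t)\<^sup>2 + \<kappa>\<^sup>2 * (max (\<tau> t) 1)\<^sup>2))) *
        Q_norm (\<tau> t) (z t - zbar)" for t
    proof (rule inexact_step_rate)
      have \<tau>0: "0 \<le> \<tau> t" using \<tau>_pos[of t] by simp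
      obtain w where w: "w \<in> Y \<times> Y \<times> Y" "(1 / \<sigma> t) *\<^sub>R Q_op (\<tau> t) (z t - w) \<in> KKT_map S \<mu>1 \<mu>2 w"
        using KKT_map_resolvent[OF SY \<mu>0 \<sigma>(1) \<tau>_pos zY] by blast
      have "Q_norm (\<tau> t) (z t - zbar) \<le> Q_norm (\<tau> 0) (z 0 - zbar) + (\<Sum>i. \<epsilon> i)"
        using crit by (intro conv(1)) (simp add: crit_A_def e_def)
      \<comment> \<open>The sum of the errors reserved in the starting condition is exactly what the
        distance to the solution can gain along the iteration.\<close>
      with start have "Q_norm (\<tau> t) (z t - zbar) \<le> r" by simp
      then have exact: "Q_norm (\<tau> t) (w - zbar) \<le>
          \<kappa> * max (\<tau> t) 1 / sqrt ((\<sigma> t)\<^sup>2 + \<kappa>\<^sup>2 * (max (\<tau> t) 1)\<^sup>2) * Q_norm (\<tau> t) (z t - zbar)"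
        using exact_step_rate[OF SY \<mu>0 KKT r bound less_imp_le[OF \<kappa>] \<sigma>(1) \<tau>0 w] by blast
      let ?d = "Q_norm (\<tau> t) (z (Suc t) - z t)"
      have d: "0 \<le> \<delta> t * ?d" using \<delta>(1)[of t] \<tau>0 by (simp add: Q_norm_nonneg)
      have "norm (e t) \<le> \<delta> t * min (sqrt (\<tau> t)) 1 / \<sigma> t * ?d"
        using crit by (simp add: crit_B_def e_def)
      from error_bound_scale[OF this \<sigma>(1) d]
      have "Q_norm (\<tau> t) (z (Suc t) - w) \<le> \<delta> t * ?d"
        by (rule inexact_step_close[OF w zY incl \<sigma>(1) \<tau>0 d])
      with exact Q_norm_triangle[OF \<tau>0, of "z (Suc t)" zbar w]
      show "Q_norm (\<tau> t) (z (Suc t) - zbar) \<le> \<delta> t * ?d +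
          \<kappa> * max (\<tau> t) 1 / sqrt ((\<sigma> t)\<^sup>2 + \<kappa>\<^sup>2 * (max (\<tau> t) 1)\<^sup>2) * Q_norm (\<tau> t) (z t - zbar)"
        by linarith
      show "?d \<le> Q_norm (\<tau> t) (z (Suc t) - zbar) + Q_norm (\<tau> t) (z t - zbar)"
        using Q_norm_triangle[OF \<tau>0, of "z (Suc t)" "z t" zbar] Q_norm_minus_commute[OF \<tau>0, of zbar "z t"]
        by simp
      show "0 \<le> Q_norm (\<tau> t) (z t - zbar)" using \<tau>0 by (rule Q_norm_nonneg)
    qed (use \<delta> \<kappa> in auto)
    show "let \<gamma> = (\<lambda>t. max (\<tau> t) 1);
                 \<gamma>_inf = max \<tau>_inf 1;
                 \<zeta> = (\<lambda>t. 1 / (1 - \<delta> t) *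
                        (\<delta> t + (1 + \<delta> t) * \<kappa> * \<gamma> t / sqrt ((\<sigma> t)\<^sup>2 + \<kappa>\<^sup>2 * (\<gamma> t)\<^sup>2)));
                 \<zeta>_inf = (if \<sigma>_inf = \<infinity> then 0
                       else \<kappa> * \<gamma>_inf / sqrt ((real_of_ereal \<sigma>_inf)\<^sup>2 + \<kappa>\<^sup>2 * \<gamma>_inf\<^sup>2))
             in (\<forall>t. Q_norm (\<tau> t) (z (Suc t) - zbar) \<le> \<zeta> t * Q_norm (\<tau> t) (z t - zbar))
                \<and> \<zeta> \<longlonglongrightarrow> \<zeta>_inf \<and> \<zeta>_inf < 1"
      unfolding Let_def
    proof (intro conjI allI)
      show "Q_norm (\<tau> t) (z (Suc t) - zbar) \<le> 1 / (1 - \<delta> t) *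
          (\<delta> t + (1 + \<delta> t) * \<kappa> * max (\<tau> t) 1 / sqrt ((\<sigma> t)\<^sup>2 + \<kappa>\<^sup>2 * (max (\<tau> t) 1)\<^sup>2)) *
          Q_norm (\<tau> t) (z t - zbar)" for t
        using contraction[of t] by (simp only: mult.assoc times_divide_eq_right)
    qed (rule rate_limit[OF \<sigma> \<tau>(2) summable_LIMSEQ_zero[OF \<delta>(2)] \<kappa>])+
  qed
qed

end
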